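(* Let $\mathcal{A}$ be an algebraic heart of a bounded t-structure of a triangulated category $\mathcal{D}$ that we can tilt indefinitely. If there are only finitely many Grothendieck classes of endo-trivial objects in $\mathcal{A}$, or only finitely many torsion classes in $\mathcal{A}$, then the Hasse quiver $\mathfrak{H}^{\mathcal{A}}(\mathrm{tors})$ of the poset of torsion classes in $\mathcal{A}$ coincides with the opposite quiver of the exchange quiver of $\mathcal{A}$ (under the identification of torsion classes in $\mathcal{A}$ with intermediate t-structures).
   Context: **Tilting.** For objects or full subcategories $E_i$, $\langle E_i\rangle$ denotes the extension-closed full subcategory generated by them. A heart $\mathcal{A}$ of a bounded t-structure is algebraic if every object has finite length and there are finitely many simple objects (up to isomorphism). A torsion pair in an abelian category $\mathcal{A}$ is a pair of full subcategories $(\mathcal{T},\mathcal{F})$ with $\mathrm{Hom}(T,F)=0$ for $T\in\mathcal{T},F\in\mathcal{F}$ and such that every $E\in\mathcal{A}$ fits into a short exact sequence $0\to T\to E\to F\to 0$ with $T\in\mathcal{T}$, $F\in\mathcal{F}$; then $\mathcal{T}$ is called a torsion class. The left tilt of a heart $\mathcal{A}\subset\mathcal{D}$ at $(\mathcal{T},\mathcal{F})$ is the heart $\{E\in\mathcal{D}: H^i(E)=0 \text{ for } i\notin\{0,1\},\ H^0(E)\in\mathcal{F},\ H^1(E)\in\mathcal{T}\}=\langle\mathcal{F},\mathcal{T}[-1]\rangle$, with $H^i$ the cohomology with respect to $\mathcal{A}$. For a simple object $S$ of an algebraic heart $\mathcal{A}$, the simple (left) tilt of $\mathcal{A}$ at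 $S$ is the left tilt at the torsion pair $(\langle S\rangle,\{E\in\mathcal{A}:\mathrm{Hom}(S,E)=0\})$. We can tilt an algebraic heart $\mathcal{A}$ with $n$ simple objects indefinitely if every heart obtained from $\mathcal{A}$ by a finite sequence of simple tilts is again algebraic with $n$ simple objects. **Endo-trivial.** An object $E$ of $\mathcal{A}$ is endo-trivial if $\mathrm{Hom}_{\mathcal{A}}(E,E)$ is a skew field. Its Grothendieck class is its class in $K(\mathcal{A})=K(\mathcal{D})$. **Posets and quivers.** A t-structure is viewed as a full subcategory $\mathcal{C}\subset\mathcal{D}$ with $\mathcal{C}[1]\subset\mathcal{C}$ (its aisle); bounded t-structures are ordered by $\mathcal{C}_1\leq\mathcal{C}_2\Leftrightarrow\mathcal{C}_1\subset\mathcal{C}_2$. Let $\mathcal{C}$ be the t-structure with heart $\mathcal{A}$. A bounded t-structure $\mathcal{C}'$ is intermediate if $\mathcal{C}\leq\mathcal{C}'\leq\mathcal{C}[-1]$. The intermediate t-structures are identified, as posets, with the torsion classes $\mathcal{T}$ in $\mathcal{A}$ ordered by inclusion: $\mathcal{T}$ corresponds to the t-structure whose heart is the left tilt $\langle\mathcal{F},\mathcal{T}[-1]\rangle$ of $\mathcal{A}$ at $(\mathcal{T},\mathcal{F})$. The Hasse quiver of a poset has the elements as vertices and an arrow $x\to y$ whenever $x>y$ and there is no $z$ with $x>z>y$. The exchange quiver of $\mathcal{A}$ has the intermediate t-structures as vertices, and an arrow $\mathcal{C}_1\to\mathcal{C}_2$ whenever $\mathcal{C}_2$ is obtained from $\mathcal{C}_1$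 by a simple (left) tilt, i.e. the heart of $\mathcal{C}_1$ is algebraic and the heart of $\mathcal{C}_2$ is a simple tilt of it. The opposite quiver is the quiver with all arrows reversed. *)

theory Defs
  imports "HOL-Algebra.Ring" "HOL-Algebra.Generated_Groups" "HOL-Algebra.Free_Abelian_Groups"
begin

section \<open>Additive categories\<close>

text \<open>
  Composition is written in the usual order: \<open>g \<cdot> f\<close> is ``first \<open>f\<close>, then \<open>g\<close>''.  The sum of two
  morphisms is only meaningful if they are parallel, and \<open>Zero X Y\<close> is the zero morphism
  from \<open>X\<close> to \<open>Y\<close>.
\<close>

record ('o, 'm) precategory =
  Ob :: "'o set"
  Mor :: "'m set"
  Dom :: "'m \<Rightarrow> 'o"
  Cod :: "'m \<Rightarrow> 'o"
  Ide :: "'o \<Rightarrow> 'm"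
  Comp :: "'m \<Rightarrow> 'm \<Rightarrow> 'm"  (infixr "\<cdot>\<index>" 70)
  Plus :: "'m \<Rightarrow> 'm \<Rightarrow> 'm"
  Zero :: "'o \<Rightarrow> 'o \<Rightarrow> 'm"

definition Hom :: "('o, 'm, 'z) precategory_scheme \<Rightarrow> 'o \<Rightarrow> 'o \<Rightarrow> 'm set" where
  "Hom D X Y = {f \<in> Mor D. Dom D f = X \<and> Cod D f = Y}"

definition hom_group :: "('o, 'm, 'z) precategory_scheme \<Rightarrow> 'o \<Rightarrow> 'o \<Rightarrow> 'm monoid" where
  "hom_group D X Y = \<lparr>carrier = Hom D X Y, monoid.mult = Plus D, one = Zero D X Y\<rparr>"

definition neg :: "('o, 'm, 'z) precategory_scheme \<Rightarrow> 'm \<Rightarrow> 'm" where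
  "neg D f = inv\<^bsub>hom_group D (Dom D f) (Cod D f)\<^esub> f"

definition is_iso :: "('o, 'm, 'z) precategory_scheme \<Rightarrow> 'm \<Rightarrow> bool" where
  "is_iso D f \<longleftrightarrow> f \<in> Mor D \<and>
     (\<exists>g\<in>Hom D (Cod D f) (Dom D f). g \<cdot>\<^bsub>D\<^esub> f = Ide D (Dom D f) \<and> f \<cdot>\<^bsub>D\<^esub> g = Ide D (Cod D f))"

definition isomorphic :: "('o, 'm, 'z) precategory_scheme \<Rightarrow> 'o \<Rightarrow> 'o \<Rightarrow> bool" where
  "isomorphic D X Y \<longleftrightarrow> (\<exists>f\<in>Hom D X Y. is_iso D f)"

definition is_zero :: "('o, 'm, 'z) precategory_scheme \<Rightarrow> 'o \<Rightarrow> bool" where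
  "is_zero D Z \<longleftrightarrow> Z \<in> Ob D \<and>
     (\<forall>X\<in>Ob D. (\<exists>!f. f \<in> Hom D X Z) \<and> (\<exists>!f. f \<in> Hom D Z X))"

locale category =
  fixes D :: "('o, 'm, 'z) precategory_scheme" (structure)
  assumes Dom_in: "f \<in> Mor D \<Longrightarrow> Dom D f \<in> Ob D"
    and Cod_in: "f \<in> Mor D \<Longrightarrow> Cod D f \<in> Ob D"
    and Ide_in: "X \<in> Ob D \<Longrightarrow> Ide D X \<in> Hom D X X"
    and Comp_in: "f \<in> Hom D X Y \<Longrightarrow> g \<in> Hom D Y Z \<Longrightarrow> g \<cdot> f \<in> Hom D X Z"
    and Comp_Ide: "f \<in> Hom D X Y \<Longrightarrow> f \<cdot> Ide D X = f"
    and Ide_Comp: "f \<in> Hom D X Y \<Longrightarrow> Ide D Y \<cdot> f = f"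
    and Comp_assoc: "f \<in> Hom D W X \<Longrightarrow> g \<in> Hom D X Y \<Longrightarrow> h \<in> Hom D Y Z
      \<Longrightarrow> (h \<cdot> g) \<cdot> f = h \<cdot> (g \<cdot> f)"

locale additive_category = category +
  assumes hom_comm_group: "X \<in> Ob D \<Longrightarrow> Y \<in> Ob D \<Longrightarrow> comm_group (hom_group D X Y)"
    and Comp_Plus: "f \<in> Hom D X Y \<Longrightarrow> f' \<in> Hom D X Y \<Longrightarrow> g \<in> Hom D Y Z
      \<Longrightarrow> g \<cdot> Plus D f f' = Plus D (g \<cdot> f) (g \<cdot> f')"
    and Plus_Comp: "f \<in> Hom D X Y \<Longrightarrow> g \<in> Hom D Y Z \<Longrightarrow> g' \<in> Hom D Y Z
      \<Longrightarrow> Plus D g g' \<cdot> f = Plus D (g \<cdot> f) (g' \<cdot> f)"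
    and zero_object: "\<exists>Z. is_zero D Z"
    and biproducts: "X \<in> Ob D \<Longrightarrow> Y \<in> Ob D \<Longrightarrow>
      \<exists>Z\<in>Ob D. \<exists>i\<in>Hom D X Z. \<exists>j\<in>Hom D Y Z. \<exists>p\<in>Hom D Z X. \<exists>q\<in>Hom D Z Y.
        p \<cdot> i = Ide D X \<and> q \<cdot> j = Ide D Y \<and> p \<cdot> j = Zero D Y X \<and> q \<cdot> i = Zero D X Y \<and>
        Plus D (i \<cdot> p) (j \<cdot> q) = Ide D Z"

definition full_sub ::
  "('o, 'm, 'z) precategory_scheme \<Rightarrow> 'o set \<Rightarrow> ('o, 'm, 'z) precategory_scheme" where
  "full_sub D X = D\<lparr>Ob := Ob D \<inter> X, Mor := {f \<in> Mor D. Dom D f \<in> X \<and> Cod D f \<in> X}\<rparr>"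

text \<open>
  Throughout, a full subcategory is represented by its set of objects and is understood to be
  strict, i.e. closed under isomorphism.  This is what makes ``finitely many torsion classes'' and
  the inclusion order on torsion classes and t-structures meaningful.
\<close>

definition strict_full :: "('o, 'm, 'z) precategory_scheme \<Rightarrow> 'o set \<Rightarrow> bool" where
  "strict_full D X \<longleftrightarrow> X \<subseteq> Ob D \<and> (\<forall>E\<in>X. \<forall>F\<in>Ob D. isomorphic D E F \<longrightarrow> F \<in> X)"

definition right_perp :: "('o, 'm, 'z) precategory_scheme \<Rightarrow> 'o set \<Rightarrow> 'o set" where
  "right_perp D X = {F \<in> Ob D. \<forall>E\<in>X. Hom D E F = {Zero D E F}}"


section \<open>Exact sequences, finite length and torsion pairs in an abelian category\<close>

definition is_kernel :: "('o, 'm, 'z) precategory_scheme \<Rightarrow> 'm \<Rightarrow> 'm \<Rightarrow> bool" where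
  "is_kernel A k f \<longleftrightarrow> k \<in> Mor A \<and> f \<in> Mor A \<and> Cod A k = Dom A f \<and>
     f \<cdot>\<^bsub>A\<^esub> k = Zero A (Dom A k) (Cod A f) \<and>
     (\<forall>g\<in>Mor A. Cod A g = Dom A f \<and> f \<cdot>\<^bsub>A\<^esub> g = Zero A (Dom A g) (Cod A f)
        \<longrightarrow> (\<exists>!u. u \<in> Hom A (Dom A g) (Dom A k) \<and> k \<cdot>\<^bsub>A\<^esub> u = g))"

definition is_cokernel :: "('o, 'm, 'z) precategory_scheme \<Rightarrow> 'm \<Rightarrow> 'm \<Rightarrow> bool" where
  "is_cokernel A c f \<longleftrightarrow> c \<in> Mor A \<and> f \<in> Mor A \<and> Dom A c = Cod A f \<and>
     c \<cdot>\<^bsub>A\<^esub> f = Zero A (Dom A f) (Cod A c) \<and>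
     (\<forall>g\<in>Mor A. Dom A g = Cod A f \<and> g \<cdot>\<^bsub>A\<^esub> f = Zero A (Dom A f) (Cod A g)
        \<longrightarrow> (\<exists>!u. u \<in> Hom A (Cod A c) (Cod A g) \<and> u \<cdot>\<^bsub>A\<^esub> c = g))"

definition short_exact :: "('o, 'm, 'z) precategory_scheme \<Rightarrow> 'm \<Rightarrow> 'm \<Rightarrow> bool" where
  "short_exact A f g \<longleftrightarrow> is_kernel A f g \<and> is_cokernel A g f"

definition is_mono :: "('o, 'm, 'z) precategory_scheme \<Rightarrow> 'm \<Rightarrow> bool" where
  "is_mono A f \<longleftrightarrow> f \<in> Mor A \<and>
     (\<forall>X\<in>Ob A. \<forall>u\<in>Hom A X (Dom A f). \<forall>v\<in>Hom A X (Dom A f). f \<cdot>\<^bsub>A\<^esub> u = f \<cdot>\<^bsub>A\<^esub> v \<longrightarrow> u = v)"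

definition simple_object :: "('o, 'm, 'z) precategory_scheme \<Rightarrow> 'o \<Rightarrow> bool" where
  "simple_object A S \<longleftrightarrow> S \<in> Ob A \<and> \<not> is_zero A S \<and>
     (\<forall>f. is_mono A f \<and> Cod A f = S \<longrightarrow> is_zero A (Dom A f) \<or> is_iso A f)"

text \<open>Objects with a finite composition series.\<close>

inductive_set finite_length :: "('o, 'm, 'z) precategory_scheme \<Rightarrow> 'o set"
  for A :: "('o, 'm, 'z) precategory_scheme" where
  fl_zero: "is_zero A Z \<Longrightarrow> Z \<in> finite_length A"
| fl_step: "short_exact A f g \<Longrightarrow> Dom A f \<in> finite_length A \<Longrightarrow> simple_object A (Cod A g)
    \<Longrightarrow> Cod A f \<in> finite_length A"

definition simple_classes :: "('o, 'm, 'z) precategory_scheme \<Rightarrow> 'o set set" where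
  "simple_classes A = (\<lambda>S. {E \<in> Ob A. isomorphic A S E}) ` {S. simple_object A S}"

definition torsion_pair ::
  "('o, 'm, 'z) precategory_scheme \<Rightarrow> 'o set \<Rightarrow> 'o set \<Rightarrow> bool" where
  "torsion_pair A T F \<longleftrightarrow> strict_full A T \<and> strict_full A F \<and>
     (\<forall>X\<in>T. \<forall>Y\<in>F. Hom A X Y = {Zero A X Y}) \<and>
     (\<forall>E\<in>Ob A. \<exists>f g. short_exact A f g \<and> Cod A f = E \<and> Dom A f \<in> T \<and> Cod A g \<in> F)"

definition torsion_classes :: "('o, 'm, 'z) precategory_scheme \<Rightarrow> 'o set set" where
  "torsion_classes A = {T. \<exists>F. torsion_pair A T F}"

definition end_ring :: "('o, 'm, 'z) precategory_scheme \<Rightarrow> 'o \<Rightarrow> 'm ring" where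
  "end_ring A E = \<lparr>carrier = Hom A E E, monoid.mult = Comp A, one = Ide A E,
     ring.zero = Zero A E E, add = Plus A\<rparr>"

definition skew_field :: "('a, 'b) ring_scheme \<Rightarrow> bool" where
  "skew_field R \<longleftrightarrow> ring R \<and> Units R = carrier R - {\<zero>\<^bsub>R\<^esub>}"

definition endo_trivial :: "('o, 'm, 'z) precategory_scheme \<Rightarrow> 'o \<Rightarrow> bool" where
  "endo_trivial A E \<longleftrightarrow> E \<in> Ob A \<and> skew_field (end_ring A E)"

text \<open>
  The Grothendieck group of \<open>A\<close> is the quotient of the free abelian group on the objects by the
  subgroup generated by the short exact sequences; the class of an object is the corresponding
  coset.
\<close>

definition grothendieck_relations ::
  "('o, 'm, 'z) precategory_scheme \<Rightarrow> ('o \<Rightarrow>\<^sub>0 int) set" where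
  "grothendieck_relations A = generate (free_Abelian_group (Ob A))
     {frag_of (Cod A f) - frag_of (Dom A f) - frag_of (Cod A g) | f g. short_exact A f g}"

definition grothendieck_group ::
  "('o, 'm, 'z) precategory_scheme \<Rightarrow> ('o \<Rightarrow>\<^sub>0 int) set monoid" where
  "grothendieck_group A = free_Abelian_group (Ob A) Mod grothendieck_relations A"

definition grothendieck_class ::
  "('o, 'm, 'z) precategory_scheme \<Rightarrow> 'o \<Rightarrow> ('o \<Rightarrow>\<^sub>0 int) set" where
  "grothendieck_class A E =
     grothendieck_relations A #>\<^bsub>free_Abelian_group (Ob A)\<^esub> frag_of E"


section \<open>Triangulated categories\<close>

text \<open>
  \<open>(f, g, h) \<in> Tri D\<close> means that \<open>f : X \<rightarrow> Y\<close>, \<open>g : Y \<rightarrow> Z\<close>, \<open>h : Z \<rightarrow> X[1]\<close> form a distinguished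
  triangle.  The shift is only required to be an autoequivalence, not an automorphism.
\<close>

record ('o, 'm) pretriangulated = "('o, 'm) precategory" +
  ShOb :: "'o \<Rightarrow> 'o"
  ShMor :: "'m \<Rightarrow> 'm"
  Tri :: "('m \<times> 'm \<times> 'm) set"

definition triangle ::
  "('o, 'm, 'z) pretriangulated_scheme \<Rightarrow> 'm \<Rightarrow> 'm \<Rightarrow> 'm \<Rightarrow> bool" where
  "triangle D f g h \<longleftrightarrow> f \<in> Mor D \<and> g \<in> Hom D (Cod D f) (Dom D h) \<and>
     h \<in> Hom D (Cod D g) (ShOb D (Dom D f))"

locale triangulated_category = additive_category D
  for D :: "('o, 'm, 'z) pretriangulated_scheme" (structure) +
  assumes ShOb_in: "X \<in> Ob D \<Longrightarrow> ShOb D X \<in> Ob D"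
    and ShMor_Ide: "X \<in> Ob D \<Longrightarrow> ShMor D (Ide D X) = Ide D (ShOb D X)"
    and ShMor_Comp: "f \<in> Hom D X Y \<Longrightarrow> g \<in> Hom D Y Z
      \<Longrightarrow> ShMor D (g \<cdot> f) = ShMor D g \<cdot> ShMor D f"
    and ShMor_Plus: "f \<in> Hom D X Y \<Longrightarrow> g \<in> Hom D X Y
      \<Longrightarrow> ShMor D (Plus D f g) = Plus D (ShMor D f) (ShMor D g)"
    and ShMor_bij: "X \<in> Ob D \<Longrightarrow> Y \<in> Ob D
      \<Longrightarrow> bij_betw (ShMor D) (Hom D X Y) (Hom D (ShOb D X) (ShOb D Y))"
    and ShOb_ess_surj: "Y \<in> Ob D \<Longrightarrow> \<exists>X\<in>Ob D. isomorphic D (ShOb D X) Y"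
    and Tri_triangle: "(f, g, h) \<in> Tri D \<Longrightarrow> triangle D f g h"
    and TR1_id: "X \<in> Ob D \<Longrightarrow> is_zero D Z
      \<Longrightarrow> (Ide D X, Zero D X Z, Zero D Z (ShOb D X)) \<in> Tri D"
    and TR1_iso: "(f, g, h) \<in> Tri D \<Longrightarrow> triangle D f' g' h' \<Longrightarrow>
      a \<in> Hom D (Dom D f) (Dom D f') \<Longrightarrow> is_iso D a \<Longrightarrow>
      b \<in> Hom D (Cod D f) (Cod D f') \<Longrightarrow> is_iso D b \<Longrightarrow>
      c \<in> Hom D (Cod D g) (Cod D g') \<Longrightarrow> is_iso D c \<Longrightarrow>
      b \<cdot> f = f' \<cdot> a \<Longrightarrow> c \<cdot> g = g' \<cdot> b \<Longrightarrow> ShMor D a \<cdot> h = h' \<cdot> c \<Longrightarrow>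
      (f', g', h') \<in> Tri D"
    and TR1_cone: "f \<in> Mor D \<Longrightarrow> \<exists>g h. (f, g, h) \<in> Tri D"
    and TR2: "triangle D f g h \<Longrightarrow> (f, g, h) \<in> Tri D \<longleftrightarrow> (g, h, neg D (ShMor D f)) \<in> Tri D"
    and TR3: "(f, g, h) \<in> Tri D \<Longrightarrow> (f', g', h') \<in> Tri D \<Longrightarrow>
      a \<in> Hom D (Dom D f) (Dom D f') \<Longrightarrow> b \<in> Hom D (Cod D f) (Cod D f') \<Longrightarrow>
      b \<cdot> f = f' \<cdot> a \<Longrightarrow>
      \<exists>c\<in>Hom D (Cod D g) (Cod D g'). c \<cdot> g = g' \<cdot> b \<and> ShMor D a \<cdot> h = h' \<cdot> c"
    and TR4: "f \<in> Hom D X Y \<Longrightarrow> g \<in> Hom D Y Z \<Longrightarrow>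
      (f, f', f'') \<in> Tri D \<Longrightarrow> (g, g', g'') \<in> Tri D \<Longrightarrow> (g \<cdot> f, k', k'') \<in> Tri D \<Longrightarrow>
      \<exists>u\<in>Hom D (Cod D f') (Cod D k'). \<exists>v\<in>Hom D (Cod D k') (Cod D g').
        (u, v, ShMor D f' \<cdot> g'') \<in> Tri D \<and>
        u \<cdot> f' = k' \<cdot> g \<and> k'' \<cdot> u = f'' \<and> v \<cdot> k' = g' \<and> g'' \<cdot> v = ShMor D f \<cdot> k''"

text \<open>
  The strict full subcategory \<open>X[n]\<close>.  Avoiding a choice of inverse of the shift, \<open>E\<close> belongs to
  \<open>X[n]\<close> if \<open>E \<cong> Y[n]\<close>, respectively \<open>E[-n] \<cong> Y\<close>, for some \<open>Y\<close> in \<open>X\<close>; one of the two iterates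
  below is always trivial.
\<close>

definition shift_set ::
  "('o, 'm, 'z) pretriangulated_scheme \<Rightarrow> int \<Rightarrow> 'o set \<Rightarrow> 'o set" where
  "shift_set D n X =
     {E \<in> Ob D. \<exists>Y\<in>X. isomorphic D ((ShOb D ^^ nat (- n)) E) ((ShOb D ^^ nat n) Y)}"

text \<open>
  The extension-closed full subcategory generated by \<open>X\<close>.  It contains the zero objects (the empty
  extensions), and is therefore closed under isomorphism.
\<close>

inductive_set ext_closure ::
  "('o, 'm, 'z) pretriangulated_scheme \<Rightarrow> 'o set \<Rightarrow> 'o set"
  for D :: "('o, 'm, 'z) pretriangulated_scheme" and X :: "'o set" where
  ext_zero: "is_zero D Z \<Longrightarrow> Z \<in> ext_closure D X"
| ext_base: "E \<in> X \<Longrightarrow> E \<in> ext_closure D X"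
| ext_step: "(f, g, h) \<in> Tri D \<Longrightarrow> Dom D f \<in> ext_closure D X \<Longrightarrow> Cod D g \<in> ext_closure D X
    \<Longrightarrow> Cod D f \<in> ext_closure D X"


section \<open>Bounded t-structures\<close>

text \<open>
  A t-structure is given by its aisle \<open>C\<close>, which is \<open>D\<^sup>\<le>\<^sup>0\<close> in the usual cohomological notation;
  \<open>C[-i]\<close> is then the subcategory of objects with cohomology in degrees at most \<open>i\<close>.  The
  predicate \<open>truncation D C U E V\<close> states that there is a distinguished triangle
  \<open>U \<rightarrow> E \<rightarrow> V \<rightarrow> U[1]\<close> with \<open>U\<close> in \<open>C\<close> and \<open>V\<close> in the right orthogonal of \<open>C\<close>.
\<close>

definition truncation ::
  "('o, 'm, 'z) pretriangulated_scheme \<Rightarrow> 'o set \<Rightarrow> 'o \<Rightarrow> 'o \<Rightarrow> 'o \<Rightarrow> bool" where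
  "truncation D C U E V \<longleftrightarrow> U \<in> C \<and> V \<in> right_perp D C \<and>
     (\<exists>f g h. (f, g, h) \<in> Tri D \<and> Dom D f = U \<and> Cod D f = E \<and> Cod D g = V)"

definition t_structure :: "('o, 'm, 'z) pretriangulated_scheme \<Rightarrow> 'o set \<Rightarrow> bool" where
  "t_structure D C \<longleftrightarrow> strict_full D C \<and> shift_set D 1 C \<subseteq> C \<and>
     (\<forall>E\<in>Ob D. \<exists>U V. truncation D C U E V)"

definition bounded_t_structure ::
  "('o, 'm, 'z) pretriangulated_scheme \<Rightarrow> 'o set \<Rightarrow> bool" where
  "bounded_t_structure D C \<longleftrightarrow> t_structure D C \<and>
     (\<forall>E\<in>Ob D. \<exists>m n. E \<in> shift_set D m C \<and> E \<in> shift_set D n (right_perp D C))"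

definition heart :: "('o, 'm, 'z) pretriangulated_scheme \<Rightarrow> 'o set \<Rightarrow> 'o set" where
  "heart D C = C \<inter> shift_set D 1 (right_perp D C)"

abbreviation heart_cat ::
  "('o, 'm, 'z) pretriangulated_scheme \<Rightarrow> 'o set \<Rightarrow> ('o, 'm, 'z) pretriangulated_scheme" where
  "heart_cat D C \<equiv> full_sub D (heart D C)"

text \<open>
  The isomorphism class of \<open>H\<^sup>i(E)\<close>: if \<open>U\<close> is the truncation of \<open>E\<close> in degrees at most \<open>i\<close>, and \<open>Z\<close>
  the truncation of \<open>U\<close> in degrees at least \<open>i\<close>, then \<open>H\<^sup>i(E)\<close> is \<open>Z[i]\<close>.
\<close>

definition cohomology ::
  "('o, 'm, 'z) pretriangulated_scheme \<Rightarrow> 'o set \<Rightarrow> int \<Rightarrow> 'o \<Rightarrow> 'o set" where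
  "cohomology D C i E = {H. \<exists>U V W Z.
     truncation D (shift_set D (- i) C) U E V \<and>
     truncation D (shift_set D (1 - i) C) W U Z \<and> H \<in> shift_set D i {Z}}"


section \<open>Tilting\<close>

definition left_tilt ::
  "('o, 'm, 'z) pretriangulated_scheme \<Rightarrow> 'o set \<Rightarrow> 'o set \<Rightarrow> 'o set \<Rightarrow> 'o set" where
  "left_tilt D C T F = {E \<in> Ob D.
     (\<forall>i. i \<notin> {0, 1} \<longrightarrow> cohomology D C i E \<subseteq> {Z. is_zero D Z}) \<and>
     cohomology D C 0 E \<subseteq> F \<and> cohomology D C 1 E \<subseteq> T}"

definition algebraic_heart :: "('o, 'm, 'z) pretriangulated_scheme \<Rightarrow> 'o set \<Rightarrow> bool" where
  "algebraic_heart D C \<longleftrightarrow>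
     Ob (heart_cat D C) \<subseteq> finite_length (heart_cat D C) \<and> finite (simple_classes (heart_cat D C))"

text \<open>\<open>simple_tilt D C C'\<close>: the heart of \<open>C'\<close> is a simple left tilt of the algebraic heart of \<open>C\<close>.\<close>

definition simple_tilt ::
  "('o, 'm, 'z) pretriangulated_scheme \<Rightarrow> 'o set \<Rightarrow> 'o set \<Rightarrow> bool" where
  "simple_tilt D C C' \<longleftrightarrow>
     bounded_t_structure D C \<and> algebraic_heart D C \<and> bounded_t_structure D C' \<and>
     (\<exists>S. simple_object (heart_cat D C) S \<and>
        heart D C' =
          left_tilt D C (ext_closure D {S}) {E \<in> heart D C. Hom D S E = {Zero D S E}})"

definition tilt_indefinitely :: "('o, 'm, 'z) pretriangulated_scheme \<Rightarrow> 'o set \<Rightarrow> bool" where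
  "tilt_indefinitely D C \<longleftrightarrow> (\<forall>C'. (simple_tilt D)\<^sup>*\<^sup>* C C' \<longrightarrow>
     algebraic_heart D C' \<and>
     card (simple_classes (heart_cat D C')) = card (simple_classes (heart_cat D C)))"

definition intermediate ::
  "('o, 'm, 'z) pretriangulated_scheme \<Rightarrow> 'o set \<Rightarrow> 'o set set" where
  "intermediate D C = {C'. bounded_t_structure D C' \<and> C \<subseteq> C' \<and> C' \<subseteq> shift_set D (- 1) C}"

text \<open>
  The intermediate t-structure identified with the torsion class \<open>T\<close> in the heart of \<open>C\<close>.  It is
  unique because \<open>F\<close> is determined by \<open>T\<close>, and a bounded t-structure by its heart.
\<close>

definition tilted_t_structure ::
  "('o, 'm, 'z) pretriangulated_scheme \<Rightarrow> 'o set \<Rightarrow> 'o set \<Rightarrow> 'o set" where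
  "tilted_t_structure D C T = (THE C'. bounded_t_structure D C' \<and>
     (\<exists>F. torsion_pair (heart_cat D C) T F \<and> heart D C' = left_tilt D C T F))"


section \<open>Quivers\<close>

text \<open>Only quivers without multiple arrows occur here.\<close>

record 'v quiver =
  vertices :: "'v set"
  arrows :: "('v \<times> 'v) set"

definition opposite_quiver :: "'v quiver \<Rightarrow> 'v quiver" where
  "opposite_quiver Q = \<lparr>vertices = vertices Q, arrows = (arrows Q)\<inverse>\<rparr>"

definition map_quiver :: "('v \<Rightarrow> 'w) \<Rightarrow> 'v quiver \<Rightarrow> 'w quiver" where
  "map_quiver \<phi> Q = \<lparr>vertices = \<phi> ` vertices Q, arrows = map_prod \<phi> \<phi> ` arrows Q\<rparr>"

definition hasse_quiver :: "'a::order set \<Rightarrow> 'a quiver" where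
  "hasse_quiver P = \<lparr>vertices = P,
     arrows = {(x, y). x \<in> P \<and> y \<in> P \<and> x > y \<and> \<not> (\<exists>z\<in>P. x > z \<and> z > y)}\<rparr>"

definition exchange_quiver ::
  "('o, 'm, 'z) pretriangulated_scheme \<Rightarrow> 'o set \<Rightarrow> 'o set quiver" where
  "exchange_quiver D C = \<lparr>vertices = intermediate D C,
     arrows = {(C\<^sub>1, C\<^sub>2). C\<^sub>1 \<in> intermediate D C \<and> C\<^sub>2 \<in> intermediate D C \<and> simple_tilt D C\<^sub>1 C\<^sub>2}\<rparr>"

end

theory Submission
  imports Defs
begin

text \<open>
  Every intermediate t-structure \<open>C'\<close> is reached from \<open>C\<close> by simple tilts.  As long as the aisle
  \<open>C\<^sub>i\<close> obtained after \<open>i\<close> tilts is properly contained in \<open>C'\<close>, the algebraic heart of \<open>C\<^sub>i\<close> has a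
  simple object \<open>S\<^sub>i\<close> with \<open>S\<^sub>i[-1]\<close> in \<open>C'\<close>, and tilting at it gives an aisle \<open>C\<^sub>i\<^sub>+\<^sub>1\<close> that is still contained
  in \<open>C'\<close>.  If this never stopped, there would be infinitely many torsion classes.  There would also be
  infinitely many classes of endo-trivial objects: the \<open>S\<^sub>i\<close> lie in the heart of \<open>C\<close>, and for
  \<open>i < j\<close> the Euler characteristic of lengths with respect to the heart of \<open>C\<^sub>j\<close>, which is additive on
  short exact sequences in the heart of \<open>C\<close>, is positive on \<open>S\<^sub>j\<close> and negative on \<open>S\<^sub>i\<close> because
  \<open>S\<^sub>i[-1]\<close> lies in the heart of \<open>C\<^sub>j\<close>.

  Hence all intermediate hearts are algebraic.  A simple tilt at \<open>S\<close> is a cover since every nonzero object of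
  the extension closure of \<open>S\<close> has \<open>S\<close> as a quotient with kernel in the heart, and conversely a cover
  contains, by the argument above, a simple tilt and is therefore equal to it.
\<close>

section \<open>Additive and triangulated categories\<close>

text \<open>Tilting enlarges aisles, while the arrows of a Hasse quiver point to the smaller
  element; this is why the opposite quiver appears. The finiteness assumptions serve termination.
  The obstacle there is that the Grothendieck classes live over the heart of \<open>C\<close>,
  whereas each \<open>S\<^sub>i\<close> is simple in a different heart. Instead of comparing
  Grothendieck groups, one function on the objects of the heart of \<open>C\<close> separates two
  classes: with respect to \<open>C\<^sub>j\<close> these objects have cohomology in degrees -1 and
  0 only, so that length of H^0 minus length of H^{-1} makes sense, and its additivity is proved
  directly on triangles. Hearts are given merely as full subcategories, with kernels and cokernels
  defined by universal properties. That short exact sequences are triangles, that images exist and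
  that lengths are well defined is therefore derived from the axioms of a triangulated category. As
  the shift is only an autoequivalence, desuspensions exist up to isomorphism, and most
  constructions retain only the existence of a triangle on given objects.\<close>

context additive_category
begin

abbreviation iso (infix "\<simeq>" 50) where "X \<simeq> Y \<equiv> isomorphic D X Y"

lemma Hom_Dom: "f \<in> Hom D X Y \<Longrightarrow> Dom D f = X"
  and Hom_Cod: "f \<in> Hom D X Y \<Longrightarrow> Cod D f = Y"
  and Hom_in_Mor: "f \<in> Hom D X Y \<Longrightarrow> f \<in> Mor D"
  by (auto simp: Hom_def)

lemma Hom_Ob: "f \<in> Hom D X Y \<Longrightarrow> X \<in> Ob D \<and> Y \<in> Ob D"
  using Dom_in Cod_in by (auto simp: Hom_def)

lemma hom_group_simps [simp]:
  "carrier (hom_group D X Y) = Hom D X Y"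
  "monoid.mult (hom_group D X Y) = Plus D"
  "one (hom_group D X Y) = Zero D X Y"
  by (auto simp: hom_group_def)

lemma Zero_in: assumes "X \<in> Ob D" "Y \<in> Ob D" shows "Zero D X Y \<in> Hom D X Y"
proof -
  interpret comm_group "hom_group D X Y" using assms hom_comm_group by blast
  show ?thesis using one_closed by simp
qed

lemma Plus_in: assumes "f \<in> Hom D X Y" "g \<in> Hom D X Y" shows "Plus D f g \<in> Hom D X Y"
proof -
  interpret comm_group "hom_group D X Y" using assms hom_comm_group Hom_Ob by blast
  show ?thesis using m_closed[of f g] assms by simp
qed

lemma neg_in: assumes "f \<in> Hom D X Y" shows "neg D f \<in> Hom D X Y"
proof -
  interpret comm_group "hom_group D X Y" using assms hom_comm_group Hom_Ob by blast
  show ?thesis using inv_closed[of f] assms by (simp add: neg_def Hom_Dom[OF assms] Hom_Cod[OF assms])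
qed

lemma Plus_neg: assumes "f \<in> Hom D X Y" shows "Plus D f (neg D f) = Zero D X Y"
proof -
  interpret comm_group "hom_group D X Y" using assms hom_comm_group Hom_Ob by blast
  show ?thesis using r_inv[of f] assms by (simp add: neg_def Hom_Dom[OF assms] Hom_Cod[OF assms])
qed

lemma neg_unique:
  assumes "f \<in> Hom D X Y" "g \<in> Hom D X Y" "Plus D f g = Zero D X Y" shows "g = neg D f"
proof -
  interpret comm_group "hom_group D X Y" using assms hom_comm_group Hom_Ob by blast
  have "Plus D g f = Zero D X Y" using m_comm[of f g] assms by simp
  then show ?thesis using inv_equality[of g f] assms
    by (simp add: neg_def Hom_Dom[OF assms(1)] Hom_Cod[OF assms(1)])
qed

lemma Plus_idem_zero:
  assumes "f \<in> Hom D X Y" "Plus D f f = f" shows "f = Zero D X Y"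
proof -
  interpret comm_group "hom_group D X Y" using assms hom_comm_group Hom_Ob by blast
  show ?thesis using l_cancel_one[of f f] assms by simp
qed

lemma Plus_Zero: assumes "f \<in> Hom D X Y"
  shows "Plus D f (Zero D X Y) = f" "Plus D (Zero D X Y) f = f"
proof -
  interpret comm_group "hom_group D X Y" using assms hom_comm_group Hom_Ob by blast
  show "Plus D f (Zero D X Y) = f" "Plus D (Zero D X Y) f = f" using r_one[of f] l_one[of f] assms by auto
qed

lemma neg_neg: assumes "f \<in> Hom D X Y" shows "neg D (neg D f) = f"
proof -
  interpret comm_group "hom_group D X Y" using assms hom_comm_group Hom_Ob by blast
  show ?thesis using neg_unique[OF neg_in[OF assms] assms] m_comm[of f "neg D f"] Plus_neg[OF assms]
      neg_in[OF assms] assms by simp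
qed

text \<open>Since 0 + 0 = 0, the composite equals its own double, and only zero does so in a
  group.\<close>

lemma Comp_Zero: assumes "g \<in> Hom D Y Z" "X \<in> Ob D" shows "g \<cdot> Zero D X Y = Zero D X Z"
  using assms Hom_Ob[OF assms(1)] Comp_Plus[of "Zero D X Y" X Y "Zero D X Y" g Z]
  by (metis Comp_in Plus_Zero(1) Plus_idem_zero Zero_in)

lemma Zero_Comp: assumes "f \<in> Hom D X Y" "Z \<in> Ob D" shows "Zero D Y Z \<cdot> f = Zero D X Z"
  using assms Hom_Ob[OF assms(1)] Plus_Comp[of f X Y "Zero D Y Z" Z "Zero D Y Z"]
  by (metis Comp_in Plus_Zero(1) Plus_idem_zero Zero_in)

lemma Comp_neg: assumes "f \<in> Hom D X Y" "g \<in> Hom D Y Z" shows "g \<cdot> neg D f = neg D (g \<cdot> f)"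
  using neg_unique[of "g \<cdot> f" X Z "g \<cdot> neg D f"] Comp_Plus[OF assms(1) neg_in[OF assms(1)] assms(2)]
  by (metis Comp_Zero Comp_in Hom_Ob Plus_neg assms neg_in)

lemma neg_Comp: assumes "f \<in> Hom D X Y" "g \<in> Hom D Y Z" shows "neg D g \<cdot> f = neg D (g \<cdot> f)"
  using neg_unique[of "g \<cdot> f" X Z "neg D g \<cdot> f"] Plus_Comp[OF assms(1) assms(2) neg_in[OF assms(2)]]
  by (metis Zero_Comp Comp_in Hom_Ob Plus_neg assms neg_in)

lemma neg_Zero: "X \<in> Ob D \<Longrightarrow> Y \<in> Ob D \<Longrightarrow> neg D (Zero D X Y) = Zero D X Y"
  by (metis Plus_Zero(1) Zero_in neg_unique)

lemma diff_zero: assumes "f \<in> Hom D X Y" "g \<in> Hom D X Y" "Plus D f (neg D g) = Zero D X Y" shows "f = g"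
  by (metis assms neg_in neg_neg neg_unique)

lemma neg_eq_Zero: assumes "f \<in> Hom D X Y" "neg D f = Zero D X Y" shows "f = Zero D X Y"
  by (metis assms Hom_Ob neg_Zero neg_neg)

lemma Hom_zero_target: assumes "is_zero D Z" "f \<in> Hom D X Z" shows "f = Zero D X Z"
proof -
  have X: "X \<in> Ob D" "Z \<in> Ob D" using Hom_Ob[OF assms(2)] by auto
  then have "\<exists>!f. f \<in> Hom D X Z" using assms(1) by (simp add: is_zero_def)
  then show ?thesis using assms(2) Zero_in[OF X] by blast
qed

lemma Hom_zero_source: assumes "is_zero D Z" "f \<in> Hom D Z X" shows "f = Zero D Z X"
proof -
  have X: "Z \<in> Ob D" "X \<in> Ob D" using Hom_Ob[OF assms(2)] by auto
  then have "\<exists>!f. f \<in> Hom D Z X" using assms(1) by (simp add: is_zero_def)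
  then show ?thesis using assms(2) Zero_in[OF X] by blast
qed

lemma is_zero_iff: "is_zero D Z \<longleftrightarrow> Z \<in> Ob D \<and> Ide D Z = Zero D Z Z"
proof
  assume *: "Z \<in> Ob D \<and> Ide D Z = Zero D Z Z"
  have "f = Zero D X Z" if "f \<in> Hom D X Z" for f X
    using Ide_Comp[OF that] * Zero_Comp[OF that] by auto
  moreover have "f = Zero D Z X" if "f \<in> Hom D Z X" for f X
    using Comp_Ide[OF that] * Comp_Zero[OF that] by auto
  ultimately show "is_zero D Z" unfolding is_zero_def using * Zero_in[of _ Z] Zero_in[of Z] by metis
next
  assume *: "is_zero D Z"
  then have "Z \<in> Ob D" by (simp add: is_zero_def)
  then show "Z \<in> Ob D \<and> Ide D Z = Zero D Z Z" using Hom_zero_target[OF * Ide_in] by blast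
qed

lemma is_isoI:
  "f \<in> Hom D X Y \<Longrightarrow> g \<in> Hom D Y X \<Longrightarrow> g \<cdot> f = Ide D X \<Longrightarrow> f \<cdot> g = Ide D Y \<Longrightarrow> is_iso D f"
  unfolding is_iso_def by (auto simp: Hom_def)

lemma is_isoE:
  assumes "is_iso D f" "f \<in> Hom D X Y"
  obtains g where "g \<in> Hom D Y X" "g \<cdot> f = Ide D X" "f \<cdot> g = Ide D Y" "is_iso D g"
  using assms unfolding is_iso_def by (auto simp: Hom_def)

lemma is_isoI2:
  assumes "f \<in> Hom D X Y" "g \<in> Hom D Y X" "g \<cdot> f = Ide D X" "h \<in> Hom D Y X" "f \<cdot> h = Ide D Y"
  shows "is_iso D f"
proof -
  have "g = h" using assms Comp_assoc[of h Y X f Y g X] Comp_Ide[of g] Ide_Comp[of h] by metis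
  then show ?thesis using assms is_isoI by blast
qed

lemma is_iso_Ide: "X \<in> Ob D \<Longrightarrow> is_iso D (Ide D X)"
  using Ide_in Ide_Comp is_isoI by meson

lemma is_iso_Comp:
  assumes "f \<in> Hom D X Y" "g \<in> Hom D Y Z" "is_iso D f" "is_iso D g" shows "is_iso D (g \<cdot> f)"
proof -
  obtain f' g' where *: "f' \<in> Hom D Y X" "f' \<cdot> f = Ide D X" "f \<cdot> f' = Ide D Y"
      "g' \<in> Hom D Z Y" "g' \<cdot> g = Ide D Y" "g \<cdot> g' = Ide D Z"
    using is_isoE assms by metis
  have "(f' \<cdot> g') \<cdot> (g \<cdot> f) = f' \<cdot> (g' \<cdot> (g \<cdot> f))" "g' \<cdot> (g \<cdot> f) = (g' \<cdot> g) \<cdot> f"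
    "(g \<cdot> f) \<cdot> (f' \<cdot> g') = g \<cdot> (f \<cdot> (f' \<cdot> g'))" "f \<cdot> (f' \<cdot> g') = (f \<cdot> f') \<cdot> g'"
    using Comp_assoc[OF Comp_in[OF assms(1,2)] *(4) *(1)] Comp_assoc[OF assms(1,2) *(4)]
      Comp_assoc[OF Comp_in[OF *(4,1)] assms(1,2)] Comp_assoc[OF *(4) *(1) assms(1)] by simp_all
  then have "(f' \<cdot> g') \<cdot> (g \<cdot> f) = Ide D X" "(g \<cdot> f) \<cdot> (f' \<cdot> g') = Ide D Z"
    using * assms Ide_Comp by auto
  then show ?thesis using is_isoI[of "g \<cdot> f" X Z "f' \<cdot> g'"] * assms Comp_in by blast
qed

lemma iso_refl: "X \<in> Ob D \<Longrightarrow> X \<simeq> X"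
  unfolding isomorphic_def using is_iso_Ide Ide_in by blast

lemma iso_sym: "X \<simeq> Y \<Longrightarrow> Y \<simeq> X"
  unfolding isomorphic_def by (meson is_isoE)

lemma iso_trans: "X \<simeq> Y \<Longrightarrow> Y \<simeq> Z \<Longrightarrow> X \<simeq> Z"
  unfolding isomorphic_def by (meson Comp_in is_iso_Comp)

lemma iso_Ob: "X \<simeq> Y \<Longrightarrow> X \<in> Ob D \<and> Y \<in> Ob D"
  unfolding isomorphic_def using Hom_Ob by blast

lemma is_zero_Ob: "is_zero D Z \<Longrightarrow> Z \<in> Ob D"
  by (simp add: is_zero_def)

lemma is_zero_iso: assumes "X \<simeq> Y" "is_zero D X" shows "is_zero D Y"
proof -
  obtain f g where *: "f \<in> Hom D X Y" "g \<in> Hom D Y X" "f \<cdot> g = Ide D Y"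
    using assms(1) unfolding isomorphic_def by (meson is_isoE)
  then have "f = Zero D X Y" using assms Hom_zero_source by blast
  then have "Ide D Y = Zero D Y Y" using * Zero_Comp[of g Y X Y] Hom_Ob by metis
  then show ?thesis using * Hom_Ob is_zero_iff by blast
qed

lemma zero_iso: assumes "is_zero D X" "is_zero D Y" shows "X \<simeq> Y"
proof -
  have X: "X \<in> Ob D" "Y \<in> Ob D" "Ide D X = Zero D X X" "Ide D Y = Zero D Y Y"
    using assms is_zero_iff by auto
  have "is_iso D (Zero D X Y)"
    using is_isoI[of "Zero D X Y" X Y "Zero D Y X"] X Zero_in Zero_Comp[of "Zero D X Y" X Y X]
      Zero_Comp[of "Zero D Y X" Y X Y] by simp
  then show ?thesis unfolding isomorphic_def using Zero_in X by blast
qed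

abbreviation orth :: "'a \<Rightarrow> 'a \<Rightarrow> bool" where
  "orth X Y \<equiv> Hom D X Y = {Zero D X Y}"

lemma orthI: "X \<in> Ob D \<Longrightarrow> Y \<in> Ob D \<Longrightarrow> (\<And>f. f \<in> Hom D X Y \<Longrightarrow> f = Zero D X Y) \<Longrightarrow> orth X Y"
  using Zero_in by blast

lemma orthD: "orth X Y \<Longrightarrow> f \<in> Hom D X Y \<Longrightarrow> f = Zero D X Y"
  by blast

lemma orth_iso: assumes "orth X Y" "X \<simeq> X'" "Y \<simeq> Y'" shows "orth X' Y'"
proof (rule orthI)
  show "X' \<in> Ob D" "Y' \<in> Ob D" using assms iso_Ob by auto
  fix f assume f: "f \<in> Hom D X' Y'"
  obtain a a' where a: "a \<in> Hom D X X'" "a' \<in> Hom D X' X" "a \<cdot> a' = Ide D X'"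
    using assms(2) unfolding isomorphic_def by (meson is_isoE)
  obtain b b' where b: "b \<in> Hom D Y Y'" "b' \<in> Hom D Y' Y" "b \<cdot> b' = Ide D Y'"
    using assms(3) unfolding isomorphic_def by (meson is_isoE)
  have fa: "f \<cdot> a \<in> Hom D X Y'" using f a Comp_in by blast
  have "b' \<cdot> (f \<cdot> a) = Zero D X Y" using orthD[OF assms(1) Comp_in[OF fa b(2)]] .
  then have "b \<cdot> (b' \<cdot> (f \<cdot> a)) = Zero D X Y'" using Comp_Zero[OF b(1)] Hom_Ob[OF a(1)] by simp
  then have "f \<cdot> a = Zero D X Y'" using Comp_assoc[OF fa b(2,1)] Ide_Comp[OF fa] b(3) by simp
  then have "(f \<cdot> a) \<cdot> a' = Zero D X' Y'" using Zero_Comp[OF a(2)] Hom_Ob[OF b(1)] by simp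
  then show "f = Zero D X' Y'" using Comp_assoc[OF a(2,1) f] Comp_Ide[OF f] a(3) by simp
qed

lemma orth_self: "orth X X \<Longrightarrow> X \<in> Ob D \<Longrightarrow> is_zero D X"
  using is_zero_iff Ide_in by blast

lemma orth_zero: "is_zero D X \<Longrightarrow> Y \<in> Ob D \<Longrightarrow> orth X Y" "is_zero D X \<Longrightarrow> Y \<in> Ob D \<Longrightarrow> orth Y X"
  using Hom_zero_source Hom_zero_target orthI is_zero_Ob by metis+

end

section \<open>Distinguished triangles and the octahedral axiom\<close>

context triangulated_category
begin

definition dt :: "'o \<Rightarrow> 'o \<Rightarrow> 'o \<Rightarrow> 'm \<Rightarrow> 'm \<Rightarrow> 'm \<Rightarrow> bool" where
  "dt X Y Z f g h \<longleftrightarrow> (f, g, h) \<in> Tri D \<and> f \<in> Hom D X Y \<and> g \<in> Hom D Y Z \<and> h \<in> Hom D Z (ShOb D X)"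

text \<open>Forgets the morphisms of \<open>dt\<close>. The third object is then meant up to
  isomorphism, which suits extension arguments; \<open>dt\<close> is kept where a particular
  morphism matters.\<close>

definition tri :: "'o \<Rightarrow> 'o \<Rightarrow> 'o \<Rightarrow> bool" where
  "tri X Y Z \<longleftrightarrow> (\<exists>f g h. dt X Y Z f g h)"

lemma Tri_dt: "(f, g, h) \<in> Tri D \<Longrightarrow> dt (Dom D f) (Cod D f) (Cod D g) f g h"
  using Tri_triangle[of f g h] unfolding dt_def triangle_def Hom_def mem_Collect_eq by metis

lemma dt_Hom: "dt X Y Z f g h \<Longrightarrow> f \<in> Hom D X Y \<and> g \<in> Hom D Y Z \<and> h \<in> Hom D Z (ShOb D X)"
  by (simp add: dt_def)

lemma dt_tri: "dt X Y Z f g h \<Longrightarrow> tri X Y Z"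
  by (auto simp: tri_def)

lemma tri_iff: "tri X Y Z \<longleftrightarrow> (\<exists>f g h. (f, g, h) \<in> Tri D \<and> Dom D f = X \<and> Cod D f = Y \<and> Cod D g = Z)"
  unfolding tri_def using Tri_dt by (metis dt_def Hom_Dom Hom_Cod)

lemma tri_Ob: "tri X Y Z \<Longrightarrow> X \<in> Ob D \<and> Y \<in> Ob D \<and> Z \<in> Ob D"
  unfolding tri_def dt_def using Hom_Ob by blast

lemma dt_Ob: "dt X Y Z f g h \<Longrightarrow> X \<in> Ob D \<and> Y \<in> Ob D \<and> Z \<in> Ob D"
  unfolding dt_def using Hom_Ob by blast

lemma triangle_Hom:
  "f \<in> Hom D X Y \<Longrightarrow> g \<in> Hom D Y Z \<Longrightarrow> h \<in> Hom D Z (ShOb D X) \<Longrightarrow> triangle D f g h"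
  unfolding triangle_def by (auto simp: Hom_def)

lemma ShMor_in: "f \<in> Hom D X Y \<Longrightarrow> ShMor D f \<in> Hom D (ShOb D X) (ShOb D Y)"
  using ShMor_bij Hom_Ob bij_betwE by blast

lemma ShMor_inj: "f \<in> Hom D X Y \<Longrightarrow> g \<in> Hom D X Y \<Longrightarrow> ShMor D f = ShMor D g \<Longrightarrow> f = g"
  using ShMor_bij[of X Y] Hom_Ob by (meson bij_betw_def inj_onD)

lemma ShMor_surj:
  assumes "X \<in> Ob D" "Y \<in> Ob D" "g \<in> Hom D (ShOb D X) (ShOb D Y)"
  obtains f where "f \<in> Hom D X Y" "ShMor D f = g"
  using ShMor_bij[of X Y] assms by (metis bij_betw_def imageE)

lemma ShMor_Zero: assumes "X \<in> Ob D" "Y \<in> Ob D" shows "ShMor D (Zero D X Y) = Zero D (ShOb D X) (ShOb D Y)"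
  using ShMor_Plus[OF Zero_in Zero_in, of X Y] assms
  by (metis Plus_Zero(1) Plus_idem_zero ShMor_in Zero_in)

lemma ShMor_eq_Zero:
  "f \<in> Hom D X Y \<Longrightarrow> ShMor D f = Zero D (ShOb D X) (ShOb D Y) \<Longrightarrow> f = Zero D X Y"
  by (metis Hom_Ob ShMor_Zero ShMor_inj Zero_in)

lemma orth_ShOb: assumes "X \<in> Ob D" "Y \<in> Ob D" shows "orth (ShOb D X) (ShOb D Y) \<longleftrightarrow> orth X Y"
proof
  assume "orth (ShOb D X) (ShOb D Y)"
  then show "orth X Y" using assms orthI ShMor_eq_Zero ShMor_in by (metis orthD)
next
  assume o: "orth X Y"
  show "orth (ShOb D X) (ShOb D Y)"
    by (rule orthI) (use assms o ShOb_in ShMor_surj ShMor_Zero orthD in metis)+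
qed

lemma iso_ShOb: assumes "X \<in> Ob D" "Y \<in> Ob D" shows "ShOb D X \<simeq> ShOb D Y \<longleftrightarrow> X \<simeq> Y"
proof
  assume "X \<simeq> Y"
  then obtain f g where *: "f \<in> Hom D X Y" "g \<in> Hom D Y X" "g \<cdot> f = Ide D X" "f \<cdot> g = Ide D Y"
    unfolding isomorphic_def by (meson is_isoE)
  then have "ShMor D g \<cdot> ShMor D f = Ide D (ShOb D X)" "ShMor D f \<cdot> ShMor D g = Ide D (ShOb D Y)"
    using ShMor_Comp ShMor_Ide assms by metis+
  then show "ShOb D X \<simeq> ShOb D Y" unfolding isomorphic_def using * ShMor_in is_isoI by meson
next
  assume "ShOb D X \<simeq> ShOb D Y"
  then obtain f g where *: "f \<in> Hom D (ShOb D X) (ShOb D Y)" "g \<in> Hom D (ShOb D Y) (ShOb D X)"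
    "g \<cdot> f = Ide D (ShOb D X)" "f \<cdot> g = Ide D (ShOb D Y)"
    unfolding isomorphic_def by (meson is_isoE)
  obtain f' where f': "f' \<in> Hom D X Y" "ShMor D f' = f" using ShMor_surj * assms by metis
  obtain g' where g': "g' \<in> Hom D Y X" "ShMor D g' = g" using ShMor_surj * assms by metis
  have "ShMor D (g' \<cdot> f') = ShMor D (Ide D X)" "ShMor D (f' \<cdot> g') = ShMor D (Ide D Y)"
    using f' g' * ShMor_Comp ShMor_Ide assms by metis+
  then have "g' \<cdot> f' = Ide D X" "f' \<cdot> g' = Ide D Y" using f' g' assms Comp_in Ide_in ShMor_inj by meson+
  then show "X \<simeq> Y" unfolding isomorphic_def using f' g' is_isoI by meson
qed

lemma is_zero_ShOb: "is_zero D Z \<Longrightarrow> is_zero D (ShOb D Z)"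
  by (metis ShMor_Ide ShMor_Zero ShOb_in is_zero_iff)

lemma is_zero_ShOb_iff: "Z \<in> Ob D \<Longrightarrow> is_zero D (ShOb D Z) \<longleftrightarrow> is_zero D Z"
  using is_zero_iff ShOb_in ShMor_eq_Zero[of "Ide D Z" Z Z] Ide_in ShMor_Ide is_zero_ShOb by metis

lemma dt_rotate: "dt X Y Z f g h \<Longrightarrow> dt Y Z (ShOb D X) g h (neg D (ShMor D f))"
  unfolding dt_def using TR2 triangle_Hom neg_in ShMor_in by meson

lemma dt_rotate_iff:
  assumes "f \<in> Hom D X Y" "g \<in> Hom D Y Z" "h \<in> Hom D Z (ShOb D X)"
  shows "dt X Y Z f g h \<longleftrightarrow> dt Y Z (ShOb D X) g h (neg D (ShMor D f))"
  using assms unfolding dt_def using TR2 triangle_Hom neg_in ShMor_in by meson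

lemma dt_iso:
  assumes "dt X Y Z f g h" "f' \<in> Hom D X' Y'" "g' \<in> Hom D Y' Z'" "h' \<in> Hom D Z' (ShOb D X')"
    "a \<in> Hom D X X'" "is_iso D a" "b \<in> Hom D Y Y'" "is_iso D b" "c \<in> Hom D Z Z'" "is_iso D c"
    "b \<cdot> f = f' \<cdot> a" "c \<cdot> g = g' \<cdot> b" "ShMor D a \<cdot> h = h' \<cdot> c"
  shows "dt X' Y' Z' f' g' h'"
  using assms TR1_iso[of f g h f' g' h' a b c] triangle_Hom[of f' X' Y' g' Z' h']
  unfolding dt_def by (simp add: Hom_def)

lemma dt_cone: assumes "f \<in> Hom D X Y" obtains Z g h where "dt X Y Z f g h"
  using TR1_cone[of f] assms Tri_dt Hom_Dom Hom_Cod Hom_in_Mor by metis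

lemma dt_map:
  assumes "dt X Y Z f g h" "dt X' Y' Z' f' g' h'" "a \<in> Hom D X X'" "b \<in> Hom D Y Y'" "b \<cdot> f = f' \<cdot> a"
  obtains c where "c \<in> Hom D Z Z'" "c \<cdot> g = g' \<cdot> b" "ShMor D a \<cdot> h = h' \<cdot> c"
  using TR3[of f g h f' g' h' a b] assms unfolding dt_def by (auto simp: Hom_def)

lemma dt_octahedral:
  assumes "dt X Y P f f' f''" "dt Y Z Q g g' g''" "dt X Z R (g \<cdot> f) k' k''"
  obtains u v where "dt P R Q u v (ShMor D f' \<cdot> g'')" "u \<cdot> f' = k' \<cdot> g" "k'' \<cdot> u = f''"
    "v \<cdot> k' = g'" "g'' \<cdot> v = ShMor D f \<cdot> k''"
proof -
  have h: "f' \<in> Hom D Y P" "k' \<in> Hom D Z R" "g' \<in> Hom D Z Q" "g'' \<in> Hom D Q (ShOb D Y)"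
    "f \<in> Hom D X Y" "g \<in> Hom D Y Z"
    using assms dt_Hom by blast+
  then have s: "ShMor D f' \<cdot> g'' \<in> Hom D Q (ShOb D P)" using ShMor_in Comp_in by blast
  show ?thesis using TR4[of f X Y g Z f' f'' g' g'' k' k''] assms h s that
    unfolding dt_def by (auto simp: Hom_Cod[OF h(1)] Hom_Cod[OF h(2)] Hom_Cod[OF h(3)])
qed

text \<open>TR3 maps the triangle on the identity of X, whose third object is zero, to the given
  one; so \<open>g \<cdot> f\<close> factors through a zero object.\<close>

lemma dt_zero: assumes "dt X Y Z f g h" shows "g \<cdot> f = Zero D X Z" 
proof -
  obtain N where N: "is_zero D N" using zero_object by blast
  have H: "f \<in> Hom D X Y" "g \<in> Hom D Y Z" "h \<in> Hom D Z (ShOb D X)" "X \<in> Ob D" "Y \<in> Ob D" "Z \<in> Ob D" "N \<in> Ob D"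
    using assms dt_Hom dt_Ob N is_zero_Ob by blast+
  have 1: "dt X X N (Ide D X) (Zero D X N) (Zero D N (ShOb D X))"
    unfolding dt_def using TR1_id[of X N] N H Ide_in Zero_in ShOb_in by blast
  obtain c where "c \<in> Hom D N Z" "c \<cdot> Zero D X N = g \<cdot> f"
    using dt_map[OF 1 assms Ide_in[OF H(4)] H(1)] by blast
  then show ?thesis using Comp_Zero H by metis
qed

text \<open>Exactness of Hom(E,-) at Y. TR3, applied to the rotated triangles, yields a morphism
  E[1] -> X[1]; as the shift is full and faithful it comes from E -> X, and the signs introduced by
  the two rotations cancel.\<close>

lemma dt_lift:
  assumes "dt X Y Z f g h" "a \<in> Hom D E Y" "g \<cdot> a = Zero D E Z"
  obtains b where "b \<in> Hom D E X" "f \<cdot> b = a"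
proof -
  obtain N where N: "is_zero D N" using zero_object by blast
  have H: "f \<in> Hom D X Y" "g \<in> Hom D Y Z" "h \<in> Hom D Z (ShOb D X)" "X \<in> Ob D" "Y \<in> Ob D" "Z \<in> Ob D" "N \<in> Ob D"
    "E \<in> Ob D"
    using assms dt_Hom dt_Ob N is_zero_Ob Hom_Ob by blast+
  have 1: "dt E E N (Ide D E) (Zero D E N) (Zero D N (ShOb D E))"
    unfolding dt_def using TR1_id[of E N] N H Ide_in Zero_in ShOb_in by blast
  obtain c where c: "c \<in> Hom D (ShOb D E) (ShOb D X)"
      "ShMor D a \<cdot> neg D (ShMor D (Ide D E)) = neg D (ShMor D f) \<cdot> c"
    using dt_map[OF dt_rotate[OF 1] dt_rotate[OF assms(1)] assms(2), of "Zero D N Z"] H assms(3) Zero_in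
      Zero_Comp[of "Zero D E N" E N Z] by metis
  obtain b where b: "b \<in> Hom D E X" "ShMor D b = c" using ShMor_surj c H by metis
  have "ShMor D a \<cdot> neg D (ShMor D (Ide D E)) = neg D (ShMor D a)"
    using Comp_neg[OF Ide_in ShMor_in[OF assms(2)]] Comp_Ide[OF ShMor_in[OF assms(2)]] ShMor_Ide H ShOb_in
    by simp
  moreover have "neg D (ShMor D f) \<cdot> c = neg D (ShMor D (f \<cdot> b))"
    using neg_Comp[OF c(1) ShMor_in[OF H(1)]] ShMor_Comp[OF b(1) H(1)] b(2) by simp
  ultimately have "neg D (ShMor D a) = neg D (ShMor D (f \<cdot> b))" using c(2) by simp
  then have "ShMor D a = ShMor D (f \<cdot> b)" using neg_neg ShMor_in b H Comp_in assms by metis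
  then show ?thesis using that b ShMor_inj assms H Comp_in by metis
qed

text \<open>Exactness of Hom(-,E) at Y, by TR3 into the triangle 0 -> E -> E, which is itself a
  rotation of the triangle on the identity of E.\<close>

lemma dt_extend:
  assumes "dt X Y Z f g h" "a \<in> Hom D Y E" "a \<cdot> f = Zero D X E"
  obtains b where "b \<in> Hom D Z E" "b \<cdot> g = a"
proof -
  obtain N where N: "is_zero D N" using zero_object by blast
  have H: "f \<in> Hom D X Y" "g \<in> Hom D Y Z" "h \<in> Hom D Z (ShOb D X)" "X \<in> Ob D" "Y \<in> Ob D" "Z \<in> Ob D" "N \<in> Ob D"
    "E \<in> Ob D"
    using assms dt_Hom dt_Ob N is_zero_Ob Hom_Ob by blast+
  have N': "is_zero D (ShOb D N)" "ShOb D N \<in> Ob D" using N is_zero_ShOb H ShOb_in by auto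
  have "dt E E (ShOb D N) (Ide D E) (Zero D E (ShOb D N)) (Zero D (ShOb D N) (ShOb D E))"
    unfolding dt_def using TR1_id[of E "ShOb D N"] N' H Ide_in Zero_in ShOb_in by blast
  then have 1: "dt N E E (Zero D N E) (Ide D E) (Zero D E (ShOb D N))"
    using dt_rotate_iff[of "Zero D N E" N E "Ide D E" E "Zero D E (ShOb D N)"] H N' Zero_in Ide_in
      ShMor_Zero neg_Zero ShOb_in by metis
  obtain c where "c \<in> Hom D Z E" "c \<cdot> g = Ide D E \<cdot> a"
    using dt_map[OF assms(1) 1, of "Zero D X N" a] assms H Zero_in Zero_Comp[of "Zero D X N" X N E] by metis
  then show ?thesis using that assms Ide_Comp by metis
qed

lemma tri_orth_left: assumes "tri X Y Z" "orth E X" "orth E Z" "E \<in> Ob D" shows "orth E Y"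
proof (rule orthI)
  show "E \<in> Ob D" "Y \<in> Ob D" using assms tri_Ob by blast+
  fix a assume a: "a \<in> Hom D E Y"
  obtain f g h where t: "dt X Y Z f g h" using assms tri_def by blast
  then have "g \<cdot> a = Zero D E Z" using a assms(3) dt_Hom Comp_in orthD by meson
  then obtain b where "b \<in> Hom D E X" "f \<cdot> b = a" using dt_lift t a by blast
  then show "a = Zero D E Y" using assms(2,4) Comp_Zero dt_Hom[OF t] orthD by metis
qed

lemma tri_orth_right: assumes "tri X Y Z" "orth X E" "orth Z E" "E \<in> Ob D" shows "orth Y E"
proof (rule orthI)
  show "E \<in> Ob D" "Y \<in> Ob D" using assms tri_Ob by blast+
  fix a assume a: "a \<in> Hom D Y E"
  obtain f g h where t: "dt X Y Z f g h" using assms tri_def by blast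
  then have "a \<cdot> f = Zero D X E" using a assms(2) dt_Hom Comp_in orthD by meson
  then obtain b where "b \<in> Hom D Z E" "b \<cdot> g = a" using dt_extend t a by blast
  then show "a = Zero D Y E" using assms(3,4) Zero_Comp dt_Hom[OF t] orthD by metis
qed

text \<open>Exactness alone suffices: the identity of Y lifts through \<open>f\<close>, and the
  identity of X[1] extends along the shift of \<open>f\<close>, which gives inverses on either
  side.\<close>

lemma dt_third_zero: assumes "dt X Y Z f g h" "is_zero D Z" shows "is_iso D f"
proof -
  have H: "f \<in> Hom D X Y" "g \<in> Hom D Y Z" "X \<in> Ob D" "Y \<in> Ob D" "h \<in> Hom D Z (ShOb D X)"
    using assms dt_Hom dt_Ob by blast+
  have "g \<cdot> Ide D Y = Zero D Y Z" using H Comp_in Ide_in Hom_zero_target assms by metis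
  then obtain r where r: "r \<in> Hom D Y X" "f \<cdot> r = Ide D Y" using dt_lift assms H Ide_in by metis
  have "Ide D (ShOb D X) \<cdot> h = Zero D Z (ShOb D X)"
    using H Ide_Comp Hom_zero_source assms by metis
  then obtain l' where l': "l' \<in> Hom D (ShOb D Y) (ShOb D X)" "l' \<cdot> neg D (ShMor D f) = Ide D (ShOb D X)"
    using dt_extend[OF dt_rotate[OF dt_rotate[OF assms(1)]]] Ide_in ShOb_in H by metis
  then have "neg D l' \<cdot> ShMor D f = Ide D (ShOb D X)" using H ShMor_in Comp_neg neg_Comp by metis
  moreover obtain l where "l \<in> Hom D Y X" "ShMor D l = neg D l'" using l' neg_in ShMor_surj H by metis
  ultimately have "ShMor D (l \<cdot> f) = ShMor D (Ide D X)" "l \<in> Hom D Y X" using ShMor_Comp ShMor_Ide H by metis+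
  then have "l \<cdot> f = Ide D X" "l \<in> Hom D Y X" using ShMor_inj Comp_in Ide_in H by meson+
  then show ?thesis using is_isoI2 r H by meson
qed

lemma tri_third_zero: "tri X Y Z \<Longrightarrow> is_zero D Z \<Longrightarrow> X \<simeq> Y"
  unfolding tri_def isomorphic_def using dt_third_zero dt_Hom by blast

lemma tri_rotate: "tri X Y Z \<Longrightarrow> tri Y Z (ShOb D X)"
  unfolding tri_def using dt_rotate by blast

lemma dt_iso_third:
  assumes "dt X Y Z f g h" "c \<in> Hom D Z Z'" "is_iso D c"
  obtains h' where "dt X Y Z' f (c \<cdot> g) h'"
proof -
  obtain c' where c': "c' \<in> Hom D Z' Z" "c' \<cdot> c = Ide D Z" using assms is_isoE by metis
  have H: "f \<in> Hom D X Y" "g \<in> Hom D Y Z" "h \<in> Hom D Z (ShOb D X)" "X \<in> Ob D" "Y \<in> Ob D"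
    using assms dt_Hom dt_Ob by blast+
  have e: "Ide D (ShOb D X) \<cdot> h = (h \<cdot> c') \<cdot> c" 
    using c' H assms Comp_assoc Comp_Ide Ide_Comp by metis
  have "dt X Y Z' f (c \<cdot> g) (h \<cdot> c')"
    by (rule dt_iso[OF assms(1), where a = "Ide D X" and b = "Ide D Y" and c = c])
      (use H assms c' e Comp_in Ide_in is_iso_Ide Comp_Ide Ide_Comp ShMor_Ide in metis)+
  then show ?thesis using that by blast
qed

lemma dt_iso_first:
  assumes "dt X Y Z f g h" "a \<in> Hom D X' X" "is_iso D a"
  obtains h' where "dt X' Y Z (f \<cdot> a) g h'"
proof -
  obtain a' where a': "a' \<in> Hom D X X'" "a \<cdot> a' = Ide D X" "is_iso D a'" using assms is_isoE by metis
  have H: "f \<in> Hom D X Y" "g \<in> Hom D Y Z" "h \<in> Hom D Z (ShOb D X)" "X \<in> Ob D" "Y \<in> Ob D" "Z \<in> Ob D"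
    using assms dt_Hom dt_Ob by blast+
  have e: "Ide D Y \<cdot> f = (f \<cdot> a) \<cdot> a'" 
    using a' H assms Comp_assoc Comp_Ide Ide_Comp by metis
  have i: "ShMor D a' \<cdot> h \<in> Hom D Z (ShOb D X')" using a' H ShMor_in Comp_in by blast
  have "dt X' Y Z (f \<cdot> a) g (ShMor D a' \<cdot> h)"
    by (rule dt_iso[OF assms(1), where a = "a'" and b = "Ide D Y" and c = "Ide D Z"])
      (use H assms a' e i Comp_in Ide_in is_iso_Ide Comp_Ide Ide_Comp ShMor_Ide in metis)+
  then show ?thesis using that by blast
qed

lemma dt_iso_middle:
  assumes "dt X Y Z f g h" "b \<in> Hom D Y Y'" "is_iso D b"
  obtains g' where "dt X Y' Z (b \<cdot> f) g' h" "g' \<cdot> b = g"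
proof -
  obtain b' where b': "b' \<in> Hom D Y' Y" "b' \<cdot> b = Ide D Y" using assms is_isoE by metis
  have H: "f \<in> Hom D X Y" "g \<in> Hom D Y Z" "h \<in> Hom D Z (ShOb D X)" "X \<in> Ob D" "Y \<in> Ob D" "Z \<in> Ob D"
    using assms dt_Hom dt_Ob by blast+
  have e: "(g \<cdot> b') \<cdot> b = g" "Ide D Z \<cdot> g = (g \<cdot> b') \<cdot> b"
    using b' H assms Comp_assoc Comp_Ide Ide_Comp by metis+
  have "dt X Y' Z (b \<cdot> f) (g \<cdot> b') h"
    by (rule dt_iso[OF assms(1), where a = "Ide D X" and b = b and c = "Ide D Z"])
      (use H assms b' e Comp_in Ide_in is_iso_Ide Comp_Ide Ide_Comp ShMor_Ide in metis)+
  then show ?thesis using that e by blast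
qed

lemma tri_iso:
  assumes "tri X Y Z" "X \<simeq> X'" "Y \<simeq> Y'" "Z \<simeq> Z'" shows "tri X' Y' Z'"
proof -
  have "tri X Y Z'" using assms unfolding tri_def isomorphic_def by (meson dt_iso_third)
  moreover have "tri X Y' Z'" if "tri X Y Z'" using that assms unfolding tri_def isomorphic_def by (meson dt_iso_middle)
  moreover have "tri X' Y' Z'" if "tri X Y' Z'"
    using that iso_sym[OF assms(2)] unfolding tri_def isomorphic_def by (meson dt_iso_first)
  ultimately show ?thesis by blast
qed

lemma dt_unrotate:
  assumes "dt X Y Z f g h" "W \<in> Ob D" "ShOb D W \<simeq> Z"
  obtains w h' where "dt W X Y w f h'"
proof -
  obtain a a' where a: "a \<in> Hom D (ShOb D W) Z" "is_iso D a" "a' \<in> Hom D Z (ShOb D W)" 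
      "a' \<cdot> a = Ide D (ShOb D W)" "a \<cdot> a' = Ide D Z" "is_iso D a'"
    using assms(3) unfolding isomorphic_def by (meson is_isoE)
  have H: "f \<in> Hom D X Y" "g \<in> Hom D Y Z" "h \<in> Hom D Z (ShOb D X)" "X \<in> Ob D" "Y \<in> Ob D" "Z \<in> Ob D"
    using assms dt_Hom dt_Ob by blast+
  have "neg D (h \<cdot> a) \<in> Hom D (ShOb D W) (ShOb D X)" using a H Comp_in neg_in by blast
  then obtain w where w: "w \<in> Hom D W X" "ShMor D w = neg D (h \<cdot> a)" using ShMor_surj assms(2) H by metis
  have n: "neg D (ShMor D w) = h \<cdot> a" using w neg_neg Comp_in a H by metis
  have i: "a' \<cdot> g \<in> Hom D Y (ShOb D W)" "h \<cdot> a \<in> Hom D (ShOb D W) (ShOb D X)" using a H Comp_in by blast+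
  have e: "Ide D (ShOb D X) \<cdot> h = (h \<cdot> a) \<cdot> a'"
    using a H Comp_assoc Comp_Ide Ide_Comp by metis
  have "dt X Y (ShOb D W) f (a' \<cdot> g) (h \<cdot> a)"
    by (rule dt_iso[OF assms(1), where a = "Ide D X" and b = "Ide D Y" and c = a'])
      (use H a i e Comp_in Ide_in is_iso_Ide Comp_Ide Ide_Comp ShMor_Ide in metis)+
  then have "dt W X Y w f (a' \<cdot> g)" using dt_rotate_iff[OF w(1) H(1) i(1)] n by simp
  then show ?thesis using that by blast
qed

lemma tri_unrotate: "tri X Y Z \<Longrightarrow> W \<in> Ob D \<Longrightarrow> ShOb D W \<simeq> Z \<Longrightarrow> tri W X Y"
  unfolding tri_def using dt_unrotate by metis

lemma tri_ShOb: assumes "X \<in> Ob D" "Y \<in> Ob D" "Z \<in> Ob D"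
  shows "tri (ShOb D X) (ShOb D Y) (ShOb D Z) \<longleftrightarrow> tri X Y Z"
  using assms tri_rotate tri_unrotate iso_refl ShOb_in by metis

text \<open>The octahedron on \<open>f\<close> followed by the identity of Y contains a triangle Z
  -> Z' -> 0; no five lemma is required.\<close>

lemma tri_cone_iso:
  assumes "dt X Y Z f g h" "dt X Y Z' f g' h'" shows "Z \<simeq> Z'"
proof -
  obtain N where N: "is_zero D N" using zero_object by blast
  have H: "f \<in> Hom D X Y" "X \<in> Ob D" "Y \<in> Ob D" using assms dt_Hom dt_Ob by blast+
  have 1: "dt Y Y N (Ide D Y) (Zero D Y N) (Zero D N (ShOb D Y))"
    unfolding dt_def using TR1_id[of Y N] N H Ide_in Zero_in ShOb_in is_zero_Ob by blast
  have "dt X Y Z' (Ide D Y \<cdot> f) g' h'" using assms H Ide_Comp by metis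
  then obtain u v w where "dt Z Z' N u v w" using dt_octahedral[OF assms(1) 1] by metis
  then show ?thesis using N dt_tri tri_third_zero by blast
qed

lemma tri_cocone_iso:
  assumes "dt X Y Z f g h" "dt X' Y Z f' g h'" shows "X \<simeq> X'"
  using tri_cone_iso[OF dt_rotate[OF assms(1)] dt_rotate[OF assms(2)]] iso_ShOb dt_Ob assms by meson

lemma desuspension: assumes "Y \<in> Ob D" obtains X where "X \<in> Ob D" "ShOb D X \<simeq> Y"
  using ShOb_ess_surj assms by blast

text \<open>The octahedral axiom on objects: E is filtered with successive factors X, P, Q, and the
  last two factors are grouped together.\<close>

lemma tri_assoc_left:
  assumes "tri X Y P" "tri Y E Q" obtains R where "tri P R Q" "tri X E R"
proof -
  obtain f f' f'' g g' g'' where *: "dt X Y P f f' f''" "dt Y E Q g g' g''" using assms unfolding tri_def by blast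
  then have "g \<cdot> f \<in> Hom D X E" using dt_Hom Comp_in by blast
  then obtain R k' k'' where **: "dt X E R (g \<cdot> f) k' k''" using dt_cone by blast
  show ?thesis using dt_octahedral[OF * **] ** dt_tri that by metis
qed

text \<open>The reverse regrouping, with the first two factors taken together. It is
  \<open>tri_assoc_left\<close> for the rotated triangles, followed by a desuspension.\<close>

lemma tri_assoc_right:
  assumes "tri X E R" "tri P R Q" obtains Y where "tri X Y P" "tri Y E Q"
proof -
  obtain R' where R': "tri (ShOb D X) R' (ShOb D P)" "tri E Q R'"
    using tri_assoc_left[OF tri_rotate[OF assms(1)] tri_rotate[OF assms(2)]] by metis
  obtain Y where Y: "Y \<in> Ob D" "ShOb D Y \<simeq> R'" using R' desuspension tri_Ob by metis
  have "tri Y E Q" using R' Y tri_unrotate by blast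
  moreover have "tri X Y P" 
    using tri_iso[OF R'(1) iso_refl iso_sym[OF Y(2)] iso_refl] tri_ShOb tri_Ob R' Y assms by blast
  ultimately show ?thesis using that by blast
qed

text \<open>The octahedron on \<open>X \<rightarrow> E \<rightarrow> S'\<close>: the object \<open>W\<close> plays the role of \<open>X \<inter> X'\<close>.\<close>

lemma dt_diamond:
  assumes "dt X E S x p t" "dt X' E S' x' p' t'"
  obtains W w r where "dt W X S' w (p' \<cdot> x) r" "tri W X' S"
proof -
  have H: "x \<in> Hom D X E" "p' \<in> Hom D E S'" using assms dt_Hom by blast+
  then have "p' \<cdot> x \<in> Hom D X S'" using Comp_in by blast
  then obtain K k' k'' where K: "dt X S' K (p' \<cdot> x) k' k''" using dt_cone by blast
  obtain W where W: "W \<in> Ob D" "ShOb D W \<simeq> K" using K desuspension dt_Ob by metis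
  obtain w r where w: "dt W X S' w (p' \<cdot> x) r" using dt_unrotate[OF K W] by blast
  have 1: "tri S K (ShOb D X')" using dt_octahedral[OF assms(1) dt_rotate[OF assms(2)] K] dt_tri by metis
  have "tri X' S K" using tri_unrotate[OF 1] iso_refl ShOb_in dt_Ob[OF assms(2)] by blast
  then have "tri W X' S" using tri_unrotate W by blast
  then show ?thesis using w that by blast
qed

lemma tri_zero_first: assumes "is_zero D N" "X \<simeq> Y" shows "tri N X Y"
proof -
  have X: "X \<in> Ob D" "Y \<in> Ob D" using assms iso_Ob by auto
  have "tri X X (ShOb D N)"
    unfolding tri_def dt_def using TR1_id[of X "ShOb D N"] is_zero_ShOb[OF assms(1)] Ide_in Zero_in ShOb_in X
    by (meson is_zero_Ob)
  then have "tri N X X" using tri_unrotate iso_refl is_zero_Ob assms ShOb_in by meson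
  then show ?thesis using tri_iso iso_refl is_zero_Ob assms X by meson
qed

lemma tri_zero_third: assumes "is_zero D N" "X \<simeq> Y" shows "tri X Y N"
proof -
  have X: "X \<in> Ob D" "Y \<in> Ob D" using assms iso_Ob by auto
  have "tri X X N"
    unfolding tri_def dt_def using TR1_id[of X N] Ide_in Zero_in ShOb_in X assms
    by (meson is_zero_Ob)
  then show ?thesis using tri_iso iso_refl is_zero_Ob assms X by meson
qed

lemma tri_first_zero: "tri X Y Z \<Longrightarrow> is_zero D X \<Longrightarrow> Y \<simeq> Z"
  using tri_third_zero[OF tri_rotate] is_zero_ShOb by blast

lemma tri_middle_zero: "tri X Y Z \<Longrightarrow> is_zero D Y \<Longrightarrow> Z \<simeq> ShOb D X"
  using tri_first_zero[OF tri_rotate] by blast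

section \<open>Shifts and t-structures\<close>

definition desusp :: "'o \<Rightarrow> 'o" where
  "desusp Y = (SOME X. X \<in> Ob D \<and> ShOb D X \<simeq> Y)"

text \<open>Negative shifts iterate a chosen desuspension. The laws of shifts consequently hold as
  isomorphisms and not as equalities.\<close>

definition sh :: "int \<Rightarrow> 'o \<Rightarrow> 'o" where
  "sh n X = (if 0 \<le> n then (ShOb D ^^ nat n) X else (desusp ^^ nat (- n)) X)"

lemma desusp: assumes "Y \<in> Ob D" shows "desusp Y \<in> Ob D" "ShOb D (desusp Y) \<simeq> Y"
  using someI_ex[of "\<lambda>X. X \<in> Ob D \<and> ShOb D X \<simeq> Y"] ShOb_ess_surj[OF assms] unfolding desusp_def by auto

lemma funpow_Ob: "X \<in> Ob D \<Longrightarrow> (ShOb D ^^ n) X \<in> Ob D" "X \<in> Ob D \<Longrightarrow> (desusp ^^ n) X \<in> Ob D"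
  by (induction n) (auto simp: ShOb_in desusp)

lemma sh_Ob: "X \<in> Ob D \<Longrightarrow> sh n X \<in> Ob D"
  by (simp add: sh_def funpow_Ob)

lemma sh_0 [simp]: "sh 0 X = X"
  by (simp add: sh_def)

lemma sh_1 [simp]: "sh 1 X = ShOb D X"
  by (simp add: sh_def)

lemma sh_step: assumes "X \<in> Ob D" shows "sh (n + 1) X \<simeq> ShOb D (sh n X)"
proof (cases "0 \<le> n")
  case True
  then have "sh (n + 1) X = ShOb D (sh n X)" by (simp add: sh_def nat_add_distrib)
  then show ?thesis using assms iso_refl sh_Ob by metis
next
  case False
  then have "nat (- n) = Suc (nat (- (n + 1)))" by simp
  moreover have "sh (n + 1) X = (desusp ^^ nat (- (n + 1))) X"
    using False by (cases "n = -1") (auto simp: sh_def)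
  ultimately have "sh n X = desusp (sh (n + 1) X)" using False by (simp add: sh_def)
  then show ?thesis using desusp(2) iso_sym sh_Ob assms by metis
qed

text \<open>Characterises the family of shifts up to isomorphism, so that laws such as
  \<open>sh_add\<close> need no case distinction on signs. The downward step uses that the shift
  reflects isomorphisms.\<close>

lemma sh_unique:
  assumes "A 0 \<simeq> X" "\<And>n. A n \<in> Ob D" "\<And>n. A (n + 1) \<simeq> ShOb D (A n)"
  shows "A n \<simeq> sh n X"
proof (induction n rule: int_induct[of _ 0])
  case base then show ?case using assms by simp
next
  case (step1 i)
  have X: "X \<in> Ob D" using assms iso_Ob by blast
  then have "ShOb D (A i) \<simeq> ShOb D (sh i X)" using step1 iso_ShOb assms sh_Ob by blast
  then show ?case using assms(3)[of i] sh_step[OF X, of i] iso_trans iso_sym by meson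
next
  case (step2 i)
  have X: "X \<in> Ob D" using assms iso_Ob by blast
  have "A i \<simeq> ShOb D (A (i - 1))" "sh i X \<simeq> ShOb D (sh (i - 1) X)"
    using assms(3)[of "i - 1"] sh_step[OF X, of "i - 1"] by auto
  then have "ShOb D (A (i - 1)) \<simeq> ShOb D (sh (i - 1) X)" using step2 iso_trans iso_sym by meson
  then show ?case using iso_ShOb assms sh_Ob X by blast
qed

lemma sh_add: assumes "X \<in> Ob D" shows "sh m (sh n X) \<simeq> sh (m + n) X"
proof -
  have "sh (m + n) X \<simeq> sh m (sh n X)"
  proof (rule sh_unique[of "\<lambda>m. sh (m + n) X"])
    show "sh (k + 1 + n) X \<simeq> ShOb D (sh (k + n) X)" for k
      using sh_step[OF assms, of "k + n"] by (simp add: ac_simps)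
  qed (use assms iso_refl sh_Ob in auto)
  then show ?thesis by (rule iso_sym)
qed

lemma sh_cong: "X \<simeq> Y \<Longrightarrow> sh n X \<simeq> sh n Y"
  using sh_unique[of "\<lambda>n. sh n X" Y n] sh_step iso_Ob sh_Ob by simp

lemma sh_minus: "X \<in> Ob D \<Longrightarrow> sh (- n) (sh n X) \<simeq> X" "X \<in> Ob D \<Longrightarrow> sh n (sh (- n) X) \<simeq> X"
  using sh_add[of X "- n" n] sh_add[of X n "- n"] by auto

lemma sh_iso_iff: "X \<in> Ob D \<Longrightarrow> Y \<in> Ob D \<Longrightarrow> sh n X \<simeq> sh n Y \<longleftrightarrow> X \<simeq> Y"
  using sh_cong[of "sh n X" "sh n Y" "- n"] sh_cong[of X Y n] sh_minus(1)[of _ n] iso_trans iso_sym by meson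

lemma sh_iso_transfer:
  assumes "X \<in> Ob D" "Y \<in> Ob D" shows "sh n X \<simeq> Y \<longleftrightarrow> X \<simeq> sh (- n) Y"
  using sh_iso_iff[of X "sh (- n) Y" n] sh_minus(2)[of Y n] assms sh_Ob iso_trans iso_sym by meson

lemma sh_induct:
  assumes "P 0" "\<And>n. P n \<longleftrightarrow> P (n + 1)" shows "P (n::int)"
  by (induction n rule: int_induct[of _ 0]) (use assms assms(2)[of "_ - 1"] in auto)

lemma orth_iso_iff: "X \<simeq> X' \<Longrightarrow> Y \<simeq> Y' \<Longrightarrow> orth X Y \<longleftrightarrow> orth X' Y'"
  using orth_iso[of X Y X' Y'] orth_iso[of X' Y' X Y] iso_sym by blast

lemma orth_sh: assumes "X \<in> Ob D" "Y \<in> Ob D" shows "orth (sh n X) (sh n Y) \<longleftrightarrow> orth X Y"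
proof (induction n rule: sh_induct)
  case (2 n)
  show ?case using orth_iso_iff[OF sh_step sh_step, of X Y n n] orth_ShOb[of "sh n X" "sh n Y"] assms sh_Ob
    by simp
qed simp

lemma is_zero_sh: assumes "X \<in> Ob D" shows "is_zero D (sh n X) \<longleftrightarrow> is_zero D X"
proof -
  have "is_zero D X \<longleftrightarrow> orth X X" if "X \<in> Ob D" for X using orth_self orth_zero that by blast
  then show ?thesis using orth_sh assms sh_Ob by blast
qed

lemma tri_sh: assumes "X \<in> Ob D" "Y \<in> Ob D" "Z \<in> Ob D"
  shows "tri (sh n X) (sh n Y) (sh n Z) \<longleftrightarrow> tri X Y Z"
proof (induction n rule: sh_induct)
  case (2 n)
  have "tri (sh (n + 1) X) (sh (n + 1) Y) (sh (n + 1) Z) \<longleftrightarrow>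
        tri (ShOb D (sh n X)) (ShOb D (sh n Y)) (ShOb D (sh n Z))"
    using tri_iso sh_step assms iso_sym by meson
  then show ?case using tri_ShOb sh_Ob assms by simp
qed simp

lemma shift_set_iff:
  assumes "X \<subseteq> Ob D" shows "E \<in> shift_set D n X \<longleftrightarrow> E \<in> Ob D \<and> (\<exists>Y\<in>X. E \<simeq> sh n Y)"
proof -
  have "(ShOb D ^^ nat (- n)) E \<simeq> (ShOb D ^^ nat n) Y \<longleftrightarrow> E \<simeq> sh n Y" if "E \<in> Ob D" "Y \<in> Ob D" for Y
  proof (cases "0 \<le> n")
    case True then show ?thesis by (cases "n = 0") (auto simp: sh_def)
  next
    case False
    then have "(ShOb D ^^ nat (- n)) E = sh (- n) E" by (simp add: sh_def)
    then show ?thesis using False sh_iso_transfer[of E Y "- n"] that by simp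
  qed
  then show ?thesis unfolding shift_set_def using assms by auto
qed

lemma strict_fullD: "strict_full D X \<Longrightarrow> E \<in> X \<Longrightarrow> E \<simeq> F \<Longrightarrow> F \<in> X"
  unfolding strict_full_def using iso_Ob by blast

lemma strict_full_Ob: "strict_full D X \<Longrightarrow> E \<in> X \<Longrightarrow> E \<in> Ob D"
  unfolding strict_full_def by blast

lemma shift_set_strict:
  assumes "strict_full D X" shows "E \<in> shift_set D n X \<longleftrightarrow> E \<in> Ob D \<and> sh (- n) E \<in> X"
proof -
  have "(\<exists>Y\<in>X. E \<simeq> sh n Y) \<longleftrightarrow> sh (- n) E \<in> X" if "E \<in> Ob D"
    using strict_fullD[OF assms] strict_full_Ob[OF assms] sh_iso_transfer[of E _ "- n"] that sh_Ob iso_refl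
      iso_sym sh_minus(2)[of E n] by (metis minus_minus)
  then show ?thesis using shift_set_iff assms unfolding strict_full_def by auto
qed

text \<open>The objects with cohomology in degrees at most, respectively at least, \<open>k\<close>.\<close>

definition le :: "'o set \<Rightarrow> int \<Rightarrow> 'o set" where
  "le C k = shift_set D (- k) C"

definition ge :: "'o set \<Rightarrow> int \<Rightarrow> 'o set" where
  "ge C k = shift_set D (1 - k) (right_perp D C)"

lemma right_perp_strict: assumes "C \<subseteq> Ob D" shows "strict_full D (right_perp D C)"
  unfolding strict_full_def right_perp_def
proof (intro conjI ballI impI CollectI; clarify?)
  fix E F X assume *: "E \<in> Ob D" "\<forall>X\<in>C. orth X E" "F \<in> Ob D" "E \<simeq> F" "X \<in> C"
  then show "orth X F" using orth_iso[of X E X F] iso_refl assms by blast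
qed

lemma right_perpD: "V \<in> right_perp D C \<Longrightarrow> U \<in> C \<Longrightarrow> orth U V"
  by (simp add: right_perp_def)

context
  fixes C assumes t: "t_structure D C"
begin

lemma ts_strict: "strict_full D C"
  using t by (simp add: t_structure_def)

lemma ts_Ob: "E \<in> C \<Longrightarrow> E \<in> Ob D"
  using ts_strict strict_full_Ob by blast

lemma perp_strict: "strict_full D (right_perp D C)"
  using right_perp_strict ts_Ob by blast

lemma le_iff: "E \<in> le C k \<longleftrightarrow> E \<in> Ob D \<and> sh k E \<in> C"
  unfolding le_def using shift_set_strict[OF ts_strict] by simp

text \<open>The shift is by \<open>k - 1\<close> because the right orthogonal of the aisle is the
  part in degrees at least 1.\<close>

lemma ge_iff: "E \<in> ge C k \<longleftrightarrow> E \<in> Ob D \<and> sh (k - 1) E \<in> right_perp D C"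
  unfolding ge_def using shift_set_strict[OF perp_strict] by simp

lemma le_Ob: "E \<in> le C k \<Longrightarrow> E \<in> Ob D" and ge_Ob: "E \<in> ge C k \<Longrightarrow> E \<in> Ob D"
  by (auto simp: le_iff ge_iff)

lemma le_0: "le C 0 = C"
  using le_iff ts_Ob by auto

lemma le_iso: "E \<in> le C k \<Longrightarrow> E \<simeq> F \<Longrightarrow> F \<in> le C k"
  using le_iff strict_fullD[OF ts_strict] sh_cong iso_Ob by meson

lemma ge_iso: "E \<in> ge C k \<Longrightarrow> E \<simeq> F \<Longrightarrow> F \<in> ge C k"
  using ge_iff strict_fullD[OF perp_strict] sh_cong iso_Ob by meson

lemma le_sh: "E \<in> Ob D \<Longrightarrow> sh m E \<in> le C k \<longleftrightarrow> E \<in> le C (k + m)"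
  using le_iff[of "sh m E"] le_iff[of E] sh_add[of E k m] sh_Ob strict_fullD[OF ts_strict] iso_sym by blast

lemma ge_sh: "E \<in> Ob D \<Longrightarrow> sh m E \<in> ge C k \<longleftrightarrow> E \<in> ge C (k + m)"
  using ge_iff[of "sh m E" k] ge_iff[of E "k + m"] sh_add[of E "k - 1" m] sh_Ob[of E m]
    strict_fullD[OF perp_strict, of "sh (k - 1) (sh m E)" "sh (k - 1 + m) E"]
    strict_fullD[OF perp_strict, of "sh (k - 1 + m) E" "sh (k - 1) (sh m E)"] iso_sym
  by (auto simp: algebra_simps)

lemma le_ShOb: "E \<in> Ob D \<Longrightarrow> ShOb D E \<in> le C k \<longleftrightarrow> E \<in> le C (k + 1)"
  and ge_ShOb: "E \<in> Ob D \<Longrightarrow> ShOb D E \<in> ge C k \<longleftrightarrow> E \<in> ge C (k + 1)"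
  using le_sh[of E 1] ge_sh[of E 1] by auto

lemma ts_ShOb: "E \<in> C \<Longrightarrow> ShOb D E \<in> C"
proof -
  assume E: "E \<in> C"
  then have "ShOb D E \<in> shift_set D 1 C"
    using shift_set_iff[of C "ShOb D E" 1] ts_Ob ShOb_in iso_refl by auto
  then show ?thesis using t unfolding t_structure_def by blast
qed

lemma le_mono: assumes "E \<in> le C i" "i \<le> j" shows "E \<in> le C j"
  using assms(2)
proof (induction rule: int_ge_induct)
  case (step j)
  then have "ShOb D (sh j E) \<in> C" using le_iff ts_ShOb by blast
  then show ?case using le_iff strict_fullD[OF ts_strict] sh_step iso_sym step by meson
qed (use assms in simp)

lemma le_ge_orth: assumes "X \<in> le C i" "Y \<in> ge C j" "i < j" shows "orth X Y"
proof -
  have "X \<in> le C (j - 1)" using le_mono[OF assms(1)] assms(3) by simp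
  then have "orth (sh (j - 1) X) (sh (j - 1) Y)" using right_perpD le_iff ge_iff assms by blast
  then show ?thesis using orth_sh assms le_Ob ge_Ob by blast
qed

lemma ge_char: assumes "E \<in> Ob D" "\<And>U. U \<in> le C k \<Longrightarrow> orth U E" shows "E \<in> ge C (k + 1)"
proof -
  have "orth U (sh k E)" if U: "U \<in> C" for U
  proof -
    have "sh (- k) U \<in> le C k" using le_sh[of U "- k"] U ts_Ob le_0 by simp
    then show ?thesis
      using assms orth_sh[of "sh (- k) U" E k] orth_iso[OF _ sh_minus(2) iso_refl] U ts_Ob sh_Ob by blast
  qed
  then show ?thesis using ge_iff assms(1) sh_Ob by (simp add: right_perp_def)
qed

lemma ge_mono: assumes "E \<in> ge C i" "j \<le> i" shows "E \<in> ge C j"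
  using ge_char[of E "j - 1"] le_ge_orth[OF _ assms(1)] assms ge_Ob by simp

lemma right_perp_le: "right_perp D (le C k) = ge C (k + 1)"
  using ge_char le_ge_orth[of _ k _ "k + 1"] ge_Ob by (auto simp: right_perp_def)

lemma truncation_iff: "truncation D (le C k) U E V \<longleftrightarrow> U \<in> le C k \<and> V \<in> ge C (k + 1) \<and> tri U E V"
  unfolding truncation_def tri_iff right_perp_le by auto

lemma truncate:
  assumes "E \<in> Ob D" obtains U V where "tri U E V" "U \<in> le C k" "V \<in> ge C (k + 1)"
proof -
  have "\<exists>U V. truncation D (le C 0) U (sh k E) V" using t assms sh_Ob unfolding t_structure_def le_0 by blast
  then obtain U V where UV: "U \<in> le C 0" "V \<in> ge C 1" "tri U (sh k E) V" using truncation_iff[of 0] by auto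
  then have Ob: "U \<in> Ob D" "V \<in> Ob D" using le_Ob ge_Ob by auto
  have "tri (sh (- k) U) (sh (- k) (sh k E)) (sh (- k) V)" using UV tri_sh Ob sh_Ob assms by blast
  then have "tri (sh (- k) U) E (sh (- k) V)" using tri_iso iso_refl sh_minus(1) sh_Ob assms Ob by meson
  then show ?thesis using that le_sh ge_sh UV Ob by simp
qed

end

text \<open>As E -> V is zero, the identity of V factors through the connecting morphism V -> U[1];
  the remaining factor U[1] -> V vanishes too.\<close>

lemma tri_split_third: assumes "tri U E V" "orth E V" "orth (ShOb D U) V" shows "is_zero D V" "U \<simeq> E"
proof -
  obtain f g h where T: "dt U E V f g h" using assms tri_def by blast
  have H: "g \<in> Hom D E V" "h \<in> Hom D V (ShOb D U)" "V \<in> Ob D" using T dt_Hom dt_Ob by blast+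
  have "g = Zero D E V" using assms(2) H orthD by blast
  then have "Ide D V \<cdot> g = Zero D E V" using H Ide_Comp by simp
  then obtain b where "b \<in> Hom D (ShOb D U) V" "b \<cdot> h = Ide D V" 
    using dt_extend[OF dt_rotate[OF T] Ide_in] H by metis
  then have "Ide D V = Zero D V V" using assms(3) Zero_Comp H orthD by metis
  then show "is_zero D V" using is_zero_iff H by blast
  then show "U \<simeq> E" using assms tri_third_zero by blast
qed

lemma tri_split_first: assumes "tri U E V" "orth U E" "orth (ShOb D U) V" shows "is_zero D U" "E \<simeq> V"
proof -
  obtain f g h where T: "dt U E V f g h" using assms tri_def by blast
  have H: "f \<in> Hom D U E" "h \<in> Hom D V (ShOb D U)" "V \<in> Ob D" "U \<in> Ob D" "E \<in> Ob D" using T dt_Hom dt_Ob by blast+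
  have "f = Zero D U E" using assms(2) H orthD by blast
  then have "neg D (ShMor D f) = Zero D (ShOb D U) (ShOb D E)" using ShMor_Zero neg_Zero H ShOb_in by simp
  then have "neg D (ShMor D f) \<cdot> Ide D (ShOb D U) = Zero D (ShOb D U) (ShOb D E)"
    using Comp_Ide[OF Zero_in] H ShOb_in by simp
  then obtain b where "b \<in> Hom D (ShOb D U) V" "h \<cdot> b = Ide D (ShOb D U)" 
    using dt_lift[OF dt_rotate[OF dt_rotate[OF T]] Ide_in] H ShOb_in by metis
  then have "Ide D (ShOb D U) = Zero D (ShOb D U) (ShOb D U)" using assms(3) Comp_Zero H orthD ShOb_in by metis
  then have "is_zero D (ShOb D U)" using is_zero_iff ShOb_in H by blast
  then show "is_zero D U" using is_zero_ShOb_iff H by blast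
  then show "E \<simeq> V" using assms tri_first_zero by blast
qed

text \<open>The shift of \<open>u\<close> dies in Y[1], hence lifts along the connecting morphism to
  P[1] -> Z, which is zero by assumption.\<close>

lemma dt_mono:
  assumes "dt X Y Z f g h" "orth (ShOb D P) Z" "u \<in> Hom D P X" "f \<cdot> u = Zero D P Y"
  shows "u = Zero D P X"
proof -
  have H: "f \<in> Hom D X Y" "h \<in> Hom D Z (ShOb D X)" "X \<in> Ob D" "P \<in> Ob D" "Y \<in> Ob D" "ShMor D u \<in> Hom D (ShOb D P) (ShOb D X)"
    using assms dt_Hom dt_Ob Hom_Ob ShMor_in by blast+
  have "neg D (ShMor D f) \<cdot> ShMor D u = neg D (ShMor D f \<cdot> ShMor D u)" using neg_Comp[OF H(6) ShMor_in] H by blast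
  also have "\<dots> = Zero D (ShOb D P) (ShOb D Y)" 
    using ShMor_Comp[OF assms(3) H(1)] assms(4) ShMor_Zero neg_Zero H ShOb_in by metis
  finally obtain b where "b \<in> Hom D (ShOb D P) Z" "h \<cdot> b = ShMor D u"
    using dt_lift[OF dt_rotate[OF dt_rotate[OF assms(1)]] H(6)] by metis
  then have "ShMor D u = Zero D (ShOb D P) (ShOb D X)" using assms(2) Comp_Zero H orthD ShOb_in by metis
  then show ?thesis using ShMor_eq_Zero assms by blast
qed

lemma dt_epi:
  assumes "dt X Y Z f g h" "orth (ShOb D X) Q" "u \<in> Hom D Z Q" "u \<cdot> g = Zero D Y Q"
  shows "u = Zero D Z Q"
proof -
  have H: "Z \<in> Ob D" "Q \<in> Ob D" "h \<in> Hom D Z (ShOb D X)" using assms dt_Ob Hom_Ob dt_Hom by blast+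
  obtain b where "b \<in> Hom D (ShOb D X) Q" "b \<cdot> h = u" using dt_extend[OF dt_rotate[OF assms(1)] assms(3,4)] by metis
  then show ?thesis using assms(2) Zero_Comp H orthD by metis
qed

context
  fixes C assumes t: "t_structure D C"
begin

text \<open>In the truncation triangle of E both E and U[1] are orthogonal to V, so V is zero and E
  is isomorphic to U.\<close>

lemma le_char: assumes "E \<in> Ob D" "\<And>V. V \<in> ge C (k + 1) \<Longrightarrow> orth E V" shows "E \<in> le C k"
proof -
  obtain U V where UV: "tri U E V" "U \<in> le C k" "V \<in> ge C (k + 1)" using truncate[OF t] assms by blast
  then have "ShOb D U \<in> le C k" using le_ShOb[OF t] le_mono[OF t] le_Ob[OF t] by simp
  then have "orth (ShOb D U) V" using le_ge_orth[OF t] UV by simp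
  then show ?thesis using tri_split_third UV assms le_iso[OF t] by blast
qed

lemma le_ext: "tri X Y Z \<Longrightarrow> X \<in> le C k \<Longrightarrow> Z \<in> le C k \<Longrightarrow> Y \<in> le C k"
  by (rule le_char) (use tri_Ob tri_orth_right le_ge_orth[OF t] ge_Ob[OF t] in \<open>auto simp: le_ge_orth[OF t]\<close>)

lemma ge_ext: assumes "tri X Y Z" "X \<in> ge C k" "Z \<in> ge C k" shows "Y \<in> ge C k"
proof -
  have "orth U Y" if "U \<in> le C (k - 1)" for U
    using tri_orth_left[OF assms(1)] le_ge_orth[OF t that assms(2)] le_ge_orth[OF t that assms(3)] le_Ob[OF t that]
    by simp
  then show ?thesis using ge_char[OF t, of Y "k - 1"] assms tri_Ob by simp
qed

lemma le_third: "tri X Y Z \<Longrightarrow> X \<in> le C (k + 1) \<Longrightarrow> Y \<in> le C k \<Longrightarrow> Z \<in> le C k"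
  using le_ext[OF tri_rotate] le_ShOb[OF t] tri_Ob by blast

lemma ge_third: "tri X Y Z \<Longrightarrow> X \<in> ge C (k + 1) \<Longrightarrow> Y \<in> ge C k \<Longrightarrow> Z \<in> ge C k"
  using ge_ext[OF tri_rotate] ge_ShOb[OF t] tri_Ob by blast

lemma le_first: assumes "tri X Y Z" "Y \<in> le C k" "Z \<in> le C (k - 1)" shows "X \<in> le C k"
proof -
  have Z: "Z \<in> Ob D" using assms tri_Ob by blast
  then have "tri (desusp Z) X Y" using tri_unrotate assms desusp by blast
  moreover have "desusp Z \<in> le C k"
    using assms(3) le_iso[OF t] iso_sym desusp[OF Z] le_ShOb[OF t, of "desusp Z" "k - 1"] by fastforce
  ultimately show ?thesis using le_ext assms by blast
qed

lemma ge_first: assumes "tri X Y Z" "Y \<in> ge C k" "Z \<in> ge C (k - 1)" shows "X \<in> ge C k"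
proof -
  have Z: "Z \<in> Ob D" using assms tri_Ob by blast
  then have "tri (desusp Z) X Y" using tri_unrotate assms desusp by blast
  moreover have "desusp Z \<in> ge C k"
    using assms(3) ge_iso[OF t] iso_sym desusp[OF Z] ge_ShOb[OF t, of "desusp Z" "k - 1"] by fastforce
  ultimately show ?thesis using ge_ext assms by blast
qed

text \<open>Orthogonality lets each of \<open>f\<close>, \<open>f'\<close> factor through the other.
  The composites are identities because U[1] is orthogonal to V, which makes \<open>f\<close> left
  cancellable on objects of the aisle; the second claim is then uniqueness of cones.\<close>

lemma truncation_unique:
  assumes "tri U E V" "tri U' E V'" "U \<in> le C k" "U' \<in> le C k" "V \<in> ge C (k + 1)" "V' \<in> ge C (k + 1)"
  shows "U \<simeq> U'" "V \<simeq> V'"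
proof -
  obtain f g h where 1: "dt U E V f g h" using assms tri_def by blast
  obtain f' g' h' where 2: "dt U' E V' f' g' h'" using assms tri_def by blast
  have H: "f \<in> Hom D U E" "g \<in> Hom D E V" "f' \<in> Hom D U' E" "g' \<in> Hom D E V'" "U \<in> Ob D" "U' \<in> Ob D"
    using 1 2 dt_Hom dt_Ob by blast+
  have o: "orth P W" "orth (ShOb D P) W" if "P \<in> le C k" "W \<in> ge C (k + 1)" for P W
    using that le_ge_orth[OF t that] le_ge_orth[OF t, of "ShOb D P" "k - 1"] le_ShOb[OF t] le_Ob[OF t]
    by auto
  have retract: "u = Ide D P"
    if d: "dt P E W x p r" and P: "P \<in> le C k" "W \<in> ge C (k + 1)" and u: "u \<in> Hom D P P" "x \<cdot> u = x" for P W x p r u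
  proof -
    have x: "x \<in> Hom D P E" "Ide D P \<in> Hom D P P" using d dt_Hom dt_Ob Ide_in by blast+
    have "x \<cdot> Plus D u (neg D (Ide D P)) = Plus D x (neg D x)"
      using Comp_Plus[OF u(1) neg_in x(1)] Comp_neg[OF x(2,1)] Comp_Ide[OF x(1)] u x by simp
    then have "Plus D u (neg D (Ide D P)) = Zero D P P"
      using dt_mono[OF d o(2)[OF P] Plus_in[OF u(1) neg_in]] x Plus_neg by simp
    then show ?thesis using diff_zero u x by blast
  qed
  have z: "g' \<cdot> f = Zero D U V'" "g \<cdot> f' = Zero D U' V"
    using orthD[OF o(1)[OF assms(3,6)] Comp_in[OF H(1,4)]] orthD[OF o(1)[OF assms(4,5)] Comp_in[OF H(3,2)]]
    by auto
  obtain a where a: "a \<in> Hom D U U'" "f' \<cdot> a = f" using dt_lift[OF 2 H(1) z(1)] by blast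
  obtain b where b: "b \<in> Hom D U' U" "f \<cdot> b = f'" using dt_lift[OF 1 H(3) z(2)] by blast
  have "f \<cdot> (b \<cdot> a) = f" "f' \<cdot> (a \<cdot> b) = f'"
    using Comp_assoc[OF a(1) b(1) H(1)] Comp_assoc[OF b(1) a(1) H(3)] a b by simp_all
  then have "b \<cdot> a = Ide D U" "a \<cdot> b = Ide D U'"
    using retract[OF 1 assms(3,5) Comp_in[OF a(1) b(1)]] retract[OF 2 assms(4,6) Comp_in[OF b(1) a(1)]] by auto
  then have i: "is_iso D a" using is_isoI[OF a(1) b(1)] by blast
  then show "U \<simeq> U'" unfolding isomorphic_def using a(1) by blast
  obtain h'' where "dt U E V' (f' \<cdot> a) g' h''" using dt_iso_first[OF 2 a(1) i] by blast
  then have "dt U E V' f g' h''" using a by simp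
  then show "V \<simeq> V'" using tri_cone_iso[OF 1] by blast
qed

lemma heart_eq: "heart D C = le C 0 \<inter> ge C 0"
  unfolding heart_def le_0[OF t] ge_def by simp

lemma heart_iff: "E \<in> heart D C \<longleftrightarrow> E \<in> le C 0 \<and> E \<in> ge C 0"
  using heart_eq by blast

lemma heart_Ob: "E \<in> heart D C \<Longrightarrow> E \<in> Ob D"
  using heart_eq le_Ob[OF t] by blast

lemma heart_iso: "E \<in> heart D C \<Longrightarrow> E \<simeq> F \<Longrightarrow> F \<in> heart D C"
  using heart_eq le_iso[OF t] ge_iso[OF t] by blast

lemma heart_ext: "tri X Y Z \<Longrightarrow> X \<in> heart D C \<Longrightarrow> Z \<in> heart D C \<Longrightarrow> Y \<in> heart D C"
  using heart_eq le_ext ge_ext by blast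

lemma heart_orth: "X \<in> heart D C \<Longrightarrow> Y \<in> heart D C \<Longrightarrow> orth (ShOb D X) Y"
  using le_ge_orth[OF t, of "ShOb D X" "-1" Y 0] le_ShOb[OF t, of X "-1"] heart_iff heart_Ob by simp

lemma zero_le: assumes "is_zero D N" shows "N \<in> le C k"
  by (rule le_char) (use assms orth_zero is_zero_Ob ge_Ob[OF t] in auto)

lemma zero_ge: assumes "is_zero D N" shows "N \<in> ge C k"
  using ge_char[OF t, of N "k - 1"] assms orth_zero is_zero_Ob le_Ob[OF t] by simp

lemma zero_heart: "is_zero D N \<Longrightarrow> N \<in> heart D C"
  using zero_le zero_ge heart_iff by blast

lemma le_ge_zero: "E \<in> le C i \<Longrightarrow> E \<in> ge C j \<Longrightarrow> i < j \<Longrightarrow> is_zero D E"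
  using le_ge_orth[OF t] orth_self le_Ob[OF t] by blast

end

lemma bounded_ts: "bounded_t_structure D C \<Longrightarrow> t_structure D C"
  by (simp add: bounded_t_structure_def)

lemma bounded_le: assumes "bounded_t_structure D C" "E \<in> Ob D" obtains k where "E \<in> le C k"
proof -
  obtain m where "E \<in> shift_set D m C" using assms unfolding bounded_t_structure_def by blast
  then have "E \<in> le C (- m)" by (simp add: le_def)
  then show ?thesis using that by blast
qed

lemma bounded_ge: assumes "bounded_t_structure D C" "E \<in> Ob D" obtains k where "E \<in> ge C k"
proof -
  obtain m where "E \<in> shift_set D m (right_perp D C)" using assms unfolding bounded_t_structure_def by blast
  then have "E \<in> ge C (1 - m)" by (simp add: ge_def)
  then show ?thesis using that by blast
qed

lemma le_subset: "t_structure D C \<Longrightarrow> t_structure D C' \<Longrightarrow> C \<subseteq> C' \<Longrightarrow> E \<in> le C k \<Longrightarrow> E \<in> le C' k"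
  using le_iff by blast

lemma ge_subset: "t_structure D C \<Longrightarrow> t_structure D C' \<Longrightarrow> C \<subseteq> C' \<Longrightarrow> E \<in> ge C' k \<Longrightarrow> E \<in> ge C k"
  using ge_iff by (auto simp: right_perp_def)

end

section \<open>The heart\<close>

lemma full_sub_simps [simp]:
  "Ob (full_sub D X) = Ob D \<inter> X"
  "Mor (full_sub D X) = {f \<in> Mor D. Dom D f \<in> X \<and> Cod D f \<in> X}"
  "Dom (full_sub D X) = Dom D" "Cod (full_sub D X) = Cod D" "Ide (full_sub D X) = Ide D"
  "Comp (full_sub D X) = Comp D" "Plus (full_sub D X) = Plus D" "Zero (full_sub D X) = Zero D"
  by (simp_all add: full_sub_def)

lemma Hom_full_sub: "A \<in> X \<Longrightarrow> B \<in> X \<Longrightarrow> Hom (full_sub D X) A B = Hom D A B"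
  by (auto simp: Hom_def)

context triangulated_category
begin

lemma is_iso_full_sub:
  assumes "f \<in> Mor D" "Dom D f \<in> X" "Cod D f \<in> X" shows "is_iso (full_sub D X) f \<longleftrightarrow> is_iso D f"
  unfolding is_iso_def using assms Hom_full_sub[of "Cod D f" X "Dom D f" D] by simp

lemma isomorphic_full_sub:
  assumes "A \<in> X" "B \<in> X" shows "isomorphic (full_sub D X) A B \<longleftrightarrow> A \<simeq> B"
proof -
  have "is_iso (full_sub D X) f \<longleftrightarrow> is_iso D f" if "f \<in> Hom D A B" for f
    using that assms is_iso_full_sub[of f X] by (auto simp: Hom_def)
  then show ?thesis unfolding isomorphic_def Hom_full_sub[OF assms] by blast
qed

lemma is_zero_full_sub: "is_zero (full_sub D X) Z \<longleftrightarrow> Z \<in> X \<and> is_zero D Z"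
proof
  assume z: "is_zero (full_sub D X) Z"
  then have Z: "Z \<in> Ob D" "Z \<in> X" by (auto simp: is_zero_def)
  from z have "\<forall>W\<in>Ob (full_sub D X). \<exists>!f. f \<in> Hom (full_sub D X) W Z" unfolding is_zero_def by blast
  from bspec[OF this, of Z] have "\<exists>!f. f \<in> Hom D Z Z" using Z Hom_full_sub[of Z X Z D] by simp
  then have "Ide D Z = Zero D Z Z" using Ide_in[OF Z(1)] Zero_in[OF Z(1) Z(1)] by blast
  then show "Z \<in> X \<and> is_zero D Z" using is_zero_iff Z by blast
next
  assume z: "Z \<in> X \<and> is_zero D Z"
  then show "is_zero (full_sub D X) Z" unfolding is_zero_def by (simp add: Hom_full_sub)
qed

lemma dt_mono_inj:
  assumes "dt X Y Z f g h" "orth (ShOb D P) Z" "u \<in> Hom D P X" "v \<in> Hom D P X" "f \<cdot> u = f \<cdot> v"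
  shows "u = v"
proof -
  have f: "f \<in> Hom D X Y" using assms dt_Hom by blast
  have "f \<cdot> Plus D u (neg D v) = Zero D P Y"
    using Comp_Plus[OF assms(3) neg_in[OF assms(4)] f] Comp_neg[OF assms(4) f] assms(5)
      Plus_neg[OF Comp_in[OF assms(4) f]] by simp
  then show ?thesis using dt_mono[OF assms(1,2) Plus_in[OF assms(3) neg_in[OF assms(4)]]] diff_zero[OF assms(3,4)]
    by blast
qed

lemma dt_epi_inj:
  assumes "dt X Y Z f g h" "orth (ShOb D X) Q" "u \<in> Hom D Z Q" "v \<in> Hom D Z Q" "u \<cdot> g = v \<cdot> g"
  shows "u = v"
proof -
  have g: "g \<in> Hom D Y Z" using assms dt_Hom by blast
  have "Plus D u (neg D v) \<cdot> g = Zero D Y Q"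
    using Plus_Comp[OF g assms(3) neg_in[OF assms(4)]] neg_Comp[OF g assms(4)] assms(5)
      Plus_neg[OF Comp_in[OF g assms(4)]] by simp
  then show ?thesis using dt_epi[OF assms(1,2) Plus_in[OF assms(3) neg_in[OF assms(4)]]] diff_zero[OF assms(3,4)]
    by blast
qed

section \<open>Short exact sequences and images in the heart\<close>

context
  fixes C assumes t: "t_structure D C"
begin

lemma Hom_heart: "A \<in> heart D C \<Longrightarrow> B \<in> heart D C \<Longrightarrow> Hom (heart_cat D C) A B = Hom D A B"
  by (rule Hom_full_sub)

lemma Mor_heart: "f \<in> Hom D A B \<Longrightarrow> A \<in> heart D C \<Longrightarrow> B \<in> heart D C \<Longrightarrow> f \<in> Mor (heart_cat D C)"
  by (auto simp: Hom_def)

text \<open>Factorisations exist by exactness; they are unique because P[1] is orthogonal to Z for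
  P, Z in the heart.\<close>

lemma dt_is_kernel:
  assumes T: "dt X Y Z f g h" and H: "X \<in> heart D C" "Y \<in> heart D C" "Z \<in> heart D C"
  shows "is_kernel (heart_cat D C) f g"
proof -
  have fg: "f \<in> Hom D X Y" "g \<in> Hom D Y Z" "g \<cdot> f = Zero D X Z" using T dt_Hom dt_zero by blast+
  have "\<exists>!u. u \<in> Hom D P X \<and> f \<cdot> u = k" if k: "k \<in> Hom D P Y" "P \<in> heart D C" "g \<cdot> k = Zero D P Z" for k P
    using dt_lift[OF T k(1,3)] dt_mono_inj[OF T heart_orth[OF t k(2) H(3)]] by metis
  moreover have "Dom D k \<in> heart D C \<and> k \<in> Hom D (Dom D k) Y" if "k \<in> Mor (heart_cat D C)" "Cod D k = Y" for k
    using that by (auto simp: Hom_def)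
  ultimately show ?thesis unfolding is_kernel_def
    using fg H Mor_heart[OF fg(1)] Mor_heart[OF fg(2)] Hom_heart
    by (simp add: Hom_Dom[OF fg(1)] Hom_Cod[OF fg(1)] Hom_Dom[OF fg(2)] Hom_Cod[OF fg(2)])
qed

lemma dt_is_cokernel:
  assumes T: "dt X Y Z f g h" and H: "X \<in> heart D C" "Y \<in> heart D C" "Z \<in> heart D C"
  shows "is_cokernel (heart_cat D C) g f"
proof -
  have fg: "f \<in> Hom D X Y" "g \<in> Hom D Y Z" "g \<cdot> f = Zero D X Z" using T dt_Hom dt_zero by blast+
  have "\<exists>!u. u \<in> Hom D Z P \<and> u \<cdot> g = k" if k: "k \<in> Hom D Y P" "P \<in> heart D C" "k \<cdot> f = Zero D X P" for k P
    using dt_extend[OF T k(1,3)] dt_epi_inj[OF T heart_orth[OF t H(1) k(2)]] by metis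
  moreover have "Cod D k \<in> heart D C \<and> k \<in> Hom D Y (Cod D k)" if "k \<in> Mor (heart_cat D C)" "Dom D k = Y" for k
    using that by (auto simp: Hom_def)
  ultimately show ?thesis unfolding is_cokernel_def
    using fg H Mor_heart[OF fg(1)] Mor_heart[OF fg(2)] Hom_heart
    by (simp add: Hom_Dom[OF fg(1)] Hom_Cod[OF fg(1)] Hom_Dom[OF fg(2)] Hom_Cod[OF fg(2)])
qed

lemma dt_short_exact:
  "dt X Y Z f g h \<Longrightarrow> X \<in> heart D C \<Longrightarrow> Y \<in> heart D C \<Longrightarrow> Z \<in> heart D C \<Longrightarrow> short_exact (heart_cat D C) f g"
  unfolding short_exact_def using dt_is_kernel dt_is_cokernel by blast

lemma cone_le: "tri X Y N \<Longrightarrow> X \<in> heart D C \<Longrightarrow> Y \<in> heart D C \<Longrightarrow> N \<in> le C 0"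
  using le_third[OF t, of X Y N 0] le_mono[OF t] heart_iff[OF t] by force

lemma cone_ge: "tri X Y N \<Longrightarrow> X \<in> heart D C \<Longrightarrow> Y \<in> heart D C \<Longrightarrow> N \<in> ge C (-1)"
  using ge_third[OF t, of X Y N "-1"] ge_mono[OF t] heart_iff[OF t] by force

lemma kernel_mono:
  assumes "is_kernel (heart_cat D C) f g" "f \<in> Hom D X Y" "u \<in> Hom D P X" "v \<in> Hom D P X" "P \<in> heart D C"
    "f \<cdot> u = f \<cdot> v"
  shows "u = v"
proof -
  have f: "X \<in> heart D C" "Y \<in> heart D C" "Y = Dom D g" "g \<in> Hom D Y (Cod D g)" "Cod D g \<in> heart D C" "g \<cdot> f = Zero D X (Cod D g)"
    using assms(1,2) unfolding is_kernel_def by (auto simp: Hom_def)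
  have fu: "f \<cdot> u \<in> Hom D P Y" using Comp_in assms by blast
  have "g \<cdot> (f \<cdot> u) = Zero D P (Cod D g)"
    using Comp_assoc[OF assms(3,2) f(4)] f(6) Zero_Comp[OF assms(3)] Hom_Ob[OF f(4)] by simp
  moreover have "\<forall>k\<in>Mor (heart_cat D C). Cod D k = Dom D g \<and> g \<cdot> k = Zero D (Dom D k) (Cod D g) \<longrightarrow>
      (\<exists>!u. u \<in> Hom (heart_cat D C) (Dom D k) (Dom D f) \<and> f \<cdot> u = k)"
    using assms(1) unfolding is_kernel_def by simp
  from bspec[OF this Mor_heart[OF fu assms(5) f(2)]] calculation
  have "\<exists>!w. w \<in> Hom D P X \<and> f \<cdot> w = f \<cdot> u"
    using Hom_heart[OF assms(5) f(1)] f(3) by (simp add: Hom_Dom[OF fu] Hom_Cod[OF fu] Hom_Dom[OF assms(2)])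
  then show ?thesis using assms by metis
qed

lemma cokernel_factor:
  assumes "is_cokernel (heart_cat D C) g f" "k \<in> Hom D (Cod D f) W" "W \<in> heart D C"
    "k \<cdot> f = Zero D (Dom D f) W"
  shows "\<exists>!u. u \<in> Hom D (Cod D g) W \<and> u \<cdot> g = k"
proof -
  have "Cod D f \<in> heart D C" "Cod D g \<in> heart D C" using assms(1) unfolding is_cokernel_def by auto
  then have k: "k \<in> Mor (heart_cat D C)" "Hom (heart_cat D C) (Cod D g) W = Hom D (Cod D g) W"
    using Mor_heart[OF assms(2) _ assms(3)] Hom_heart[OF _ assms(3)] by auto
  have "\<forall>k\<in>Mor (heart_cat D C). Dom D k = Cod D f \<and> k \<cdot> f = Zero D (Dom D f) (Cod D k) \<longrightarrow>
      (\<exists>!u. u \<in> Hom (heart_cat D C) (Cod D g) (Cod D k) \<and> u \<cdot> g = k)"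
    using assms(1) unfolding is_cokernel_def by simp
  from bspec[OF this k(1)] show ?thesis using k(2) assms(4) Hom_Dom[OF assms(2)] Hom_Cod[OF assms(2)] by simp
qed

lemma cokernel_iso:
  assumes "is_cokernel (heart_cat D C) g f" "is_cokernel (heart_cat D C) g' f" 
  obtains c where "c \<in> Hom D (Cod D g) (Cod D g')" "is_iso D c" "c \<cdot> g = g'"
proof -
  define Y Z Z' where Y: "Y = Cod D f" and Z: "Z = Cod D g" and Z': "Z' = Cod D g'"
  have g: "g \<in> Hom D Y Z" "g' \<in> Hom D Y Z'" "g \<in> Mor (heart_cat D C)" "g' \<in> Mor (heart_cat D C)"
    "Z \<in> heart D C" "Z' \<in> heart D C" 
    "g \<cdot> f = Zero D (Dom D f) Z" "g' \<cdot> f = Zero D (Dom D f) Z'"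
    using assms Y Z Z' unfolding is_cokernel_def by (auto simp: Hom_def)
  have U: "\<exists>!u. u \<in> Hom D Z Z \<and> u \<cdot> g = g" "\<exists>!u. u \<in> Hom D Z' Z' \<and> u \<cdot> g' = g'"
    "\<exists>!u. u \<in> Hom D Z Z' \<and> u \<cdot> g = g'" "\<exists>!u. u \<in> Hom D Z' Z \<and> u \<cdot> g' = g"
    using cokernel_factor[OF assms(1)] cokernel_factor[OF assms(2)] g Y Z Z' by auto
  obtain a where ab1: "a \<in> Hom D Z Z'" "a \<cdot> g = g'" using U(3) by blast
  obtain b where ab2: "b \<in> Hom D Z' Z" "b \<cdot> g' = g" using U(4) by blast
  note ab = ab1 ab2
  have "(b \<cdot> a) \<cdot> g = g" "(a \<cdot> b) \<cdot> g' = g'"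
    using Comp_assoc[OF g(1) ab(1,3)] Comp_assoc[OF g(2) ab(3,1)] ab by auto
  moreover have "Ide D Z \<cdot> g = g" "Ide D Z' \<cdot> g' = g'" using Ide_Comp g by auto
  moreover have "b \<cdot> a \<in> Hom D Z Z" "a \<cdot> b \<in> Hom D Z' Z'" "Ide D Z \<in> Hom D Z Z" "Ide D Z' \<in> Hom D Z' Z'"
    using ab Comp_in Ide_in Hom_Ob by meson+
  ultimately have "b \<cdot> a = Ide D Z" "a \<cdot> b = Ide D Z'" using U by metis+
  then have "is_iso D a" using is_isoI[OF ab(1,3)] by blast
  then show ?thesis using that ab Z Z' by blast
qed

text \<open>A priori the cone N of \<open>f\<close> has cohomology in degrees -1 and 0. The part in
  degree -1 would be the kernel of \<open>f\<close>, which is monic, so N lies in the heart; there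
  it is a cokernel of \<open>f\<close> and thus isomorphic to the target of
  \<open>g\<close>.\<close>

lemma short_exact_dt:
  assumes "short_exact (heart_cat D C) f g"
  obtains h where "dt (Dom D f) (Cod D f) (Cod D g) f g h" "Dom D f \<in> heart D C" "Cod D f \<in> heart D C" "Cod D g \<in> heart D C"
proof -
  have k: "is_kernel (heart_cat D C) f g" "is_cokernel (heart_cat D C) g f"
    using assms unfolding short_exact_def by auto
  then have "f \<in> Mor (heart_cat D C)" "g \<in> Mor (heart_cat D C)" unfolding is_kernel_def by auto
  then have H: "Dom D f \<in> heart D C" "Cod D f \<in> heart D C" "Cod D g \<in> heart D C" "f \<in> Hom D (Dom D f) (Cod D f)"
    by (auto simp: Hom_def)
  obtain N p h where T: "dt (Dom D f) (Cod D f) N f p h" using dt_cone H by blast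
  have N: "N \<in> le C 0" "N \<in> ge C (-1)" using cone_le cone_ge dt_tri[OF T] H by auto
  then obtain K Q where KQ: "tri K N Q" "K \<in> le C (-1)" "Q \<in> ge C (-1 + 1)" using truncate[OF t] le_Ob[OF t] by metis
  have Q: "Q \<in> le C 0" using le_third[OF t KQ(1)] N le_mono[OF t KQ(2)] by simp
  have K: "K \<in> ge C (-1)" using ge_first[OF t KQ(1)] N ge_mono[OF t KQ(3)] by simp
  have KOb: "K \<in> Ob D" using le_Ob[OF t] KQ by blast
  \<comment> \<open>K is the shift of some K' in the heart. For x : K -> N the composite K -> N ->
    X[1], where X is the domain of \<open>f\<close>, is the shift of some m : K' -> X with
    \<open>f \<cdot> m\<close> zero, so m = 0. Hence x comes from a morphism K -> Y into the
    codomain of \<open>f\<close>, which vanishes by degrees.\<close>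
  have "orth K N"
  proof (rule orthI)
    fix x assume x: "x \<in> Hom D K N"
    have p: "p \<in> Hom D (Cod D f) N" "h \<in> Hom D N (ShOb D (Dom D f))" using T dt_Hom by blast+
    obtain K' where K': "K' \<in> Ob D" "ShOb D K' \<simeq> K" using desusp KOb by blast
    obtain a a' where a: "a \<in> Hom D (ShOb D K') K" "a' \<in> Hom D K (ShOb D K')" "a \<cdot> a' = Ide D K"
      using K'(2) unfolding isomorphic_def by (meson is_isoE)
    have K'H: "K' \<in> heart D C"
      using K' KQ(2) K le_iso[OF t] ge_iso[OF t] iso_sym le_ShOb[OF t K'(1), of "-1"] ge_ShOb[OF t K'(1), of "-1"]
      unfolding heart_iff[OF t] by (metis add.commute add.right_inverse)
    have hx: "h \<cdot> x \<in> Hom D K (ShOb D (Dom D f))" using Comp_in x p by blast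
    then have hxa: "(h \<cdot> x) \<cdot> a \<in> Hom D (ShOb D K') (ShOb D (Dom D f))" using a Comp_in by blast
    then obtain m where m: "m \<in> Hom D K' (Dom D f)" "ShMor D m = (h \<cdot> x) \<cdot> a"
      using ShMor_surj[OF K'(1) _ hxa] Hom_Ob[OF H(4)] by blast
    have sf: "ShMor D f \<in> Hom D (ShOb D (Dom D f)) (ShOb D (Cod D f))" using ShMor_in H by blast
    have "neg D (ShMor D f) \<cdot> h = Zero D N (ShOb D (Cod D f))" using dt_zero[OF dt_rotate[OF dt_rotate[OF T]]] .
    then have sfh: "ShMor D f \<cdot> h = Zero D N (ShOb D (Cod D f))"
      using neg_Comp[OF p(2) sf] neg_eq_Zero[OF Comp_in[OF p(2) sf]] by simp
    have "ShMor D f \<cdot> (h \<cdot> x) = Zero D K (ShOb D (Cod D f))"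
      using Comp_assoc[OF x p(2) sf] sfh Zero_Comp[OF x] Hom_Ob[OF sf] by simp
    then have "ShMor D f \<cdot> ShMor D m = Zero D (ShOb D K') (ShOb D (Cod D f))"
      using Comp_assoc[OF a(1) hx sf] Zero_Comp[OF a(1)] Hom_Ob[OF sf] m by simp
    then have "ShMor D (f \<cdot> m) = Zero D (ShOb D K') (ShOb D (Cod D f))" using ShMor_Comp[OF m(1) H(4)] by simp
    then have "f \<cdot> m = Zero D K' (Cod D f)" using ShMor_eq_Zero[OF Comp_in[OF m(1) H(4)]] by simp
    then have "m = Zero D K' (Dom D f)"
      using kernel_mono[OF k(1) H(4) m(1) Zero_in K'H] Comp_Zero[OF H(4)] K' Hom_Ob[OF m(1)] by simp
    then have "(h \<cdot> x) \<cdot> a = Zero D (ShOb D K') (ShOb D (Dom D f))" using m ShMor_Zero K' Hom_Ob[OF m(1)] by simp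
    then have "((h \<cdot> x) \<cdot> a) \<cdot> a' = Zero D K (ShOb D (Dom D f))" using Zero_Comp[OF a(2)] Hom_Ob[OF hx] by simp
    then have "h \<cdot> x = Zero D K (ShOb D (Dom D f))" using Comp_assoc[OF a(2,1) hx] a(3) Comp_Ide[OF hx] by simp
    then obtain y where y: "y \<in> Hom D K (Cod D f)" "p \<cdot> y = x" using dt_lift[OF dt_rotate[OF T] x] by blast
    have "orth K (Cod D f)" using le_ge_orth[OF t KQ(2), of "Cod D f" 0] H heart_iff[OF t] by simp
    then have "y = Zero D K (Cod D f)" using orthD y(1) by blast
    then show "x = Zero D K N" using y(2) Comp_Zero[OF p(1) KOb] by simp
  qed (use KOb le_Ob[OF t] N in auto)
  moreover have "orth (ShOb D K) Q"
    using le_ge_orth[OF t, of "ShOb D K" "-2" Q 0] le_ShOb[OF t KOb, of "-2"] KQ by simp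
  ultimately have "N \<simeq> Q" using tri_split_first KQ by blast
  then have NH: "N \<in> heart D C" using heart_iso[OF t, of Q N] heart_iff[OF t, of Q] Q KQ(3) iso_sym[of N Q] by simp
  have p: "Cod D p = N" using T dt_Hom Hom_Cod by blast
  obtain c where c: "c \<in> Hom D N (Cod D g)" "is_iso D c" "c \<cdot> p = g"
    using cokernel_iso[OF dt_is_cokernel[OF T H(1,2) NH] k(2)] p by metis
  obtain h' where "dt (Dom D f) (Cod D f) (Cod D g) f (c \<cdot> p) h'" using dt_iso_third[OF T c(1,2)] by blast
  then show ?thesis using that c(3) H by simp
qed

text \<open>Image factorisation in the heart. The cokernel Q is H^0 of the cone N of
  \<open>d\<close>, and the image I is the fibre of Y -> Q; the octahedron on
  \<open>d = m \<cdot> e\<close> identifies the cone of \<open>e\<close> with the part of N in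
  degree -1, so that its desuspension K is the kernel.\<close>

lemma heart_factorization:
  assumes d: "d \<in> Hom D X Y" and X: "X \<in> heart D C" and Y: "Y \<in> heart D C"
  obtains K I Q k e r m q s where "dt K X I k e r" "dt I Y Q m q s" "m \<cdot> e = d"
    "K \<in> heart D C" "I \<in> heart D C" "Q \<in> heart D C"
proof -
  obtain N p h where T: "dt X Y N d p h" using dt_cone d by blast
  have N: "N \<in> le C 0" "N \<in> ge C (-1)" using cone_le cone_ge dt_tri[OF T] X Y by auto
  then obtain K1 Q where KQ: "tri K1 N Q" "K1 \<in> le C (-1)" "Q \<in> ge C (-1 + 1)" using truncate[OF t] le_Ob[OF t] by metis
  have Q: "Q \<in> heart D C" using le_third[OF t KQ(1), of 0] N le_mono[OF t KQ(2)] KQ heart_iff[OF t] by simp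
  have K1: "K1 \<in> ge C (-1)" using ge_first[OF t KQ(1)] N ge_mono[OF t KQ(3)] by simp
  obtain i u w where T2: "dt K1 N Q i u w" using KQ tri_def by blast
  have H: "p \<in> Hom D Y N" "u \<in> Hom D N Q" using T T2 dt_Hom by blast+
  define q where "q = u \<cdot> p"
  have q: "q \<in> Hom D Y Q" using H Comp_in q_def by blast
  obtain R a b where R: "dt Y Q R q a b" using dt_cone q by blast
  obtain I where I: "I \<in> Ob D" "ShOb D I \<simeq> R" using desusp dt_Ob[OF R] by blast
  obtain m s where m: "dt I Y Q m q s" using dt_unrotate[OF R I] by blast
  have "q \<cdot> d = Zero D X Q"
    using Comp_assoc[OF d H] q_def dt_zero[OF T] Comp_Zero[OF H(2)] Hom_Ob[OF d] by simp
  then obtain e where e: "e \<in> Hom D X I" "m \<cdot> e = d" using dt_lift[OF m d] by blast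
  obtain N1 e' e'' where e': "dt X I N1 e e' e''" using dt_cone e by blast
  have "dt X Y N (m \<cdot> e) p h" using T e by simp
  then obtain a1 v where v: "dt N1 N Q a1 v (ShMor D e' \<cdot> s)" "v \<cdot> p = q" using dt_octahedral[OF e' m] by metis
  \<comment> \<open>The octahedron only gives some N -> Q extending \<open>q\<close>. Such an
    extension is unique since X[1] is orthogonal to Q.\<close>
  have "v = u" using dt_epi_inj[OF T heart_orth[OF t X Q] _ H(2)] v dt_Hom[OF v(1)] q_def by blast
  then have "N1 \<simeq> K1" using tri_cocone_iso[OF _ T2] v(1) by blast
  then have N1: "N1 \<in> le C (-1)" "N1 \<in> ge C (-1)" using le_iso[OF t] ge_iso[OF t] iso_sym KQ K1 by blast+
  obtain K where K: "K \<in> Ob D" "ShOb D K \<simeq> N1" using desusp dt_Ob[OF e'] by blast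
  obtain k r where k: "dt K X I k e r" using dt_unrotate[OF e' K] by blast
  have "K \<in> heart D C"
    using K N1 le_iso[OF t] ge_iso[OF t] iso_sym le_ShOb[OF t K(1), of "-1"] ge_ShOb[OF t K(1), of "-1"]
    unfolding heart_iff[OF t] by (metis add.commute add.right_inverse)
  moreover have "I \<in> heart D C"
    using ge_first[OF t dt_tri[OF m], of 0] le_ext[OF t dt_tri[OF e'], of 0] X Y Q le_mono[OF t N1(1)]
      ge_mono[OF t, of Q 0 "-1"] unfolding heart_iff[OF t] by simp
  ultimately show ?thesis using that k m e(2) Q by blast
qed

section \<open>Simple objects of the heart\<close>

abbreviation simple :: "'o \<Rightarrow> bool" where "simple \<equiv> simple_object (heart_cat D C)"

lemma simple_heart: "simple S \<Longrightarrow> S \<in> heart D C"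
  by (simp add: simple_object_def)

lemma simple_Ob: "simple S \<Longrightarrow> S \<in> Ob D"
  by (simp add: simple_object_def)

lemma simple_nonzero: "simple S \<Longrightarrow> \<not> is_zero D S"
  by (simp add: simple_object_def is_zero_full_sub)

text \<open>Translates the monomorphisms of \<open>simple_object\<close> into triangles:
  \<open>m\<close> is monic in the heart because P[1] is orthogonal to Q.\<close>

lemma simple_sub:
  assumes "simple S" "dt I S Q m q s" "I \<in> heart D C" "Q \<in> heart D C" shows "is_zero D I \<or> is_iso D m"
proof -
  have m: "m \<in> Hom D I S" using assms dt_Hom by blast
  have "is_mono (heart_cat D C) m"
    unfolding is_mono_def
  proof (intro conjI ballI impI)
    show "m \<in> Mor (heart_cat D C)" using Mor_heart[OF m assms(3) simple_heart[OF assms(1)]] .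
    fix P u v assume *: "P \<in> Ob (heart_cat D C)" "u \<in> Hom (heart_cat D C) P (Dom (heart_cat D C) m)"
      "v \<in> Hom (heart_cat D C) P (Dom (heart_cat D C) m)" "m \<cdot>\<^bsub>heart_cat D C\<^esub> u = m \<cdot>\<^bsub>heart_cat D C\<^esub> v"
    then have "P \<in> heart D C" "u \<in> Hom D P I" "v \<in> Hom D P I" "m \<cdot> u = m \<cdot> v"
      using Hom_heart[OF _ assms(3), of P] by (auto simp: Hom_Dom[OF m])
    then show "u = v" using dt_mono_inj[OF assms(2)] heart_orth[OF t _ assms(4)] by blast
  qed
  moreover have "\<forall>f. is_mono (heart_cat D C) f \<and> Cod D f = S \<longrightarrow>
      is_zero (heart_cat D C) (Dom D f) \<or> is_iso (heart_cat D C) f"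
    using assms(1) unfolding simple_object_def by simp
  ultimately have "is_zero (heart_cat D C) I \<or> is_iso (heart_cat D C) m"
    using Hom_Dom[OF m] Hom_Cod[OF m] by blast
  then show ?thesis
    using is_zero_full_sub is_iso_full_sub[OF Hom_in_Mor[OF m], of "heart D C"] assms(3) simple_heart[OF assms(1)]
    by (auto simp: Hom_Dom[OF m] Hom_Cod[OF m])
qed

text \<open>The image of \<open>d\<close> is a nonzero subobject of S, hence all of S.\<close>

lemma simple_epi:
  assumes "simple S" "X \<in> heart D C" "d \<in> Hom D X S" "d \<noteq> Zero D X S"
  obtains K k r where "dt K X S k d r" "K \<in> heart D C"
proof -
  obtain K I Q k e r m q s where f: "dt K X I k e r" "dt I S Q m q s" "m \<cdot> e = d"
    "K \<in> heart D C" "I \<in> heart D C" "Q \<in> heart D C"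
    using heart_factorization[OF assms(3,2) simple_heart[OF assms(1)]] by metis
  have h: "e \<in> Hom D X I" "m \<in> Hom D I S" using f dt_Hom by blast+
  have "\<not> is_zero D I"
    using f(3) assms(4) Hom_zero_source[of I m S] h Zero_Comp[OF h(1)] Hom_Ob[OF h(2)] by auto
  then have "is_iso D m" using simple_sub f assms by blast
  then obtain h' where "dt K X S k (m \<cdot> e) h'" using dt_iso_third[OF f(1) h(2)] by blast
  then show ?thesis using f that by simp
qed

text \<open>The kernel of \<open>d\<close> is a subobject of S and not all of it, so it is zero and
  S is its own image in E.\<close>

lemma simple_inj:
  assumes "simple S" "E \<in> heart D C" "d \<in> Hom D S E" "d \<noteq> Zero D S E"
  obtains Q q r where "dt S E Q d q r" "Q \<in> heart D C"
proof -
  obtain K I Q k e r m q s where f: "dt K S I k e r" "dt I E Q m q s" "m \<cdot> e = d"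
    "K \<in> heart D C" "I \<in> heart D C" "Q \<in> heart D C"
    using heart_factorization[OF assms(3) simple_heart[OF assms(1)] assms(2)] by metis
  have h: "e \<in> Hom D S I" "m \<in> Hom D I E" "k \<in> Hom D K S" using f dt_Hom by blast+
  have "\<not> is_iso D k"
  proof
    assume "is_iso D k"
    then obtain k' where k': "k' \<in> Hom D S K" "k \<cdot> k' = Ide D S" using is_isoE h by metis
    have "e = (e \<cdot> k) \<cdot> k'" using Comp_assoc[OF k'(1) h(3,1)] k' Comp_Ide[OF h(1)] by simp
    then have "e = Zero D S I" using dt_zero[OF f(1)] Zero_Comp[OF k'(1)] Hom_Ob[OF h(1)] by simp
    then show False using f(3) assms(4) Comp_Zero[OF h(2)] Hom_Ob[OF h(1)] by simp
  qed
  then have "is_zero D K" using simple_sub[OF assms(1) f(1)] f by blast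
  then have "is_iso D e" using dt_third_zero[OF dt_rotate[OF f(1)]] is_zero_ShOb by blast
  then obtain h' where "dt S E Q (m \<cdot> e) q h'" using dt_iso_first[OF f(2) h(1)] by blast
  then show ?thesis using f that by simp
qed

lemma schur:
  assumes "simple S" "simple S'" "d \<in> Hom D S S'" "d \<noteq> Zero D S S'" shows "is_iso D d"
proof -
  obtain Q q r where d: "dt S S' Q d q r" "Q \<in> heart D C" 
    using simple_inj[OF assms(1) simple_heart[OF assms(2)] assms(3,4)] by blast
  then show ?thesis using simple_sub[OF assms(2) d(1)] simple_heart simple_nonzero assms by blast
qed

text \<open>The full subcategory \<open>X\<close> is independent of the heart in which S is simple,
  since the endomorphism ring is that of \<open>D\<close>. It will be applied to an S that is simple
  in a tilted heart but lies in the original one.\<close>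

lemma simple_endo_trivial:
  assumes S: "simple S" and "S \<in> X" shows "endo_trivial (full_sub D X) S"
proof -
  define R where "R = end_ring (full_sub D X) S"
  have Ob: "S \<in> Ob D" using simple_Ob S by blast
  have car: "carrier R = Hom D S S" and mult: "monoid.mult R = Comp D" and one: "\<one>\<^bsub>R\<^esub> = Ide D S"
    and zero: "\<zero>\<^bsub>R\<^esub> = Zero D S S" and add: "add R = Plus D"
    unfolding R_def end_ring_def using assms(2) by (auto simp: Hom_full_sub)
  have am: "add_monoid R = hom_group D S S"
    unfolding R_def end_ring_def hom_group_def using assms(2) by (simp add: Hom_full_sub)
  have "ring R"
  proof (rule ringI)
    show "abelian_group R" 
      using hom_comm_group[OF Ob Ob] unfolding abelian_group_def abelian_monoid_def abelian_group_axioms_def am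
      by (simp add: comm_group_def)
    show "monoid R" by unfold_locales (use Comp_in Ide_in Ob Comp_assoc Comp_Ide Ide_Comp in \<open>auto simp: car mult one\<close>)
  qed (auto simp: car mult add Comp_Plus Plus_Comp)
  moreover have "Units R = carrier R - {\<zero>\<^bsub>R\<^esub>}"
  proof (intro equalityI subsetI)
    fix x assume "x \<in> Units R"
    then obtain y where xy: "x \<in> Hom D S S" "y \<in> Hom D S S" "y \<cdot> x = Ide D S"
      unfolding Units_def by (auto simp: car mult one)
    have "x \<noteq> Zero D S S"
    proof
      assume "x = Zero D S S"
      then have "Ide D S = Zero D S S" using Comp_Zero[OF xy(2) Ob] xy(3) by simp
      then show False using simple_nonzero[OF S] is_zero_iff[of S] Ob by blast
    qed
    then show "x \<in> carrier R - {\<zero>\<^bsub>R\<^esub>}" using xy car zero by simp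
  next
    fix x assume "x \<in> carrier R - {\<zero>\<^bsub>R\<^esub>}"
    then have x: "x \<in> Hom D S S" "x \<noteq> Zero D S S" using car zero by auto
    obtain y where "y \<in> Hom D S S" "y \<cdot> x = Ide D S" "x \<cdot> y = Ide D S" by (rule is_isoE[OF schur[OF S S x] x(1)])
    then show "x \<in> Units R" unfolding Units_def using x by (auto simp: car mult one)
  qed
  ultimately show ?thesis unfolding endo_trivial_def skew_field_def R_def using Ob assms(2) by simp
qed

lemma simple_quotient:
  assumes "algebraic_heart D C" "E \<in> heart D C" "\<not> is_zero D E"
  obtains K S where "tri K E S" "K \<in> heart D C" "simple S"
proof -
  have "E \<in> finite_length (heart_cat D C)"
    using assms heart_Ob[OF t] unfolding algebraic_heart_def by auto
  then show ?thesis
  proof cases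
    case fl_zero then show ?thesis using is_zero_full_sub assms by blast
  next
    case (fl_step f g)
    obtain h where "dt (Dom D f) (Cod D f) (Cod D g) f g h" "Dom D f \<in> heart D C" using short_exact_dt[OF fl_step(2)] by blast
    then show ?thesis using fl_step that[of "Dom D f" "Cod D g"] dt_tri by auto
  qed
qed

subsection \<open>Length\<close>

text \<open>A relation rather than a function, as independence of the composition series is proved
  only in \<open>haslen_unique\<close>. Using \<open>tri\<close> makes it invariant under
  isomorphism.\<close>

inductive haslen :: "'o \<Rightarrow> nat \<Rightarrow> bool" where
  haslen_zero: "is_zero D N \<Longrightarrow> haslen N 0"
| haslen_step: "haslen X n \<Longrightarrow> tri X E S \<Longrightarrow> simple S \<Longrightarrow> haslen E (Suc n)"

lemma haslen_heart: "haslen E n \<Longrightarrow> E \<in> heart D C"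
  by (induction rule: haslen.induct) (use zero_heart[OF t] heart_ext[OF t] simple_heart in blast)+

lemma haslen_0: "haslen E 0 \<Longrightarrow> is_zero D E"
  by (erule haslen.cases) auto

lemma haslen_iso: "haslen E n \<Longrightarrow> E \<simeq> E' \<Longrightarrow> haslen E' n"
  by (erule haslen.cases) (use haslen_zero haslen_step is_zero_iso tri_iso iso_refl tri_Ob in meson)+

lemma haslen_exists:
  assumes "algebraic_heart D C" "E \<in> heart D C" obtains n where "haslen E n"
proof -
  have "E \<in> finite_length (heart_cat D C)"
    using assms heart_Ob[OF t] unfolding algebraic_heart_def by auto
  then have "\<exists>n. haslen E n"
  proof induction
    case (fl_zero Z) then show ?case using is_zero_full_sub haslen_zero by blast
  next
    case (fl_step f g)
    then obtain h where "dt (Dom D f) (Cod D f) (Cod D g) f g h" using short_exact_dt by blast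
    moreover obtain n where "haslen (Dom D f) n" using fl_step by auto
    moreover have "simple (Cod D g)" using fl_step by simp
    ultimately have "haslen (Cod D f) (Suc n)" using haslen_step dt_tri by blast
    then show ?case by auto
  qed
  then show ?thesis using that by blast
qed

text \<open>If E were zero, a last step would give S isomorphic to X[1], which is orthogonal to S;
  then S would be zero.\<close>

lemma haslen_nonzero: assumes "haslen E n" "is_zero D E" shows "n = 0"
  using assms
proof cases
  case (haslen_step X n' S)
  have "S \<simeq> ShOb D X" using tri_middle_zero haslen_step assms by blast
  then have "orth S S" 
    using heart_orth[OF t haslen_heart[OF haslen_step(2)] simple_heart] haslen_step orth_iso[of "ShOb D X" S S S] iso_sym
      iso_refl simple_Ob by blast
  then show ?thesis using orth_self simple_Ob simple_nonzero haslen_step by blast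
qed

text \<open>The Jordan-Hoelder argument on the last factors of two composition series: either their
  kernels X, X' agree, or both contain the intersection W with a simple quotient.\<close>

lemma haslen_unique:
  assumes a: "algebraic_heart D C" shows "haslen E n \<Longrightarrow> haslen E m \<Longrightarrow> n = m"
proof (induction n arbitrary: E m)
  case 0
  from 0(1) have "is_zero D E" by cases auto
  then show ?case using 0 haslen_nonzero by simp
next
  case (Suc n)
  from Suc.prems(1) obtain X S where X: "haslen X n" "tri X E S" "simple S" by cases auto
  from Suc.prems(2) show ?case
  proof cases
    case haslen_zero then show ?thesis using haslen_nonzero[OF Suc.prems(1)] by simp
  next
    case (haslen_step X' m' S')
    obtain x p r where T: "dt X E S x p r" using X tri_def by blast
    obtain x' p' r' where T': "dt X' E S' x' p' r'" using haslen_step tri_def by blast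
    have H: "x \<in> Hom D X E" "p \<in> Hom D E S" "p' \<in> Hom D E S'" "p' \<cdot> x \<in> Hom D X S'" using T T' dt_Hom Comp_in by blast+
    have XH: "X \<in> heart D C" "X' \<in> heart D C" "S' \<in> heart D C" using haslen_heart X haslen_step simple_heart by auto
    show ?thesis
    proof (cases "p' \<cdot> x = Zero D X S'")
      \<comment> \<open>The second quotient map kills X, so it factors through S; by Schur the
        factor is an isomorphism, which makes X and X' isomorphic.\<close>
      case True
      then obtain s where s: "s \<in> Hom D S S'" "s \<cdot> p = p'" using dt_extend[OF T H(3)] by blast
      have "s \<noteq> Zero D S S'"
      proof
        assume "s = Zero D S S'"
        then have p': "p' = Zero D E S'" using s Zero_Comp[OF H(2)] Hom_Ob[OF s(1)] by simp
        have S': "S' \<in> Ob D" using Hom_Ob H by blast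
        have "Ide D S' = Zero D S' S'"
          by (rule dt_epi_inj[OF T' heart_orth[OF t XH(2,3)] Ide_in[OF S'] Zero_in[OF S' S']])
            (use p' Ide_Comp[OF H(3)] Zero_Comp[OF H(3) S'] in simp)
        then show False using is_zero_iff S' simple_nonzero haslen_step by blast
      qed
      then have "is_iso D s" using schur X haslen_step s by blast
      then obtain h' where "dt X E S' x (s \<cdot> p) h'" using dt_iso_third[OF T s(1)] by blast
      then have "X \<simeq> X'" using tri_cocone_iso[OF _ T'] s(2) by simp
      then show ?thesis using Suc.IH haslen_iso X haslen_step by blast
    next
      case False
      \<comment> \<open>W has some length j, so X and X' both have length j + 1. The induction
        hypothesis for X gives n = j + 1, and it then applies to X'.\<close>
      obtain W w r where W: "dt W X S' w (p' \<cdot> x) r" "tri W X' S" using dt_diamond[OF T T'] by blast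
      obtain K k r'' where "dt K X S' k (p' \<cdot> x) r''" "K \<in> heart D C" using simple_epi[OF _ XH(1) H(4) False] haslen_step by blast
      then have "W \<in> heart D C" using tri_cocone_iso[OF W(1)] heart_iso[OF t] iso_sym by blast
      then obtain j where j: "haslen W j" using haslen_exists[OF a] by blast
      have "haslen X (Suc j)" "haslen X' (Suc j)"
        using haslen.haslen_step[OF j] W dt_tri X haslen_step by blast+
      then show ?thesis using Suc.IH X haslen_step by blast
    qed
  qed
qed

lemma haslen_add: "haslen Z c \<Longrightarrow> haslen X a \<Longrightarrow> tri X Y Z \<Longrightarrow> haslen Y (a + c)"
proof (induction arbitrary: Y rule: haslen.induct)
  case (haslen_zero N) then show ?case using tri_third_zero haslen_iso by auto
next
  case (haslen_step Z' n Z S)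
  obtain Y' where "tri X Y' Z'" "tri Y' Y S" using tri_assoc_right haslen_step by blast
  then have "haslen Y (Suc (a + n))" using haslen_step haslen.haslen_step by blast
  then show ?case by simp
qed

end

subsection \<open>Euler characteristics\<close>

context
  fixes C assumes t: "t_structure D C" and a: "algebraic_heart D C"
begin

text \<open>P and F are H^{-1} and H^0 of E. Restricting to objects in degrees -1 and 0 is enough
  here and keeps the alternating sum to two terms.\<close>

definition euler :: "'o \<Rightarrow> int \<Rightarrow> bool" where
  "euler E v \<longleftrightarrow> (\<exists>P F p f. tri (ShOb D P) E F \<and> haslen C P p \<and> haslen C F f \<and> v = int f - int p)"

lemma euler_unique: assumes "euler E v" "euler E w" shows "v = w"
proof -
  have H: "P \<in> Ob D" "ShOb D P \<in> le C (-1)" "F \<in> ge C (-1 + 1)" if "haslen C P p" "haslen C F f" for P F p f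
    using haslen_heart[OF t that(1)] haslen_heart[OF t that(2)] heart_iff[OF t] heart_Ob[OF t]
      le_ShOb[OF t, of P "-1"] by auto
  obtain P F p f where 1: "tri (ShOb D P) E F" "haslen C P p" "haslen C F f" "v = int f - int p"
    using assms(1) unfolding euler_def by blast
  obtain P' F' p' f' where 2: "tri (ShOb D P') E F'" "haslen C P' p'" "haslen C F' f'" "w = int f' - int p'"
    using assms(2) unfolding euler_def by blast
  have "ShOb D P \<simeq> ShOb D P'" "F \<simeq> F'"
    using truncation_unique[OF t 1(1) 2(1), of "-1"] H[OF 1(2,3)] H[OF 2(2,3)] by auto
  then have "P \<simeq> P'" "F \<simeq> F'" using iso_ShOb H(1)[OF 1(2,3)] H(1)[OF 2(2,3)] by auto
  then have "haslen C P' p" "haslen C F' f" using haslen_iso[OF t] 1 by blast+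
  then show ?thesis using haslen_unique[OF t a] 1 2 by blast
qed

lemma heart_desusp:
  assumes "E \<in> le C (-1)" "E \<in> ge C (-1)" obtains P where "P \<in> heart D C" "ShOb D P \<simeq> E"
proof -
  have "desusp E \<in> Ob D" "ShOb D (desusp E) \<simeq> E" using desusp le_Ob[OF t] assms by blast+
  moreover have "desusp E \<in> heart D C"
    using calculation le_iso[OF t assms(1)] ge_iso[OF t assms(2)] iso_sym le_ShOb[OF t, of "desusp E" "-1"]
      ge_ShOb[OF t, of "desusp E" "-1"] unfolding heart_iff[OF t] by simp
  ultimately show ?thesis using that by blast
qed

lemma heart_truncate:
  assumes "E \<in> le C 0" "E \<in> ge C (-1)"
  obtains P F where "tri (ShOb D P) E F" "P \<in> heart D C" "F \<in> heart D C"
proof -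
  obtain U F where U: "tri U E F" "U \<in> le C (-1)" "F \<in> ge C (-1 + 1)" using truncate[OF t] le_Ob[OF t] assms by metis
  have "U \<in> ge C (-1)" using ge_first[OF t U(1)] ge_mono[OF t U(3)] assms by simp
  then obtain P where P: "P \<in> heart D C" "ShOb D P \<simeq> U" using heart_desusp U by blast
  have "F \<in> heart D C" using le_third[OF t U(1), of 0] le_mono[OF t U(2)] assms U heart_iff[OF t] by simp
  then show ?thesis using that P tri_iso[OF U(1)] iso_sym iso_refl tri_Ob[OF U(1)] by blast
qed

lemma euler_exists: assumes "E \<in> le C 0" "E \<in> ge C (-1)" obtains v where "euler E v"
  using heart_truncate[OF assms] haslen_exists[OF t a] that unfolding euler_def by metis

lemma euler_heart: assumes "haslen C E n" shows "euler E (int n)"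
proof -
  obtain N where N: "is_zero D N" using zero_object by blast
  have "tri (ShOb D N) E E"
    using tri_zero_first[OF is_zero_ShOb[OF N] iso_refl] haslen_heart[OF t assms] heart_Ob[OF t] by blast
  moreover have "haslen C N 0" using haslen_zero N t by blast
  ultimately show ?thesis unfolding euler_def using assms by fastforce
qed

lemma euler_ShOb: assumes "haslen C E n" shows "euler (ShOb D E) (- int n)"
proof -
  obtain N where N: "is_zero D N" using zero_object by blast
  have "tri (ShOb D E) (ShOb D E) N"
    using tri_zero_third[OF N iso_refl] haslen_heart[OF t assms] heart_Ob[OF t] ShOb_in by blast
  moreover have "haslen C N 0" using haslen_zero N t by blast
  ultimately show ?thesis unfolding euler_def using assms by fastforce
qed

lemma euler_iso: "euler E v \<Longrightarrow> E \<simeq> E' \<Longrightarrow> euler E' v"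
  unfolding euler_def using tri_iso iso_refl tri_Ob by blast

text \<open>Adding P[1] changes only H^{-1}, which becomes an extension of H^{-1}(Z) by P; H^0 is
  that of Z.\<close>

lemma euler_add_shifted: assumes "tri (ShOb D P) Y Z" "haslen C P p" "euler Z c" shows "euler Y (c - int p)"
proof -
  obtain P' F p' f where Z: "tri (ShOb D P') Z F" "haslen C P' p'" "haslen C F f" "c = int f - int p'"
    using assms(3) unfolding euler_def by blast
  obtain R where R: "tri (ShOb D P) R (ShOb D P')" "tri R Y F" using tri_assoc_right[OF assms(1) Z(1)] by blast
  have Ob: "R \<in> Ob D" "P \<in> Ob D" "P' \<in> Ob D" "Y \<in> Ob D" "F \<in> Ob D"
    using R tri_Ob haslen_heart[OF t] heart_Ob[OF t] assms Z by blast+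
  obtain R' where R': "R' \<in> Ob D" "ShOb D R' \<simeq> R" using desusp Ob by blast
  have "tri (ShOb D P) (ShOb D R') (ShOb D P')" using tri_iso[OF R(1)] iso_sym R' iso_refl ShOb_in Ob by blast
  then have "haslen C R' (p + p')" using haslen_add[OF t Z(2) assms(2)] tri_ShOb Ob R' by blast
  moreover have "tri (ShOb D R') Y F" using tri_iso[OF R(2)] iso_sym R' iso_refl Ob by blast
  ultimately have "euler Y (int f - int (p + p'))" unfolding euler_def using Z by blast
  moreover have "int f - int (p + p') = c - int p" using Z by simp
  ultimately show ?thesis by metis
qed

text \<open>The object \<open>W\<close> below is the image of the connecting morphism \<open>G \<rightarrow> X\<close> of the heart.\<close>

lemma euler_add_heart: assumes "tri X Y Z" "haslen C X x" "euler Z c" shows "euler Y (c + int x)"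
proof -
  obtain G F g f where Z: "tri (ShOb D G) Z F" "haslen C G g" "haslen C F f" "c = int f - int g"
    using assms(3) unfolding euler_def by blast
  obtain Q where Q: "tri X Q (ShOb D G)" "tri Q Y F" using tri_assoc_right[OF assms(1) Z(1)] by blast
  have H: "X \<in> heart D C" "G \<in> heart D C" "F \<in> heart D C" using haslen_heart[OF t] assms Z by blast+
  then have HC: "X \<in> le C 0" "X \<in> ge C 0" "ShOb D G \<in> le C (-1)" "ShOb D G \<in> ge C (-1)" "G \<in> Ob D"
    using heart_iff[OF t] heart_Ob[OF t] le_ShOb[OF t, of G "-1"] ge_ShOb[OF t, of G "-1"] by auto
  have "Q \<in> le C 0" "Q \<in> ge C (-1)"
    using le_ext[OF t Q(1)] ge_ext[OF t Q(1)] le_mono[OF t HC(3), of 0] ge_mono[OF t HC(2), of "-1"] HC by auto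
  then obtain K Cok where K: "tri (ShOb D K) Q Cok" "K \<in> heart D C" "Cok \<in> heart D C" using heart_truncate by blast
  obtain W where W: "tri W X Cok" "tri W (ShOb D K) (ShOb D G)"
    using dt_diamond Q(1) K(1) dt_tri unfolding tri_def by metis
  have KC: "ShOb D K \<in> le C 0" "Cok \<in> ge C (-1)" "K \<in> Ob D" "Cok \<in> Ob D"
    using K heart_iff[OF t] heart_Ob[OF t] le_ShOb[OF t, of K 0] le_mono[OF t, of K 0 1] ge_mono[OF t, of Cok 0 "-1"] by auto
  have WH: "W \<in> heart D C"
    using le_first[OF t W(2), of 0] ge_first[OF t W(1), of 0] KC HC heart_iff[OF t] by simp
  have "tri (ShOb D K) (ShOb D G) (ShOb D W)" using tri_rotate W by blast
  then have T: "tri K G W" using tri_ShOb KC HC heart_Ob[OF t WH] by blast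
  obtain k w l where L: "haslen C K k" "haslen C W w" "haslen C Cok l" using haslen_exists[OF t a] K WH by metis
  \<comment> \<open>The length w of the image lowers both H^0 and H^{-1} of Y, so it cancels from
    the difference.\<close>
  have e: "x = w + l" "g = k + w"
    using haslen_unique[OF t a] haslen_add[OF t L(3,2) W(1)] haslen_add[OF t L(2,1) T] assms Z by blast+
  obtain R where R: "tri Cok R F" "tri (ShOb D K) Y R" using tri_assoc_left[OF K(1) Q(2)] by blast
  have "haslen C R (l + f)" using haslen_add[OF t Z(3) L(3) R(1)] .
  then have "euler Y (int (l + f) - int k)" unfolding euler_def using R L by blast
  moreover have "int (l + f) - int k = c + int x" using e Z by simp
  ultimately show ?thesis by simp
qed

text \<open>X is cut into its parts in degrees 0 and -1, which are added to Z in this order by the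
  two preceding lemmas.\<close>

lemma euler_add: assumes "tri X Y Z" "euler X b" "euler Z c" shows "euler Y (b + c)"
proof -
  obtain P F p f where X: "tri (ShOb D P) X F" "haslen C P p" "haslen C F f" "b = int f - int p"
    using assms(2) unfolding euler_def by blast
  obtain R where R: "tri F R Z" "tri (ShOb D P) Y R" using tri_assoc_left[OF X(1) assms(1)] by blast
  have "euler Y (c + int f - int p)" using euler_add_shifted[OF R(2) X(2)] euler_add_heart[OF R(1) X(3) assms(3)] by blast
  moreover have "c + int f - int p = b + c" using X by simp
  ultimately show ?thesis by simp
qed

end

end

text \<open>An additive function extends linearly to the free abelian group and kills the relations,
  so it is constant on each coset.\<close>

lemma grothendieck_class_additive:
  fixes \<phi> :: "'o \<Rightarrow> int"
  assumes add: "\<And>f g. short_exact A f g \<Longrightarrow> \<phi> (Cod A f) = \<phi> (Dom A f) + \<phi> (Cod A g)"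
    and Ob: "\<And>f g. short_exact A f g \<Longrightarrow> Cod A f \<in> Ob A \<and> Dom A f \<in> Ob A \<and> Cod A g \<in> Ob A"
    and eq: "grothendieck_class A E = grothendieck_class A E'"
  shows "\<phi> E = \<phi> E'"
proof -
  \<comment> \<open>\<open>frag_extend\<close> takes values in free abelian groups; the integers are
    therefore encoded as the free group on one generator \<open>()\<close>.\<close>
  define L where "L = frag_extend (\<lambda>X. frag_cmul (\<phi> X) (frag_of ()))"
  \<comment> \<open>The bound on the keys is carried through the induction because the inverse in
    \<open>free_Abelian_group\<close> is the negative only for members of its carrier.\<close>
  have "L x = 0 \<and> Poly_Mapping.keys x \<subseteq> Ob A" if "x \<in> grothendieck_relations A" for x
    using that unfolding grothendieck_relations_def
  proof (induction rule: generate.induct)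
    have rel: "L h = 0 \<and> Poly_Mapping.keys h \<subseteq> Ob A"
      if h: "h \<in> {frag_of (Cod A f) - frag_of (Dom A f) - frag_of (Cod A g) | f g. short_exact A f g}" for h
    proof -
      obtain f g where fg: "short_exact A f g" "h = frag_of (Cod A f) - frag_of (Dom A f) - frag_of (Cod A g)"
        using h by blast
      have "Poly_Mapping.keys h \<subseteq> Ob A"
        unfolding fg(2) using keys_diff[of "frag_of (Cod A f) - frag_of (Dom A f)" "frag_of (Cod A g)"]
          keys_diff[of "frag_of (Cod A f)" "frag_of (Dom A f)"] Ob[OF fg(1)] by auto
      then show ?thesis unfolding fg(2) L_def frag_extend_diff frag_extend_of add[OF fg(1)]
        by (simp add: frag_cmul_distrib)
    qed
    { case one then show ?case by (simp add: L_def) }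
    { case (incl h) then show ?case using rel by blast }
    { case (inv h)
      then have h: "h \<in> carrier (free_Abelian_group (Ob A))" "L h = 0" using rel by auto
      then show ?case using inv_free_Abelian_group[of h "Ob A"] by (auto simp: L_def frag_extend_minus) }
    { case (eng h1 h2) then show ?case using keys_add[of h1 h2] by (auto simp: L_def frag_extend_add) }
  qed
  moreover have "frag_of E \<in> grothendieck_class A E"
    unfolding grothendieck_class_def grothendieck_relations_def r_coset_def
    using generate.one[of "free_Abelian_group (Ob A)"] by force
  then obtain r where "r \<in> grothendieck_relations A" "frag_of E = r + frag_of E'"
    unfolding eq unfolding grothendieck_class_def r_coset_def by auto
  ultimately have "L (frag_of E) = L (frag_of E')" by (simp add: L_def frag_extend_add)
  then have "frag_cmul (\<phi> E) (frag_of ()) = frag_cmul (\<phi> E') (frag_of ())" by (simp add: L_def)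
  then have "poly_mapping.lookup (frag_cmul (\<phi> E) (frag_of ())) () = poly_mapping.lookup (frag_cmul (\<phi> E') (frag_of ())) ()"
    by simp
  then show ?thesis by simp
qed

section \<open>Tilting\<close>

context triangulated_category
begin

text \<open>For a torsion class T in the heart of \<open>C\<close> this is the aisle of the tilted
  t-structure: U is the truncation in degrees at most 0, and V is H^1(E)[-1], with H^1(E) in
  T.\<close>

definition tilt :: "'o set \<Rightarrow> 'o set \<Rightarrow> 'o set" where
  "tilt C T = {E. \<exists>U V. tri U E V \<and> U \<in> C \<and> ShOb D V \<in> T}"

text \<open>Induction on the amplitude: the lowest cohomology of E is a shifted object of the common
  heart, and the rest has one degree less. Boundedness makes every object of the aisle accessible in
  this way.\<close>

lemma heart_eq_subset: 
  assumes "bounded_t_structure D C" "bounded_t_structure D C'" "heart D C = heart D C'" 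
  shows "E \<in> le C 0 \<Longrightarrow> E \<in> ge C (1 - int n) \<Longrightarrow> E \<in> C'"
proof (induction n arbitrary: E)
  note t = bounded_ts[OF assms(1)] bounded_ts[OF assms(2)]
  {
    case 0
    then have "is_zero D E" using le_ge_zero[OF t(1)] by simp
    then show ?case using zero_le[OF t(2), of E 0] le_0[OF t(2)] by simp
  next
    case (Suc n)
    obtain U V where UV: "tri U E V" "U \<in> le C (- int n)" "V \<in> ge C (- int n + 1)"
      using truncate[OF t(1)] Suc le_Ob[OF t(1)] by metis
    have "V \<in> le C 0" using le_third[OF t(1) UV(1), of 0] le_mono[OF t(1) UV(2)] Suc by simp
    then have V: "V \<in> C'" using Suc.IH UV(3) by simp
    have "U \<in> ge C (- int n)" using ge_first[OF t(1) UV(1)] ge_mono[OF t(1) UV(3)] Suc by simp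
    then have "sh (- int n) U \<in> heart D C" using UV heart_iff[OF t(1)] le_sh[OF t(1)] ge_sh[OF t(1)] le_Ob[OF t(1)] by simp
    then have "sh (- int n) U \<in> le C' 0" using assms(3) heart_iff[OF t(2)] by simp
    then have "U \<in> le C' (- int n)" using le_sh[OF t(2)] le_Ob[OF t(1) UV(2)] by simp
    then have "U \<in> le C' 0" using le_mono[OF t(2)] by simp
    then show ?case using le_ext[OF t(2) UV(1), of 0] V le_0[OF t(2)] by simp
  }
qed

lemma heart_determines:
  assumes "bounded_t_structure D C" "bounded_t_structure D C'" "heart D C = heart D C'" shows "C = C'"
proof -
  have "C \<subseteq> C'" if b: "bounded_t_structure D C" "bounded_t_structure D C'" "heart D C = heart D C'" for C C'
  proof
    note t = bounded_ts[OF b(1)]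
    fix E assume E: "E \<in> C"
    obtain k where k: "E \<in> ge C k" using bounded_ge[OF b(1)] ts_Ob[OF t E] by blast
    have "E \<in> ge C (1 - int (nat (1 - k)))" using ge_mono[OF t k] by simp
    then show "E \<in> C'" using heart_eq_subset[OF b] E le_0[OF t] by blast
  qed
  then show ?thesis using assms by blast
qed

section \<open>Cohomology and torsion pairs expressed by triangles\<close>

lemma cohomology_iff:
  assumes t: "t_structure D C"
  shows "H \<in> cohomology D C i E \<longleftrightarrow> (\<exists>U V W Z. tri U E V \<and> U \<in> le C i \<and> V \<in> ge C (i + 1) \<and>
    tri W U Z \<and> W \<in> le C (i - 1) \<and> Z \<in> ge C i \<and> H \<simeq> sh i Z)"
proof -
  have "shift_set D (- i) C = le C i" "shift_set D (1 - i) C = le C (i - 1)" by (simp_all add: le_def)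
  moreover have "H \<in> shift_set D i {Z} \<longleftrightarrow> H \<simeq> sh i Z" if "Z \<in> Ob D" for Z
    using shift_set_iff[of "{Z}" H i] that iso_Ob by auto
  moreover have "truncation D (le C (i - 1)) W U Z \<longleftrightarrow> W \<in> le C (i - 1) \<and> Z \<in> ge C i \<and> tri W U Z" for W U Z
    using truncation_iff[OF t, of "i - 1"] by simp
  ultimately show ?thesis unfolding cohomology_def mem_Collect_eq using truncation_iff[OF t, of i] ge_Ob[OF t]
    by (metis (no_types, lifting))
qed

lemma cohomology_unique:
  assumes t: "t_structure D C" and "H \<in> cohomology D C i E" "H' \<in> cohomology D C i E" shows "H \<simeq> H'"
proof -
  obtain U V W Z where 1: "tri U E V" "U \<in> le C i" "V \<in> ge C (i + 1)" "tri W U Z" "W \<in> le C (i - 1)" "Z \<in> ge C i" "H \<simeq> sh i Z"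
    using assms(2) unfolding cohomology_iff[OF t] by blast
  obtain U' V' W' Z' where 2: "tri U' E V'" "U' \<in> le C i" "V' \<in> ge C (i + 1)" "tri W' U' Z'" "W' \<in> le C (i - 1)" "Z' \<in> ge C i" "H' \<simeq> sh i Z'"
    using assms(3) unfolding cohomology_iff[OF t] by blast
  have "U' \<simeq> U" using truncation_unique(1)[OF t 2(1) 1(1) 2(2) 1(2) 2(3) 1(3)] .
  then have "tri W' U Z'" using tri_iso[OF 2(4)] iso_refl tri_Ob[OF 2(4)] by blast
  then have "Z \<simeq> Z'" using truncation_unique(2)[OF t 1(4), of W' Z' "i - 1"] 1 2 by simp
  then show ?thesis using 1 2 sh_cong iso_trans iso_sym by meson
qed

lemma cohomology_in:
  assumes t: "t_structure D C" and "tri U E V" "U \<in> le C i" "V \<in> ge C (i + 1)" "tri W U Z" "W \<in> le C (i - 1)" "Z \<in> ge C i"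
  shows "sh i Z \<in> cohomology D C i E"
  unfolding cohomology_iff[OF t] using assms iso_refl sh_Ob tri_Ob by meson

text \<open>The triangle form of \<open>torsion_pair\<close>, free of kernels and cokernels of the
  heart category.\<close>

definition torsion_theory :: "'o set \<Rightarrow> 'o set \<Rightarrow> 'o set \<Rightarrow> bool" where
  "torsion_theory C T F \<longleftrightarrow> strict_full D T \<and> strict_full D F \<and> T \<subseteq> heart D C \<and> F \<subseteq> heart D C \<and>
     (\<forall>X\<in>T. \<forall>Y\<in>F. orth X Y) \<and> (\<forall>E\<in>heart D C. \<exists>X\<in>T. \<exists>Y\<in>F. tri X E Y)"

lemma strict_full_heart:
  assumes t: "t_structure D C"
  shows "strict_full (heart_cat D C) X \<longleftrightarrow> strict_full D X \<and> X \<subseteq> heart D C"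
proof
  assume s: "strict_full (heart_cat D C) X"
  then have X: "X \<subseteq> heart D C" "X \<subseteq> Ob D" unfolding strict_full_def by auto
  moreover have "F \<in> X" if "E \<in> X" "E \<simeq> F" for E F
  proof -
    have F: "F \<in> heart D C" using heart_iso[OF t _ that(2)] X that by blast
    then show ?thesis using s that isomorphic_full_sub[of E "heart D C" F] X iso_Ob[OF that(2)] unfolding strict_full_def by auto
  qed
  ultimately show "strict_full D X \<and> X \<subseteq> heart D C" unfolding strict_full_def by blast
next
  assume s: "strict_full D X \<and> X \<subseteq> heart D C"
  then have X: "strict_full D X" "X \<subseteq> heart D C" "X \<subseteq> Ob D" unfolding strict_full_def by auto
  have c: "F \<in> X" if E: "E \<in> X" "F \<in> heart D C" "isomorphic (heart_cat D C) E F" for E F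
  proof -
    have "E \<in> heart D C" using E(1) X(2) by blast
    then have "E \<simeq> F" using isomorphic_full_sub[of E "heart D C" F] E(2,3) by simp
    then show ?thesis using strict_fullD[OF X(1) E(1)] by simp
  qed
  show "strict_full (heart_cat D C) X" unfolding strict_full_def using X(2,3) by (auto intro: c)
qed

lemma torsion_pair_iff:
  assumes t: "t_structure D C"
  shows "torsion_pair (heart_cat D C) T F \<longleftrightarrow> torsion_theory C T F"
proof -
  have "(\<exists>f g. short_exact (heart_cat D C) f g \<and> Cod (heart_cat D C) f = E \<and> Dom (heart_cat D C) f \<in> T \<and> Cod (heart_cat D C) g \<in> F)
     \<longleftrightarrow> (\<exists>X\<in>T. \<exists>Y\<in>F. tri X E Y)" (is "?L \<longleftrightarrow> ?R") if "E \<in> heart D C" "T \<subseteq> heart D C" "F \<subseteq> heart D C" for E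
  proof
    assume ?L
    then obtain f g where fg: "short_exact (heart_cat D C) f g" "Cod D f = E" "Dom D f \<in> T" "Cod D g \<in> F" by auto
    then show ?R using short_exact_dt[OF t fg(1)] dt_tri by metis
  next
    assume ?R
    then obtain X Y f g h where d: "dt X E Y f g h" "X \<in> T" "Y \<in> F" unfolding tri_def by blast
    then have "short_exact (heart_cat D C) f g" using dt_short_exact[OF t d(1)] that by blast
    moreover have "Cod D f = E" "Dom D f = X" "Cod D g = Y" using dt_Hom[OF d(1)] Hom_Dom Hom_Cod by blast+
    ultimately show ?L using d(2,3) by auto
  qed
  then show ?thesis
    unfolding torsion_pair_def torsion_theory_def strict_full_heart[OF t] using Hom_heart[OF t] heart_Ob[OF t]
    by (auto simp: subset_iff) 
qed

section \<open>Comparing degrees for an intermediate t-structure\<close>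

context
  fixes C C' assumes t: "t_structure D C" "t_structure D C'" and sub: "C \<subseteq> C'" "C' \<subseteq> le C 1"
begin

lemma intermediate_le: "E \<in> le C k \<Longrightarrow> E \<in> le C' k"
  using le_subset t sub by blast

lemma intermediate_le_Suc: "E \<in> le C' k \<Longrightarrow> E \<in> le C (k + 1)"
  using le_iff[OF t(2)] sub le_sh[OF t(1), of E k 1] by (auto simp: add.commute)

lemma intermediate_ge: "E \<in> ge C' k \<Longrightarrow> E \<in> ge C k"
  using ge_subset t sub by blast

lemma intermediate_ge_Suc: assumes "E \<in> ge C (k + 1)" shows "E \<in> ge C' k"
proof -
  have "orth U E" if "U \<in> le C' (k - 1)" for U
    using le_ge_orth[OF t(1) intermediate_le_Suc[OF that] assms] by simp
  then show ?thesis using ge_char[OF t(2), of E "k - 1"] assms ge_Ob[OF t(1)] by simp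
qed

end

section \<open>The t-structure tilted at a torsion pair\<close>

context
  fixes C T F assumes b: "bounded_t_structure D C" and p: "torsion_theory C T F"
begin

lemma ct: "t_structure D C"
  using b bounded_ts by blast

lemma T_heart: "X \<in> T \<Longrightarrow> X \<in> heart D C" and F_heart: "Y \<in> F \<Longrightarrow> Y \<in> heart D C"
  and TF_orth: "X \<in> T \<Longrightarrow> Y \<in> F \<Longrightarrow> orth X Y"
  and T_iso: "X \<in> T \<Longrightarrow> X \<simeq> X' \<Longrightarrow> X' \<in> T" and F_iso: "Y \<in> F \<Longrightarrow> Y \<simeq> Y' \<Longrightarrow> Y' \<in> F"
  using p strict_fullD unfolding torsion_theory_def by blast+

lemma torsion_split:
  assumes "E \<in> heart D C" obtains X Y where "X \<in> T" "Y \<in> F" "tri X E Y"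
  using p assms unfolding torsion_theory_def by blast

lemma zero_T: assumes "is_zero D N" shows "N \<in> T"
proof -
  obtain X Y where XY: "X \<in> T" "Y \<in> F" "tri X N Y" using torsion_split zero_heart[OF ct assms] by blast
  have "is_zero D X"
    using tri_split_first(1)[OF XY(3)] orth_zero(2)[OF assms] heart_orth[OF ct] T_heart F_heart XY heart_Ob[OF ct] by blast
  then show ?thesis using T_iso XY zero_iso assms by blast
qed

lemma T_desusp: assumes "ShOb D V \<in> T" "V \<in> Ob D" shows "V \<in> le C 1" "V \<in> ge C 1"
  using T_heart[OF assms(1)] heart_iff[OF ct] le_ShOb[OF ct assms(2), of 0] ge_ShOb[OF ct assms(2), of 0] by auto

lemma C_sub_tilt: "C \<subseteq> tilt C T"
proof
  fix E assume E: "E \<in> C"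
  obtain N where N: "is_zero D N" using zero_object by blast
  have "tri E E N" using tri_zero_third[OF N iso_refl] ts_Ob[OF ct E] by blast
  moreover have "ShOb D N \<in> T" using zero_T is_zero_ShOb N by blast
  ultimately show "E \<in> tilt C T" unfolding tilt_def using E by blast
qed

lemma tilt_sub_le: "tilt C T \<subseteq> le C 1"
proof
  fix E assume "E \<in> tilt C T"
  then obtain U V where UV: "tri U E V" "U \<in> C" "ShOb D V \<in> T" unfolding tilt_def by blast
  then have "V \<in> le C 1" using T_desusp tri_Ob by blast
  moreover have "U \<in> le C 1" using le_mono[OF ct, of U 0 1] le_0[OF ct] UV by simp
  ultimately show "E \<in> le C 1" using le_ext[OF ct UV(1)] by blast
qed

lemma tilt_orth_F: assumes "N \<in> tilt C T" "Y \<in> Ob D" "ShOb D Y \<in> F" shows "orth N Y"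
proof -
  obtain U V where UV: "tri U N V" "U \<in> C" "ShOb D V \<in> T" using assms(1) unfolding tilt_def by blast
  have "Y \<in> ge C 1" using F_heart[OF assms(3)] heart_iff[OF ct] ge_ShOb[OF ct assms(2), of 0] by simp
  then have "orth U Y" using le_ge_orth[OF ct, of U 0 Y 1] UV le_0[OF ct] by simp
  moreover have "orth V Y" using TF_orth[OF UV(3) assms(3)] orth_ShOb tri_Ob UV assms by blast
  ultimately show ?thesis using tri_orth_right UV assms by blast
qed

text \<open>Closure under the shift is immediate, since the shift of the new aisle is contained in
  \<open>C\<close>. The new truncation cuts E inside degree 1, between the torsion and the
  torsion-free part of H^1(E).\<close>

lemma tilt_t_structure: "t_structure D (tilt C T)"
  unfolding t_structure_def
proof (intro conjI ballI subsetI)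
  have Ob: "tilt C T \<subseteq> Ob D" unfolding tilt_def using tri_Ob by blast
  moreover have "E' \<in> tilt C T" if "E \<in> tilt C T" "E \<simeq> E'" for E E'
    using that tri_iso iso_refl tri_Ob unfolding tilt_def by blast
  ultimately show "strict_full D (tilt C T)" unfolding strict_full_def by blast
  show "E \<in> tilt C T" if shifted: "E \<in> shift_set D 1 (tilt C T)" for E
  proof -
    obtain Y where Y: "Y \<in> tilt C T" "E \<simeq> ShOb D Y" using shifted shift_set_iff[OF Ob, of E 1] by auto
    then have "Y \<in> le C 1" using tilt_sub_le by blast
    then have "ShOb D Y \<in> le C 0" using le_ShOb[OF ct, of Y 0] le_Ob[OF ct] by simp
    then have "E \<in> C" using Y iso_sym le_iso[OF ct] le_0[OF ct] by blast
    then show ?thesis using C_sub_tilt by blast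
  qed
  fix E assume E: "E \<in> Ob D"
  obtain U V where UV: "tri U E V" "U \<in> le C 0" "V \<in> ge C (0 + 1)" using truncate[OF ct E] by blast
  obtain B V' where BV: "tri B V V'" "B \<in> le C 1" "V' \<in> ge C (1 + 1)" using truncate[OF ct ge_Ob[OF ct UV(3)]] by blast
  have B: "B \<in> Ob D" "B \<in> ge C 1" using le_Ob[OF ct] ge_first[OF ct BV(1)] ge_mono[OF ct BV(3)] BV UV by auto
  have "ShOb D B \<in> heart D C" 
    using heart_iff[OF ct] le_ShOb[OF ct B(1), of 0] ge_ShOb[OF ct B(1), of 0] BV B by simp
  then obtain X Y where XY: "X \<in> T" "Y \<in> F" "tri X (ShOb D B) Y" using torsion_split by blast
  have Ob': "X \<in> Ob D" "Y \<in> Ob D" using tri_Ob XY by blast+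
  define x y where "x = desusp X" and "y = desusp Y"
  have xy: "x \<in> Ob D" "y \<in> Ob D" "ShOb D x \<simeq> X" "ShOb D y \<simeq> Y" using desusp Ob' x_def y_def by auto
  have "tri (ShOb D x) (ShOb D B) (ShOb D y)" using tri_iso[OF XY(3)] xy iso_sym iso_refl ShOb_in B by blast
  then have xBy: "tri x B y" using tri_ShOb xy B by blast
  \<comment> \<open>E now has successive factors U, x, y, V': degrees at most 0, the two parts of
    H^1(E)[-1], and degrees at least 2. The regrouping collects U, x in N and y, V' in R.\<close>
  obtain M where M: "tri U M B" "tri M E V'" using tri_assoc_right[OF UV(1) BV(1)] by blast
  obtain N where N: "tri U N x" "tri N M y" using tri_assoc_right[OF M(1) xBy] by blast
  obtain R where R: "tri y R V'" "tri N E R" using tri_assoc_left[OF N(2) M(2)] by blast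
  have "ShOb D x \<in> T" using T_iso XY xy iso_sym by blast
  then have "N \<in> tilt C T" unfolding tilt_def using N UV le_0[OF ct] by blast
  moreover have "R \<in> right_perp D (tilt C T)"
    unfolding right_perp_def
  proof (intro CollectI conjI ballI)
    show "R \<in> Ob D" using R tri_Ob by blast
    fix P assume P: "P \<in> tilt C T"
    have "ShOb D y \<in> F" using F_iso XY xy iso_sym by blast
    then have "orth P y" using tilt_orth_F P xy by blast
    moreover have "orth P V'" using le_ge_orth[OF ct _ BV(3), of P 1] P tilt_sub_le by auto
    ultimately show "orth P R" using tri_orth_left[OF R(1)] P Ob by blast
  qed
  ultimately have "truncation D (tilt C T) N E R" unfolding truncation_def using R(2) tri_iff by blast
  then show "\<exists>U V. truncation D (tilt C T) U E V" by blast
qed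

lemma tilt_bounded: "bounded_t_structure D (tilt C T)"
  unfolding bounded_t_structure_def
proof (intro conjI ballI tilt_t_structure)
  note i = ct tilt_t_structure C_sub_tilt tilt_sub_le
  fix E assume E: "E \<in> Ob D"
  obtain k where "E \<in> le C k" using bounded_le[OF b E] by blast
  then have "E \<in> shift_set D (- k) (tilt C T)" using intermediate_le[OF i] unfolding le_def by blast
  moreover obtain l where "E \<in> ge C l" using bounded_ge[OF b E] by blast
  then have "E \<in> ge (tilt C T) (l - 1)" using intermediate_ge_Suc[OF i, of E "l - 1"] by simp
  then have "E \<in> shift_set D (1 - (l - 1)) (right_perp D (tilt C T))" unfolding ge_def .
  ultimately show "\<exists>m n. E \<in> shift_set D m (tilt C T) \<and> E \<in> shift_set D n (right_perp D (tilt C T))" by blast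
qed

lemma F_ge_tilt: assumes "Y \<in> F" shows "Y \<in> ge (tilt C T) 0"
proof -
  have Y: "Y \<in> Ob D" using F_heart heart_Ob[OF ct] assms by blast
  have "orth U Y" if "U \<in> le (tilt C T) (-1)" for U
  proof -
    have U: "U \<in> Ob D" "sh (-1) U \<in> tilt C T" using le_iff[OF tilt_t_structure] that by auto
    have "ShOb D (sh (-1) Y) \<in> F" using F_iso assms sh_minus(2)[OF Y, of 1] iso_sym by simp
    then have "orth (sh (-1) U) (sh (-1) Y)" using tilt_orth_F U sh_Ob Y by blast
    then show ?thesis using orth_sh U Y by blast
  qed
  then show ?thesis using ge_char[OF tilt_t_structure Y, of "-1"] by simp
qed

lemma T_le_tilt: assumes "X \<in> T" shows "X \<in> le (tilt C T) (-1)"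
proof -
  obtain N where N: "is_zero D N" using zero_object by blast
  have X: "X \<in> Ob D" using T_heart heart_Ob[OF ct] assms by blast
  then have "tri N (sh (-1) X) (sh (-1) X)" using tri_zero_first[OF N iso_refl] sh_Ob by blast
  moreover have "ShOb D (sh (-1) X) \<in> T" using T_iso assms sh_minus(2)[OF X, of 1] iso_sym by simp
  moreover have "N \<in> C" using zero_le[OF ct N, of 0] le_0[OF ct] by simp
  ultimately have "sh (-1) X \<in> tilt C T" unfolding tilt_def by blast
  then show ?thesis using le_iff[OF tilt_t_structure] X by blast
qed

lemma heart_tilt: "heart D (tilt C T) = {E. \<exists>Y\<in>F. \<exists>X. ShOb D X \<in> T \<and> tri Y E X}"
proof (intro equalityI subsetI)
  note i = ct tilt_t_structure C_sub_tilt tilt_sub_le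
  fix E assume "E \<in> heart D (tilt C T)"
  then have E: "E \<in> tilt C T" "E \<in> ge (tilt C T) 0" using heart_iff[OF i(2)] le_0[OF i(2)] by auto
  then obtain U V where UV: "tri U E V" "U \<in> C" "ShOb D V \<in> T" unfolding tilt_def by blast
  have Ob: "U \<in> Ob D" "V \<in> Ob D" using UV tri_Ob by blast+
  have V: "V \<in> ge C 1" "V \<in> le C 1" using T_desusp UV Ob by auto
  have "V \<in> ge (tilt C T) (-1)" using ge_mono[OF i(2) intermediate_ge_Suc[OF i, of V 0]] V by simp
  then have Ut: "U \<in> ge (tilt C T) 0" using ge_first[OF i(2) UV(1), of 0] E by simp
  then have "U \<in> heart D C" using heart_iff[OF ct] UV le_0[OF ct] intermediate_ge[OF i] by blast
  then obtain X Y where XY: "X \<in> T" "Y \<in> F" "tri X U Y" using torsion_split by blast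
  \<comment> \<open>For the tilted t-structure T lies in degrees at most -1 and U in degrees at
    least 0; so the torsion part X of U vanishes and U is in F.\<close>
  have "orth X U" using le_ge_orth[OF i(2) T_le_tilt[OF XY(1)] Ut] by simp
  then have "U \<simeq> Y" using tri_split_first(2)[OF XY(3)] heart_orth[OF ct] T_heart F_heart XY by blast
  then have "U \<in> F" using F_iso XY iso_sym by blast
  then show "E \<in> {E. \<exists>Y\<in>F. \<exists>X. ShOb D X \<in> T \<and> tri Y E X}" using UV by blast
next
  note i = ct tilt_t_structure C_sub_tilt tilt_sub_le
  fix E assume "E \<in> {E. \<exists>Y\<in>F. \<exists>X. ShOb D X \<in> T \<and> tri Y E X}"
  then obtain Y X where YX: "Y \<in> F" "ShOb D X \<in> T" "tri Y E X" by blast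
  have "Y \<in> C" using F_heart[OF YX(1)] heart_iff[OF ct] le_0[OF ct] by blast
  then have "E \<in> tilt C T" unfolding tilt_def using YX by blast
  then have "E \<in> le (tilt C T) 0" using le_0[OF i(2)] by simp
  moreover have "X \<in> ge (tilt C T) 0" using intermediate_ge_Suc[OF i, of X 0] T_desusp[OF YX(2)] tri_Ob[OF YX(3)] by simp
  then have "E \<in> ge (tilt C T) 0" using ge_ext[OF i(2) YX(3)] F_ge_tilt YX by blast
  ultimately show "E \<in> heart D (tilt C T)" using heart_iff[OF i(2)] by blast
qed

text \<open>\<open>cohomology\<close> is the set of all choices of H^i(E). From left to right it
  suffices to exhibit one choice in each degree; conversely one choice is computed and the others
  are isomorphic to it.\<close>

lemma left_tilt_eq: "left_tilt D C T F = {E. \<exists>Y\<in>F. \<exists>X. ShOb D X \<in> T \<and> tri Y E X}"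
proof (intro equalityI subsetI)
  obtain N where N: "is_zero D N" using zero_object by blast
  note Nle = zero_le[OF ct N] and Nge = zero_ge[OF ct N]
  fix E assume "E \<in> left_tilt D C T F"
  then have E: "E \<in> Ob D" "cohomology D C 0 E \<subseteq> F" "cohomology D C 1 E \<subseteq> T"
    and z: "\<And>i H. i \<notin> {0, 1} \<Longrightarrow> H \<in> cohomology D C i E \<Longrightarrow> is_zero D H" unfolding left_tilt_def by auto
  have EN: "tri E E N" "tri N N N" and NE: "tri N X X" if "X \<in> Ob D" for X
    using tri_zero_third[OF N] tri_zero_first[OF N] iso_refl that E is_zero_Ob[OF N] by blast+
  \<comment> \<open>Vanishing of the top cohomology lowers the upper bound by one. Boundedness
    supplies a bound from which the descent to degree 1 starts.\<close>
  have step: "E \<in> le C j" if "E \<in> le C (j + 1)" "1 \<le> j" for j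
  proof -
    obtain W Z where WZ: "tri W E Z" "W \<in> le C j" "Z \<in> ge C (j + 1)" using truncate[OF ct E(1)] by blast
    have "sh (j + 1) Z \<in> cohomology D C (j + 1) E"
      by (rule cohomology_in[OF ct EN(1)[OF E(1)] that(1) Nge WZ(1)]) (use WZ in auto)
    then have "is_zero D Z" using z[of "j + 1"] that is_zero_sh tri_Ob[OF WZ(1)] by auto
    then show ?thesis using tri_third_zero WZ le_iso[OF ct] by blast
  qed
  have "E \<in> le C 1" if "E \<in> le C (1 + int n)" for n
    using that by (induction n) (use step in \<open>auto simp: algebra_simps\<close>)
  moreover obtain k where "E \<in> le C k" using bounded_le[OF b E(1)] by blast
  then have "E \<in> le C (1 + int (nat (k - 1)))" using le_mono[OF ct] by simp
  ultimately have E1: "E \<in> le C 1" by blast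
  have step: "E \<in> ge C (j + 1)" if "E \<in> ge C j" "j < 0" for j
  proof -
    obtain U V where UV: "tri U E V" "U \<in> le C j" "V \<in> ge C (j + 1)" using truncate[OF ct E(1)] by blast
    have U: "U \<in> ge C j" "U \<in> Ob D" using ge_first[OF ct UV(1)] ge_mono[OF ct UV(3)] that tri_Ob UV by auto
    have "sh j U \<in> cohomology D C j E"
      by (rule cohomology_in[OF ct UV NE[OF U(2)] Nle U(1)])
    then have "is_zero D U" using z[of j] that is_zero_sh U by auto
    then show ?thesis using tri_first_zero UV ge_iso[OF ct] iso_sym by blast
  qed
  have "E \<in> ge C 0" if "E \<in> ge C (- int n)" for n
    using that by (induction n) (use step[of "- 1 - int _"] in auto)
  moreover obtain k where "E \<in> ge C k" using bounded_ge[OF b E(1)] by blast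
  then have "E \<in> ge C (- int (nat (- k)))" using ge_mono[OF ct] by simp
  ultimately have E0: "E \<in> ge C 0" by blast
  obtain U V where UV: "tri U E V" "U \<in> le C 0" "V \<in> ge C (0 + 1)" using truncate[OF ct E(1)] by blast
  have U: "U \<in> ge C 0" "U \<in> Ob D" using ge_first[OF ct UV(1), of 0] ge_mono[OF ct UV(3), of "-1"] E0 tri_Ob UV by auto
  have "sh 0 U \<in> cohomology D C 0 E" by (rule cohomology_in[OF ct UV NE[OF U(2)] Nle U(1)])
  then have "U \<in> F" using E by auto
  moreover have "sh 1 V \<in> cohomology D C 1 E"
    by (rule cohomology_in[OF ct EN(1)[OF E(1)] E1 Nge UV(1)]) (use UV in auto)
  then have "ShOb D V \<in> T" using E by auto
  ultimately show "E \<in> {E. \<exists>Y\<in>F. \<exists>X. ShOb D X \<in> T \<and> tri Y E X}" using UV by blast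
next
  obtain N where N: "is_zero D N" using zero_object by blast
  note Nle = zero_le[OF ct N] and Nge = zero_ge[OF ct N]
  fix E assume "E \<in> {E. \<exists>Y\<in>F. \<exists>X. ShOb D X \<in> T \<and> tri Y E X}"
  then obtain Y X where YX: "Y \<in> F" "ShOb D X \<in> T" "tri Y E X" by blast
  have Ob: "Y \<in> Ob D" "E \<in> Ob D" "X \<in> Ob D" using tri_Ob YX by auto
  have Y: "Y \<in> le C 0" "Y \<in> ge C 0" using F_heart[OF YX(1)] heart_iff[OF ct] by auto
  have X: "X \<in> le C 1" "X \<in> ge C 1" using T_desusp YX Ob by auto
  have E: "E \<in> le C 1" "E \<in> ge C 0"
    using le_ext[OF ct YX(3)] ge_ext[OF ct YX(3)] le_mono[OF ct Y(1)] ge_mono[OF ct X(2)] X Y by auto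
  have t: "tri E E N" "tri N N N" "tri N Y Y" "tri N E E"
    using tri_zero_third[OF N iso_refl] tri_zero_first[OF N iso_refl] Ob is_zero_Ob[OF N] by blast+
  have "is_zero D H" if "i \<notin> {0, 1}" "H \<in> cohomology D C i E" for i H
  proof -
    \<comment> \<open>Outside the degrees 0 and 1 the trivial triangles on E and the zero object N
      are truncation triangles.\<close>
    have "sh i N \<in> cohomology D C i E"
    proof (cases "i < 0")
      case True
      show ?thesis
        by (rule cohomology_in[OF ct t(4) Nle _ t(2) Nle Nge]) (use ge_mono[OF ct E(2)] True in simp)
    next
      case False
      then have "1 \<le> i - 1" using that by auto
      then show ?thesis
        by (intro cohomology_in[OF ct t(1) _ Nge t(1) _ Nge]) (use le_mono[OF ct E(1)] in auto)
    qed
    then have "sh i N \<simeq> H" using cohomology_unique[OF ct _ that(2)] by blast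
    then show ?thesis using is_zero_iso is_zero_sh N is_zero_Ob by blast
  qed
  moreover have "H \<in> F" if "H \<in> cohomology D C 0 E" for H
  proof -
    have "sh 0 Y \<in> cohomology D C 0 E"
      by (rule cohomology_in[OF ct YX(3) Y(1) _ t(3) Nle Y(2)]) (use X in simp)
    then show ?thesis using cohomology_unique[OF ct _ that] F_iso YX by auto
  qed
  moreover have "H \<in> T" if "H \<in> cohomology D C 1 E" for H
  proof -
    have "sh 1 X \<in> cohomology D C 1 E"
      by (rule cohomology_in[OF ct t(1) E(1) Nge YX(3) _ X(2)]) (use Y in simp)
    then show ?thesis using cohomology_unique[OF ct _ that] T_iso YX by auto
  qed
  ultimately show "E \<in> left_tilt D C T F" unfolding left_tilt_def using Ob by blast
qed

lemma heart_tilt_left_tilt: "heart D (tilt C T) = left_tilt D C T F"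
  using heart_tilt left_tilt_eq by simp

text \<open>The torsion class can be read off from the tilted aisle: if E[-1] is in it, then E is in
  degrees at most -1 there and has no nonzero morphism to F, so E equals its torsion part.\<close>

lemma tilt_recover: "T = {E \<in> heart D C. sh (-1) E \<in> tilt C T}"
proof (intro equalityI subsetI)
  fix E assume "E \<in> T" then show "E \<in> {E \<in> heart D C. sh (-1) E \<in> tilt C T}"
    using T_le_tilt T_heart le_iff[OF tilt_t_structure] by blast
next
  fix E assume "E \<in> {E \<in> heart D C. sh (-1) E \<in> tilt C T}"
  then have E: "E \<in> heart D C" "E \<in> le (tilt C T) (-1)"
    using le_iff[OF tilt_t_structure] heart_Ob[OF ct] by auto
  obtain X Y where XY: "X \<in> T" "Y \<in> F" "tri X E Y" using torsion_split E by blast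
  have "orth E Y" using le_ge_orth[OF tilt_t_structure E(2) F_ge_tilt[OF XY(2)]] by simp
  then have "X \<simeq> E" using tri_split_third(2)[OF XY(3)] heart_orth[OF ct] T_heart F_heart XY by blast
  then show "E \<in> T" using T_iso XY by blast
qed

end

section \<open>Torsion classes attached to intermediate t-structures\<close>

definition torsion_of :: "'o set \<Rightarrow> 'o set \<Rightarrow> 'o set" where
  "torsion_of C C' = {E \<in> heart D C. sh (-1) E \<in> C'}"

context
  fixes C C' assumes t: "t_structure D C" "t_structure D C'" and sub: "C \<subseteq> C'" "C' \<subseteq> le C 1"
begin

text \<open>The decomposition of E is its truncation for \<open>C'\<close> below degree 0. One
  degree bound for each piece comes from the inclusions of aisles, the other from the
  triangle.\<close>

lemma torsion_of_theory: "torsion_theory C (torsion_of C C') (heart D C \<inter> ge C' 0)"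
  unfolding torsion_theory_def
proof (intro conjI ballI)
  have T: "X \<in> torsion_of C C' \<longleftrightarrow> X \<in> heart D C \<and> X \<in> le C' (-1)" for X
    unfolding torsion_of_def using le_iff[OF t(2)] heart_Ob[OF t(1)] by blast
  show "strict_full D (torsion_of C C')"
    unfolding strict_full_def using T heart_Ob[OF t(1)] heart_iso[OF t(1)] le_iso[OF t(2)] by blast
  show "strict_full D (heart D C \<inter> ge C' 0)"
    unfolding strict_full_def using heart_Ob[OF t(1)] heart_iso[OF t(1)] ge_iso[OF t(2)] by blast
  show "torsion_of C C' \<subseteq> heart D C" "heart D C \<inter> ge C' 0 \<subseteq> heart D C" using T by auto
  show "orth X Y" if "X \<in> torsion_of C C'" "Y \<in> heart D C \<inter> ge C' 0" for X Y
    using le_ge_orth[OF t(2), of X "-1" Y 0] T that by simp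
  fix E assume E: "E \<in> heart D C"
  then have E': "E \<in> le C 0" "E \<in> ge C 0" using heart_iff[OF t(1)] by auto
  obtain X Y where XY: "tri X E Y" "X \<in> le C' (-1)" "Y \<in> ge C' (-1 + 1)" using truncate[OF t(2) heart_Ob[OF t(1) E]] by blast
  have 1: "X \<in> le C 0" "Y \<in> ge C 0" using intermediate_le_Suc[OF t sub XY(2)] intermediate_ge[OF t sub] XY by auto
  have "X \<in> ge C 0" "Y \<in> le C 0"
    using ge_first[OF t(1) XY(1) E'(2)] ge_mono[OF t(1) 1(2)] le_third[OF t(1) XY(1) _ E'(1)] le_mono[OF t(1) 1(1)] by auto
  then have "X \<in> torsion_of C C'" "Y \<in> heart D C \<inter> ge C' 0" using T heart_iff[OF t(1)] 1 XY by auto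
  then show "\<exists>X\<in>torsion_of C C'. \<exists>Y\<in>heart D C \<inter> ge C' 0. tri X E Y" using XY by blast
qed

text \<open>For E in \<open>C'\<close> the truncation of E for \<open>C\<close> does the work: U
  also lies in \<open>C'\<close>, hence so does V, and this says that V[1] is in the torsion
  class.\<close>

lemma tilt_torsion_of: "tilt C (torsion_of C C') = C'"
proof (intro equalityI subsetI)
  fix E assume "E \<in> tilt C (torsion_of C C')"
  then obtain U V where UV: "tri U E V" "U \<in> C" "sh (-1) (ShOb D V) \<in> C'" unfolding tilt_def torsion_of_def by blast
  have "sh (-1) (ShOb D V) \<simeq> V" using sh_minus(1)[of V 1] tri_Ob UV by simp
  then have "V \<in> le C' 0" using UV le_0[OF t(2)] le_iso[OF t(2)] by blast
  moreover have "U \<in> le C' 0" using UV sub le_0[OF t(2)] by blast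
  ultimately show "E \<in> C'" using le_ext[OF t(2) UV(1)] le_0[OF t(2)] by blast
next
  fix E assume E: "E \<in> C'"
  obtain U V where UV: "tri U E V" "U \<in> le C 0" "V \<in> ge C (0 + 1)" using truncate[OF t(1) ts_Ob[OF t(2) E]] by blast
  have Ob: "V \<in> Ob D" using UV tri_Ob by blast
  have "U \<in> le C' 1" using intermediate_le[OF t sub UV(2)] le_mono[OF t(2)] by simp
  then have V': "V \<in> le C' 0" using le_third[OF t(2) UV(1), of 0] E le_0[OF t(2)] by simp
  then have "V \<in> le C 1" using intermediate_le_Suc[OF t sub V'] by simp
  then have "ShOb D V \<in> heart D C" using UV heart_iff[OF t(1)] le_ShOb[OF t(1) Ob, of 0] ge_ShOb[OF t(1) Ob, of 0] by simp
  moreover have "sh (-1) (ShOb D V) \<in> C'"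
    using sh_minus(1)[OF Ob, of 1] V' le_0[OF t(2)] le_iso[OF t(2), of V 0] iso_sym by simp
  ultimately have "ShOb D V \<in> torsion_of C C'" unfolding torsion_of_def by blast
  then show "E \<in> tilt C (torsion_of C C')" unfolding tilt_def using UV le_0[OF t(1)] by blast
qed

end

text \<open>Resolves the definite description: \<open>tilt C T\<close> has the required heart, and a
  bounded t-structure is determined by its heart.\<close>

lemma tilted_t_structure_eq:
  assumes "bounded_t_structure D C" "T \<in> torsion_classes (heart_cat D C)"
  shows "tilted_t_structure D C T = tilt C T"
proof -
  note t = bounded_ts[OF assms(1)]
  obtain F where F: "torsion_theory C T F" using assms torsion_pair_iff[OF t] unfolding torsion_classes_def by blast
  show ?thesis
    unfolding tilted_t_structure_def
  proof (rule the_equality)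
    show "bounded_t_structure D (tilt C T) \<and>
        (\<exists>F. torsion_pair (heart_cat D C) T F \<and> heart D (tilt C T) = left_tilt D C T F)"
      using tilt_bounded[OF assms(1) F] heart_tilt_left_tilt[OF assms(1) F] F torsion_pair_iff[OF t] by blast
    fix C' assume C': "bounded_t_structure D C' \<and>
        (\<exists>F. torsion_pair (heart_cat D C) T F \<and> heart D C' = left_tilt D C T F)"
    then obtain F' where F': "torsion_theory C T F'" "heart D C' = left_tilt D C T F'" using torsion_pair_iff[OF t] by blast
    then show "C' = tilt C T" 
      using heart_determines[OF _ tilt_bounded[OF assms(1) F'(1)]] heart_tilt_left_tilt[OF assms(1) F'(1)] C' by blast
  qed
qed

lemma intermediate_iff: "C' \<in> intermediate D C \<longleftrightarrow> bounded_t_structure D C' \<and> C \<subseteq> C' \<and> C' \<subseteq> le C 1"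
  unfolding intermediate_def le_def by simp

lemma tilt_intermediate:
  assumes "bounded_t_structure D C" "torsion_theory C T F" shows "tilt C T \<in> intermediate D C"
  unfolding intermediate_iff using tilt_bounded[OF assms] C_sub_tilt[OF assms] tilt_sub_le[OF assms] by blast

lemma intermediate_tilt:
  assumes "bounded_t_structure D C" "C' \<in> intermediate D C"
  shows "torsion_of C C' \<in> torsion_classes (heart_cat D C)" "tilt C (torsion_of C C') = C'"
proof -
  have i: "t_structure D C" "t_structure D C'" "C \<subseteq> C'" "C' \<subseteq> le C 1"
    using assms bounded_ts intermediate_iff by auto
  show "torsion_of C C' \<in> torsion_classes (heart_cat D C)" "tilt C (torsion_of C C') = C'"
    using torsion_of_theory[OF i] torsion_pair_iff[OF i(1)] tilt_torsion_of[OF i] unfolding torsion_classes_def by blast+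
qed

subsection \<open>Simple tilts\<close>

lemma ext_closure_tri:
  assumes "tri X Y Z" "X \<in> ext_closure D A" "Z \<in> ext_closure D A" shows "Y \<in> ext_closure D A"
proof -
  obtain f g h where "(f, g, h) \<in> Tri D" "Dom D f = X" "Cod D f = Y" "Cod D g = Z" using assms(1) tri_iff by blast
  then show ?thesis using ext_closure.ext_step[of f g h D A] assms by simp
qed

lemma ext_closure_induct [consumes 1, case_names zero base ext]:
  assumes "E \<in> ext_closure D A" "\<And>N. is_zero D N \<Longrightarrow> P N" "\<And>E. E \<in> A \<Longrightarrow> P E"
    "\<And>X Y Z. tri X Y Z \<Longrightarrow> X \<in> ext_closure D A \<Longrightarrow> P X \<Longrightarrow> Z \<in> ext_closure D A \<Longrightarrow> P Z \<Longrightarrow> P Y"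
  shows "P E"
  using assms(1)
proof (induct rule: ext_closure.induct)
  case (ext_zero Z) then show ?case by (rule assms(2))
next
  case (ext_base E) then show ?case by (rule assms(3))
next
  case (ext_step f g h)
  show ?case by (rule assms(4)[OF dt_tri[OF Tri_dt[OF ext_step(1)]] ext_step(2,3,4,5)])
qed

lemma ext_closure_iso: assumes "E \<in> ext_closure D A" "E \<simeq> F" shows "F \<in> ext_closure D A"
proof -
  obtain N where N: "is_zero D N" using zero_object by blast
  show ?thesis using ext_closure_tri[OF tri_zero_third[OF N assms(2)] assms(1) ext_closure.ext_zero[OF N]] .
qed

text \<open>In an extension with third object Z, a quotient S of Z is also a quotient of the middle
  object; regrouping shows that the new kernel is again an iterated extension.\<close>

lemma ext_closure_quotient:
  assumes "E \<in> ext_closure D {S}" "S \<in> Ob D" shows "is_zero D E \<or> (\<exists>K\<in>ext_closure D {S}. tri K E S)"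
  using assms(1)
proof (induction rule: ext_closure_induct)
  case (base E)
  obtain N where N: "is_zero D N" using zero_object by blast
  then have "tri N S S" using tri_zero_first iso_refl assms by blast
  then show ?case using base ext_closure.ext_zero[OF N, of "{S}"] by blast
next
  case (ext X Y Z)
  show ?case
  proof (cases "is_zero D Z")
    case True
    then have XY: "X \<simeq> Y" using tri_third_zero[OF ext(1)] by blast
    from ext(4) show ?thesis
    proof
      assume "is_zero D X" then show ?thesis using is_zero_iso[OF XY] by blast
    next
      assume "\<exists>K\<in>ext_closure D {S}. tri K X S"
      then obtain K where K: "K \<in> ext_closure D {S}" "tri K X S" by blast
      then have "tri K Y S" using tri_iso[OF K(2) iso_refl XY iso_refl] tri_Ob by blast
      then show ?thesis using K by blast
    qed
  next
    case False
    then obtain K where K: "K \<in> ext_closure D {S}" "tri K Z S" using ext by blast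
    obtain L where "tri X L K" "tri L Y S" using tri_assoc_right[OF ext(1) K(2)] by blast
    then show ?thesis using ext_closure_tri ext K by blast
  qed
qed simp

lemma ext_closure_orth:
  assumes "E \<in> ext_closure D {S}" "orth S F" "F \<in> Ob D" shows "orth E F"
  using assms(1) by (induction rule: ext_closure_induct) (use assms orth_zero tri_orth_right in \<open>blast | simp\<close>)+

abbreviation simple_tilt_at :: "'o set \<Rightarrow> 'o \<Rightarrow> 'o set" where
  "simple_tilt_at C S \<equiv> tilt C (ext_closure D {S})"

context
  fixes C assumes b: "bounded_t_structure D C" and a: "algebraic_heart D C"
begin

lemma bt: "t_structure D C"
  using b bounded_ts by blast

lemma ext_closure_heart:
  assumes "simple_object (heart_cat D C) S" "E \<in> ext_closure D {S}" shows "E \<in> heart D C"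
  using assms(2)
  by (induction rule: ext_closure_induct) (use assms zero_heart[OF bt] heart_ext[OF bt] simple_heart[OF bt] in blast)+

text \<open>The torsion part is found by induction on length: a nonzero morphism S -> E is monic,
  and the torsion part of its cokernel, which is shorter, is enlarged by S.\<close>

lemma simple_torsion_theory:
  assumes S: "simple_object (heart_cat D C) S"
  shows "torsion_theory C (ext_closure D {S}) {E \<in> heart D C. orth S E}"
  unfolding torsion_theory_def
proof (intro conjI ballI)
  have Ob: "S \<in> Ob D" using simple_Ob[OF bt S] .
  show "strict_full D (ext_closure D {S})"
    unfolding strict_full_def using ext_closure_iso ext_closure_heart[OF S] heart_Ob[OF bt] by blast
  show "strict_full D {E \<in> heart D C. orth S E}"
    unfolding strict_full_def using heart_iso[OF bt] heart_Ob[OF bt] orth_iso[OF _ iso_refl[OF Ob]] by blast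
  show "ext_closure D {S} \<subseteq> heart D C" "{E \<in> heart D C. orth S E} \<subseteq> heart D C" using ext_closure_heart[OF S] by auto
  show "orth X Y" if "X \<in> ext_closure D {S}" "Y \<in> {E \<in> heart D C. orth S E}" for X Y
    using ext_closure_orth that heart_Ob[OF bt] by blast
  obtain N where N: "is_zero D N" using zero_object by blast
  have S1: "haslen C S 1"
    using haslen_step[OF bt haslen_zero[OF bt N] tri_zero_first[OF N iso_refl[OF Ob]] S] by simp
  have "\<exists>X\<in>ext_closure D {S}. \<exists>Y\<in>{E \<in> heart D C. orth S E}. tri X E Y" if "haslen C E n" for E n
    using that
  proof (induction n arbitrary: E rule: less_induct)
    case (less n)
    have E: "E \<in> heart D C" using haslen_heart[OF bt] less by blast
    show ?case
    proof (cases "orth S E")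
      case True
      have "tri N E E" using tri_zero_first[OF N iso_refl] heart_Ob[OF bt E] by blast
      then show ?thesis using True E ext_closure.ext_zero[OF N, of "{S}"] by blast
    next
      case False
      then obtain d where d: "d \<in> Hom D S E" "d \<noteq> Zero D S E" using orthI Ob heart_Ob[OF bt E] by blast
      obtain Q q r where Q: "dt S E Q d q r" "Q \<in> heart D C" using simple_inj[OF bt S E d] by blast
      obtain k where k: "haslen C Q k" using haslen_exists[OF bt a Q(2)] by blast
      then have "n = 1 + k" using haslen_unique[OF bt a less(2)] haslen_add[OF bt k S1 dt_tri[OF Q(1)]] by blast
      then obtain X' Y' where XY: "X' \<in> ext_closure D {S}" "Y' \<in> {E \<in> heart D C. orth S E}" "tri X' Q Y'"
        using less.IH[OF _ k] by auto
      obtain Y where "tri S Y X'" "tri Y E Y'" using tri_assoc_right[OF dt_tri[OF Q(1)] XY(3)] by blast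
      moreover have "S \<in> ext_closure D {S}" by (rule ext_closure.ext_base) simp
      ultimately show ?thesis using XY ext_closure_tri by blast
    qed
  qed
  note split = this
  fix E assume "E \<in> heart D C"
  then obtain n where "haslen C E n" using haslen_exists[OF bt a] by blast
  then show "\<exists>X\<in>ext_closure D {S}. \<exists>Y\<in>{E \<in> heart D C. orth S E}. tri X E Y" by (rule split)
qed

lemma simple_tilt_at:
  assumes "simple_object (heart_cat D C) S" shows "simple_tilt D C (simple_tilt_at C S)"
  unfolding simple_tilt_def
  by (intro conjI exI[of _ S] assms a b tilt_bounded[OF b simple_torsion_theory[OF assms]]
      heart_tilt_left_tilt[OF b simple_torsion_theory[OF assms]])

lemma simple_tilt_atE:
  assumes "simple_tilt D C C'" obtains S where "simple_object (heart_cat D C) S" "C' = simple_tilt_at C S"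
proof -
  obtain S where S: "simple_object (heart_cat D C) S"
      "heart D C' = left_tilt D C (ext_closure D {S}) {E \<in> heart D C. Hom D S E = {Zero D S E}}"
      "bounded_t_structure D C'"
    using assms unfolding simple_tilt_def by blast
  have "C' = simple_tilt_at C S"
    using heart_determines[OF S(3) tilt_bounded[OF b simple_torsion_theory[OF S(1)]]]
      heart_tilt_left_tilt[OF b simple_torsion_theory[OF S(1)]] S(2) by simp
  then show ?thesis using that S by blast
qed

text \<open>The condition on S says that S[-1] is in \<open>C'\<close>. It passes to iterated
  extensions of S, and the tilt consists of extensions of their desuspensions by objects of
  \<open>C\<close>.\<close>

lemma simple_tilt_at_subset:
  assumes "simple_object (heart_cat D C) S" "t_structure D C'" "C \<subseteq> C'" "S \<in> le C' (-1)"
  shows "simple_tilt_at C S \<subseteq> C'"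
proof
  fix E assume "E \<in> simple_tilt_at C S"
  then obtain U V where UV: "tri U E V" "U \<in> C" "ShOb D V \<in> ext_closure D {S}" unfolding tilt_def by blast
  have "X \<in> le C' (-1)" if "X \<in> ext_closure D {S}" for X
    using that
  proof (induction rule: ext_closure_induct)
    case (zero N) then show ?case using zero_le[OF assms(2)] by blast
  next
    case (base E) then show ?case using assms by simp
  next
    case (ext X Y Z) then show ?case using le_ext[OF assms(2)] by blast
  qed
  then have "V \<in> le C' 0" using UV le_ShOb[OF assms(2), of V "-1"] tri_Ob[OF UV(1)] by simp
  moreover have "U \<in> le C' 0" using UV assms le_0[OF assms(2)] by blast
  ultimately have "E \<in> le C' 0" using le_ext[OF assms(2) UV(1)] by blast
  then show "E \<in> C'" using le_0[OF assms(2)] by simp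
qed

lemma simple_tilt_at_strict:
  assumes "simple_object (heart_cat D C) S" shows "C \<subset> simple_tilt_at C S"
proof -
  note p = simple_torsion_theory[OF assms]
  have Ob: "S \<in> Ob D" using simple_Ob[OF bt assms] .
  have "S \<in> ext_closure D {S}" by (rule ext_closure.ext_base) simp
  then have "sh (-1) S \<in> simple_tilt_at C S" using tilt_recover[OF b p] by blast
  moreover have "sh (-1) S \<notin> C"
  proof
    assume "sh (-1) S \<in> C"
    then have "S \<in> le C (-1)" using le_iff[OF bt] Ob by blast
    then have "is_zero D S" using le_ge_zero[OF bt, of S "-1" 0] simple_heart[OF bt assms] heart_iff[OF bt] by simp
    then show False using simple_nonzero[OF bt assms] by blast
  qed
  ultimately show ?thesis using C_sub_tilt[OF b p] by blast
qed

text \<open>An object of \<open>C'\<close> outside \<open>C\<close> has nonzero V[1] in the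
  extension closure of S. Its quotient S has a kernel in \<open>C\<close>, which is inside
  \<open>C'\<close>, and V is in \<open>C'\<close>; this forces S[-1] into
  \<open>C'\<close>.\<close>

lemma simple_tilt_at_minimal:
  assumes S: "simple_object (heart_cat D C) S" and t': "t_structure D C'" and sub: "C \<subset> C'" "C' \<subseteq> simple_tilt_at C S"
  shows "C' = simple_tilt_at C S"
proof -
  obtain E where E: "E \<in> C'" "E \<notin> C" using sub by blast
  then obtain U V where UV: "tri U E V" "U \<in> C" "ShOb D V \<in> ext_closure D {S}" using sub unfolding tilt_def by blast
  have V: "V \<in> Ob D" using UV tri_Ob by blast
  have "\<not> is_zero D V"
    using tri_third_zero[OF UV(1)] E UV le_iso[OF bt, of U 0 E] le_0[OF bt] by blast
  then obtain K where K: "K \<in> ext_closure D {S}" "tri K (ShOb D V) S"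
    using ext_closure_quotient[OF UV(3) simple_Ob[OF bt S]] is_zero_ShOb_iff V by blast
  have "U \<in> le C' 0" "E \<in> le C' 0" using UV E sub le_0[OF t'] by auto
  then have "V \<in> le C' 0" using le_third[OF t' UV(1), of 0] le_mono[OF t', of U 0 1] by simp
  then have VS: "ShOb D V \<in> le C' (-1)" using le_ShOb[OF t' V, of "-1"] by simp
  have "K \<in> C" using ext_closure_heart[OF S K(1)] heart_iff[OF bt] le_0[OF bt] by blast
  then have "K \<in> le C' 0" using sub le_0[OF t'] by blast
  then have "S \<in> le C' (-1)" using le_third[OF t' K(2), of "-1"] VS by simp
  then show ?thesis using simple_tilt_at_subset[OF S t'] sub by blast
qed

text \<open>An object of \<open>C'\<close> outside \<open>C\<close> has nonzero H^1 for
  \<open>C\<close>; a simple quotient of this H^1 is the required S, as the kernel in the heart is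
  in \<open>C'\<close>.\<close>

lemma exists_simple_tilt_below:
  assumes t': "t_structure D C'" and sub: "C \<subset> C'" "C' \<subseteq> le C 1"
  obtains S where "simple_object (heart_cat D C) S" "S \<in> le C' (-1)"
proof -
  have i: "C \<subseteq> C'" using sub by blast
  note i = bt t' i sub(2)
  obtain E where E: "E \<in> C'" "E \<notin> C" using sub by blast
  obtain U V where UV: "tri U E V" "U \<in> le C 0" "V \<in> ge C (0 + 1)" using truncate[OF bt ts_Ob[OF t' E(1)]] by blast
  have V: "V \<in> Ob D" using UV tri_Ob by blast
  have "\<not> is_zero D V"
    using tri_third_zero[OF UV(1)] E UV le_iso[OF bt, of U 0 E] le_0[OF bt] by blast
  then have nz: "\<not> is_zero D (ShOb D V)" using is_zero_ShOb_iff V by blast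
  have "U \<in> le C' 0" "E \<in> le C' 0" using intermediate_le[OF i UV(2)] E le_0[OF t'] by auto
  then have V': "V \<in> le C' 0" using le_third[OF t' UV(1), of 0] le_mono[OF t', of U 0 1] by simp
  then have VS: "ShOb D V \<in> le C' (-1)" using le_ShOb[OF t' V, of "-1"] by simp
  have "V \<in> le C 1" using intermediate_le_Suc[OF i V'] by simp
  then have "ShOb D V \<in> heart D C" using heart_iff[OF bt] UV le_ShOb[OF bt V, of 0] ge_ShOb[OF bt V, of 0] by simp
  then obtain K S where K: "tri K (ShOb D V) S" "K \<in> heart D C" "simple_object (heart_cat D C) S"
    using simple_quotient[OF bt a _ nz] by blast
  have "K \<in> le C' 0" using intermediate_le[OF i] K(2) heart_iff[OF bt] by blast
  then have "S \<in> le C' (-1)" using le_third[OF t' K(1), of "-1"] VS by simp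
  then show ?thesis using that K by blast
qed

end

subsection \<open>Reachability of intermediate t-structures\<close>

text \<open>The Euler characteristic with respect to \<open>C'\<close> separates simple objects of the heart of \<open>C'\<close> from torsion objects.\<close>

lemma grothendieck_class_distinct:
  assumes b: "bounded_t_structure D C" "bounded_t_structure D C'" and sub: "C \<subseteq> C'" "C' \<subseteq> le C 1"
    and a: "algebraic_heart D C'"
    and X: "X \<in> heart D C" "X \<in> le C' (-1)" "\<not> is_zero D X"
    and Y: "Y \<in> heart D C" "Y \<in> heart D C'" "\<not> is_zero D Y"
  shows "grothendieck_class (heart_cat D C) X \<noteq> grothendieck_class (heart_cat D C) Y"
proof
  assume eq: "grothendieck_class (heart_cat D C) X = grothendieck_class (heart_cat D C) Y"
  note t = bounded_ts[OF b(1)] and t' = bounded_ts[OF b(2)]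
  note i = t t' sub
  \<comment> \<open>Objects of the heart of \<open>C\<close> lie in degrees -1 and 0 for
    \<open>C'\<close>, so the description is proper on all of them.\<close>
  define \<phi> where "\<phi> E = (THE v. euler C' E v)" for E
  have ge: "E \<in> ge C' (-1)" if "E \<in> heart D C" for E
    using intermediate_ge_Suc[OF i, of E "-1"] heart_iff[OF t] that by simp
  have \<phi>: "\<phi> E = v" if "euler C' E v" for E v
    unfolding \<phi>_def using euler_unique[OF t' a] that by blast
  have ex: "euler C' E (\<phi> E)" if "E \<in> heart D C" for E
    using euler_exists[OF t' a intermediate_le[OF i] ge, of E] heart_iff[OF t] that \<phi> by metis
  have "\<phi> X = \<phi> Y"
  proof (rule grothendieck_class_additive[OF _ _ eq])
    fix f g assume s: "short_exact (heart_cat D C) f g"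
    obtain h where "dt (Dom D f) (Cod D f) (Cod D g) f g h" 
      and H: "Dom D f \<in> heart D C" "Cod D f \<in> heart D C" "Cod D g \<in> heart D C"
      using short_exact_dt[OF t s] by blast
    then have "euler C' (Cod D f) (\<phi> (Dom D f) + \<phi> (Cod D g))" using euler_add[OF t' a dt_tri] ex by blast
    then show "\<phi> (Cod (heart_cat D C) f) = \<phi> (Dom (heart_cat D C) f) + \<phi> (Cod (heart_cat D C) g)" using \<phi> by simp
    show "Cod (heart_cat D C) f \<in> Ob (heart_cat D C) \<and> Dom (heart_cat D C) f \<in> Ob (heart_cat D C) \<and>
        Cod (heart_cat D C) g \<in> Ob (heart_cat D C)" using H heart_Ob[OF t] by simp
  qed
  moreover have "\<phi> E > 0" if E: "E \<in> heart D C'" "\<not> is_zero D E" for E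
  proof -
    obtain n where n: "haslen C' E n" using haslen_exists[OF t' a E(1)] by blast
    then have "n \<noteq> 0" using E(2) haslen_0[OF t'] by metis
    then show ?thesis using \<phi>[OF euler_heart[OF t' a n]] by simp
  qed
  then have "\<phi> Y > 0" using Y by blast
  moreover have "\<phi> X < 0"
  proof -
    have Ob: "X \<in> Ob D" "sh (-1) X \<in> Ob D" using heart_Ob[OF t X(1)] sh_Ob by auto
    \<comment> \<open>For \<open>C'\<close> the object X sits in degree -1 alone, so only the
      negative term of its Euler characteristic is nonzero.\<close>
    have H: "sh (-1) X \<in> heart D C'"
      using heart_iff[OF t'] le_sh[OF t' Ob(1), of "-1" 0] ge_sh[OF t' Ob(1), of "-1" 0] X ge by simp
    obtain n where n: "haslen C' (sh (-1) X) n" using haslen_exists[OF t' a H] by blast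
    have "\<not> is_zero D (sh (-1) X)" using is_zero_sh Ob X by blast
    then have "n \<noteq> 0" using n haslen_0[OF t'] by metis
    moreover have "euler C' X (- int n)"
      using euler_iso[OF t' a euler_ShOb[OF t' a n]] sh_minus(2)[OF Ob(1), of 1] by simp
    ultimately show ?thesis using \<phi> by fastforce
  qed
  ultimately show False by simp
qed

lemma simple_tilts_increase:
  assumes "(simple_tilt D)\<^sup>*\<^sup>* C C'" "bounded_t_structure D C" shows "bounded_t_structure D C' \<and> C \<subseteq> C'"
  using assms(1)
proof induction
  case (step Y Z)
  have YZ: "bounded_t_structure D Y" "algebraic_heart D Y" "bounded_t_structure D Z"
    using step(2) unfolding simple_tilt_def by auto
  obtain S where "simple_object (heart_cat D Y) S" "Z = simple_tilt_at Y S" using simple_tilt_atE[OF YZ(1,2) step(2)] by blast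
  then show ?case using simple_tilt_at_strict[OF YZ(1,2)] YZ step by blast
qed (use assms in simp)

text \<open>Together with \<open>tilt_indefinitely\<close> this makes every intermediate heart
  algebraic, as needed to find simple tilts below covers.\<close>

lemma intermediate_reachable:
  assumes b: "bounded_t_structure D C" and ind: "tilt_indefinitely D C" and C': "C' \<in> intermediate D C"
    and fin: "finite (grothendieck_class (heart_cat D C) ` {E. endo_trivial (heart_cat D C) E}) \<or>
         finite (torsion_classes (heart_cat D C))"
  shows "(simple_tilt D)\<^sup>*\<^sup>* C C'"
proof (rule ccontr)
  assume not: "\<not> (simple_tilt D)\<^sup>*\<^sup>* C C'"
  \<comment> \<open>By \<open>not\<close> no member of R equals \<open>C'\<close>, so the inclusion
    in \<open>C'\<close> is always proper and a further tilt below \<open>C'\<close> exists.\<close>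
  define R where "R = {X. (simple_tilt D)\<^sup>*\<^sup>* C X \<and> X \<subseteq> C'}"
  note t = bounded_ts[OF b]
  have C1: "bounded_t_structure D C'" "C \<subseteq> C'" "C' \<subseteq> le C 1" using C' intermediate_iff by auto
  note t' = bounded_ts[OF C1(1)]
  have R: "bounded_t_structure D X" "algebraic_heart D X" "C \<subseteq> X" "X \<subset> C'" "X \<subseteq> le C 1" "X \<in> intermediate D C" if "X \<in> R" for X
  proof -
    have X: "(simple_tilt D)\<^sup>*\<^sup>* C X" "X \<subseteq> C'" using that R_def by auto
    show 1: "bounded_t_structure D X" "C \<subseteq> X" "algebraic_heart D X"
      using simple_tilts_increase[OF X(1) b] ind X(1) unfolding tilt_indefinitely_def by auto
    show "X \<subset> C'" "X \<subseteq> le C 1" using X not C1 by auto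
    then show "X \<in> intermediate D C" using intermediate_iff 1 by blast
  qed
  have "\<exists>S. simple_object (heart_cat D X) S \<and> S \<in> le C' (-1) \<and> simple_tilt_at X S \<in> R" if X: "X \<in> R" for X
  proof -
    have "C' \<subseteq> le X 1" using le_subset[OF t bounded_ts[OF R(1)[OF X]] R(3)[OF X]] C1 by blast
    then obtain S where S: "simple_object (heart_cat D X) S" "S \<in> le C' (-1)"
      using exists_simple_tilt_below[OF R(1,2)[OF X] t' R(4)[OF X]] by blast
    have "simple_tilt_at X S \<subseteq> C'" using simple_tilt_at_subset[OF R(1,2)[OF X] S(1) t' _ S(2)] R(4)[OF X] by blast
    moreover have "(simple_tilt D)\<^sup>*\<^sup>* C (simple_tilt_at X S)"
      using X simple_tilt_at[OF R(1,2)[OF X] S(1)] unfolding R_def by (auto intro: rtranclp.rtrancl_into_rtrancl)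
    ultimately show ?thesis using S R_def by blast
  qed
  then obtain s where s: "simple_object (heart_cat D X) (s X)" "s X \<in> le C' (-1)" "simple_tilt_at X (s X) \<in> R" if "X \<in> R" for X
    by metis
  define X where "X n = ((\<lambda>X. simple_tilt_at X (s X)) ^^ n) C" for n
  have XR: "X n \<in> R" for n
    by (induction n) (use s C1 in \<open>auto simp: X_def R_def\<close>)
  have XSuc: "X (Suc n) = simple_tilt_at (X n) (s (X n))" for n by (simp add: X_def)
  have strict: "X n \<subset> X (Suc n)" for n
    unfolding XSuc using simple_tilt_at_strict R(1,2)[OF XR] s(1)[OF XR] by blast
  then have mono: "X i \<subset> X j" if "i < j" for i j using lift_Suc_mono_less[of X] that by blast
  have "inj X" using mono by (metis (no_types) injI linorder_neqE_nat psubset_imp_subset order.strict_iff_order)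
  from fin show False
  proof
    assume "finite (torsion_classes (heart_cat D C))"
    moreover have "torsion_of C (X n) \<in> torsion_classes (heart_cat D C)" "tilt C (torsion_of C (X n)) = X n" for n
      using intermediate_tilt[OF b R(6)[OF XR]] by auto
    then have "inj (\<lambda>n. torsion_of C (X n))" "range (\<lambda>n. torsion_of C (X n)) \<subseteq> torsion_classes (heart_cat D C)"
      using \<open>inj X\<close> unfolding inj_def by (metis, blast)
    ultimately show False using finite_subset finite_imageD infinite_UNIV_nat by metis
  next
    assume f: "finite (grothendieck_class (heart_cat D C) ` {E. endo_trivial (heart_cat D C) E})"
    define S where "S n = s (X n)" for n
    have S: "simple_object (heart_cat D (X n)) (S n)" "S n \<in> le C' (-1)" for n using s[OF XR] S_def by auto
    have nz: "\<not> is_zero D (S n)" and SX: "S n \<in> heart D (X n)" for n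
      using simple_nonzero simple_heart bounded_ts[OF R(1)[OF XR]] S by blast+
    \<comment> \<open>The bound below is inherited from the larger aisle \<open>X n\<close>; the
      bound above holds because \<open>S n\<close> desuspended is in \<open>C'\<close>, which is
      inside \<open>C[-1]\<close>.\<close>
    have SC: "S n \<in> heart D C" for n
    proof -
      have tn: "t_structure D (X n)" using bounded_ts[OF R(1)[OF XR]] .
      have "S n \<in> ge (X n) 0" using SX heart_iff[OF tn] by blast
      then have "S n \<in> ge C 0" using ge_subset[OF t tn R(3)[OF XR]] by blast
      moreover have "S n \<in> le C 0" using intermediate_le_Suc[OF t t' C1(2,3) S(2)] by simp
      ultimately show ?thesis using heart_iff[OF t] by blast
    qed
    have "grothendieck_class (heart_cat D C) (S i) \<noteq> grothendieck_class (heart_cat D C) (S j)" if "i < j" for i j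
    \<comment> \<open>The separating Euler characteristic is that of \<open>X j\<close>:
      \<open>S j\<close> is simple in its heart, while \<open>S i\<close> moved to degree -1 or
      below at the earlier tilt.\<close>
    proof (rule grothendieck_class_distinct[OF b R(1)[OF XR[of j]] R(3)[OF XR] R(5)[OF XR] R(2)[OF XR] SC[of i] _ nz SC[of j] SX nz])
      have p: "torsion_theory (X i) (ext_closure D {S i}) {E \<in> heart D (X i). orth (S i) E}"
        using simple_torsion_theory R(1,2)[OF XR] S by blast
      have "S i \<in> ext_closure D {S i}" by (rule ext_closure.ext_base) simp
      then have "sh (-1) (S i) \<in> X (Suc i)" using tilt_recover[OF R(1)[OF XR] p] unfolding XSuc S_def by blast
      moreover have "X (Suc i) \<subseteq> X j" using mono[of "Suc i" j] that by (cases "Suc i = j") auto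
      ultimately show "S i \<in> le (X j) (-1)"
        using le_iff[OF bounded_ts[OF R(1)[OF XR]]] heart_Ob[OF t SC] by blast
    qed
    then have "inj (\<lambda>n. grothendieck_class (heart_cat D C) (S n))" unfolding inj_def by (metis linorder_neqE_nat)
    moreover have "endo_trivial (heart_cat D C) (S n)" for n
      using simple_endo_trivial bounded_ts[OF R(1)[OF XR]] S SC by blast
    then have "range (\<lambda>n. grothendieck_class (heart_cat D C) (S n)) \<subseteq> grothendieck_class (heart_cat D C) ` {E. endo_trivial (heart_cat D C) E}"
      by blast
    ultimately show False using f finite_subset finite_imageD infinite_UNIV_nat by metis
  qed
qed

text \<open>The tilt X is the larger element. Algebraicity of the heart of Y comes from
  reachability.\<close>

lemma simple_tilt_iff_cover:
  assumes b: "bounded_t_structure D C" and ind: "tilt_indefinitely D C"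
    and fin: "finite (grothendieck_class (heart_cat D C) ` {E. endo_trivial (heart_cat D C) E}) \<or>
         finite (torsion_classes (heart_cat D C))"
    and X: "X \<in> intermediate D C" and Y: "Y \<in> intermediate D C"
  shows "simple_tilt D Y X \<longleftrightarrow> Y \<subset> X \<and> \<not> (\<exists>Z\<in>intermediate D C. Y \<subset> Z \<and> Z \<subset> X)"
proof -
  have bX: "bounded_t_structure D X" "C \<subseteq> X" "X \<subseteq> le C 1" and bY: "bounded_t_structure D Y" "C \<subseteq> Y" "Y \<subseteq> le C 1"
    using X Y intermediate_iff by auto
  have aY: "algebraic_heart D Y"
    using ind intermediate_reachable[OF b ind Y fin] unfolding tilt_indefinitely_def by blast
  show ?thesis
  proof
    assume "simple_tilt D Y X"
    then obtain S where S: "simple_object (heart_cat D Y) S" "X = simple_tilt_at Y S" using simple_tilt_atE[OF bY(1) aY] by blast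
    have "Z = X" if Z: "Z \<in> intermediate D C" "Y \<subset> Z" "Z \<subset> X" for Z
      using simple_tilt_at_minimal[OF bY(1) aY S(1) bounded_ts, of Z] Z S intermediate_iff by blast
    then show "Y \<subset> X \<and> \<not> (\<exists>Z\<in>intermediate D C. Y \<subset> Z \<and> Z \<subset> X)"
      using simple_tilt_at_strict[OF bY(1) aY S(1)] S by blast
  next
    assume c: "Y \<subset> X \<and> \<not> (\<exists>Z\<in>intermediate D C. Y \<subset> Z \<and> Z \<subset> X)"
    have "X \<subseteq> le Y 1" using le_subset[OF bounded_ts[OF b] bounded_ts[OF bY(1)] bY(2)] bX by blast
    then obtain S where S: "simple_object (heart_cat D Y) S" "S \<in> le X (-1)"
      using exists_simple_tilt_below[OF bY(1) aY bounded_ts[OF bX(1)]] c by blast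
    \<comment> \<open>Z is an intermediate simple tilt with Y strictly below Z and Z contained in X;
      as X covers Y, it must be X.\<close>
    define Z where "Z = simple_tilt_at Y S"
    have "Z \<subseteq> X" unfolding Z_def
      using simple_tilt_at_subset[OF bY(1) aY S(1) bounded_ts[OF bX(1)] _ S(2)] c by blast
    moreover have "Y \<subset> Z" unfolding Z_def using simple_tilt_at_strict[OF bY(1) aY S(1)] .
    moreover have st: "simple_tilt D Y Z" unfolding Z_def using simple_tilt_at[OF bY(1) aY S(1)] .
    then have "bounded_t_structure D Z" unfolding simple_tilt_def by blast
    then have "Z \<in> intermediate D C" if "Y \<subseteq> Z" "Z \<subseteq> X"
      unfolding intermediate_iff using that bX(3) bY(2) by blast
    ultimately have "Z = X" using c by blast
    then show "simple_tilt D Y X" using st by simp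
  qed
qed

end

section \<open>Comparison of the Hasse quiver and the exchange quiver\<close>

theorem proposition3p4:
  fixes D :: "('o, 'm) pretriangulated" and C :: "'o set"
  assumes "triangulated_category D"
    and "bounded_t_structure D C"
    and "algebraic_heart D C"
    and "tilt_indefinitely D C"
    and "finite (grothendieck_class (heart_cat D C) ` {E. endo_trivial (heart_cat D C) E}) \<or>
         finite (torsion_classes (heart_cat D C))"
  shows "inj_on (tilted_t_structure D C) (torsion_classes (heart_cat D C)) \<and>
         map_quiver (tilted_t_structure D C) (hasse_quiver (torsion_classes (heart_cat D C))) =
           opposite_quiver (exchange_quiver D C)"
proof -
  interpret triangulated_category D by fact
  define tors where "tors = torsion_classes (heart_cat D C)"
  define \<phi> where "\<phi> = tilted_t_structure D C"
  note b = assms(2)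
  have \<phi>: "\<phi> T = tilt C T" "T = {E \<in> heart D C. sh (-1) E \<in> \<phi> T}" "\<phi> T \<in> intermediate D C" if T: "T \<in> tors" for T
  proof -
    obtain F where F: "torsion_theory C T F" 
      using T torsion_pair_iff[OF bounded_ts[OF b]] unfolding tors_def torsion_classes_def by blast
    show 1: "\<phi> T = tilt C T" using T tilted_t_structure_eq[OF b] unfolding \<phi>_def tors_def by blast
    show "T = {E \<in> heart D C. sh (-1) E \<in> \<phi> T}" "\<phi> T \<in> intermediate D C"
      using tilt_recover[OF b F] tilt_intermediate[OF b F] 1 by auto
  qed
  \<comment> \<open>\<open>tilt\<close> is visibly monotone in the torsion class, and recovering T
    from its aisle gives the converse. So \<phi> is an order embedding and transports strict
    inclusions and covers.\<close>
  have sub: "T \<subseteq> T' \<longleftrightarrow> \<phi> T \<subseteq> \<phi> T'" if "T \<in> tors" "T' \<in> tors" for T T'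
  proof
    assume "T \<subseteq> T'" then show "\<phi> T \<subseteq> \<phi> T'" unfolding \<phi>(1)[OF that(1)] \<phi>(1)[OF that(2)] tilt_def by blast
  next
    assume "\<phi> T \<subseteq> \<phi> T'" then show "T \<subseteq> T'" using \<phi>(2)[OF that(1)] \<phi>(2)[OF that(2)] by blast
  qed
  then have strict: "T \<subset> T' \<longleftrightarrow> \<phi> T \<subset> \<phi> T'" if "T \<in> tors" "T' \<in> tors" for T T' using that by blast
  have inj: "inj_on \<phi> tors" by (rule inj_onI) (use sub in blast)
  have surj: "\<phi> ` tors = intermediate D C"
  proof
    show "intermediate D C \<subseteq> \<phi> ` tors"
      using intermediate_tilt[OF b] \<phi>(1) unfolding tors_def by (metis imageI subsetI)
  qed (use \<phi>(3) in blast)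
  have cover: "simple_tilt D (\<phi> T) (\<phi> T') \<longleftrightarrow> T \<subset> T' \<and> \<not> (\<exists>U\<in>tors. T \<subset> U \<and> U \<subset> T')"
    if "T \<in> tors" "T' \<in> tors" for T T'
    unfolding simple_tilt_iff_cover[OF b assms(4,5) \<phi>(3)[OF that(2)] \<phi>(3)[OF that(1)]]
    using strict that unfolding surj[symmetric] by auto
  \<comment> \<open>A Hasse arrow leaves the larger torsion class, whereas the simple tilt leaves
    the smaller aisle; the converse relation accounts for this.\<close>
  have "map_prod \<phi> \<phi> ` {(x, y). x \<in> tors \<and> y \<in> tors \<and> x > y \<and> \<not> (\<exists>z\<in>tors. x > z \<and> z > y)} =
      {(C1, C2). C1 \<in> intermediate D C \<and> C2 \<in> intermediate D C \<and> simple_tilt D C1 C2}\<inverse>"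
    unfolding surj[symmetric] using cover by force
  then have "map_quiver \<phi> (hasse_quiver tors) = opposite_quiver (exchange_quiver D C)"
    unfolding map_quiver_def hasse_quiver_def opposite_quiver_def exchange_quiver_def using surj by simp
  then show ?thesis using inj unfolding \<phi>_def tors_def by blast
qed

end
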